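(* Let $1\le p\le n-1$. The operator $\tilde\Box:\mathrm{dom}(\tilde\Box)\to A^2_{(p,0)}(\mathbb C^n,e^{-|z|^2})$ is bijective and has a bounded inverse $\tilde N:A^2_{(p,0)}(\mathbb C^n,e^{-|z|^2})\to\mathrm{dom}(\tilde\Box)$. In addition, $$\|\tilde Nu\|\le\frac1p\,\|u\|\qquad\text{for each }u\in A^2_{(p,0)}(\mathbb C^n,e^{-|z|^2}).$$
   Context: $A^2(\mathbb C^n,e^{-|z|^2})$ is the Fock space of entire functions $f$ with $\|f\|^2=\int_{\mathbb C^n}|f|^2e^{-|z|^2}\,d\lambda<\infty$, with the corresponding inner product $(f,g)=\int_{\mathbb C^n}f\overline g\,e^{-|z|^2}d\lambda$. $A^2_{(p,0)}(\mathbb C^n,e^{-|z|^2})$ is the Hilbert space of $(p,0)$-forms $f=\sum'_{|J|=p}f_J\,dz_J$ (sum over strictly increasing multi-indices $J$ of length $p$) with coefficients $f_J\in A^2(\mathbb C^n,e^{-|z|^2})$ and $\|f\|^2=\sum'_{|J|=p}\|f_J\|^2$. The densely defined operator $\partial f=\sum'_{|J|=p}\sum_{j=1}^n\frac{\partial f_J}{\partial z_j}\,dz_j\wedge dz_J$ has domain $\mathrm{dom}(\partial)=\{f\in A^2_{(p,0)}(\mathbb C^n,e^{-|z|^2}):\partial f\in A^2_{(p+1,0)}(\mathbb C^n,e^{-|z|^2})\}$, and $\partial^*$ is its Hilbert space adjoint (mapping $(p+1,0)$-forms to $(p,0)$-forms). On $(p,0)$-forms, $\tilde\Box=\tilde\Box_p=\partial^*\partial+\partial\partial^*$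 with $\mathrm{dom}(\tilde\Box_p)=\{f\in\mathrm{dom}(\partial)\cap\mathrm{dom}(\partial^* ):\partial f\in\mathrm{dom}(\partial^* )\text{ and }\partial^*f\in\mathrm{dom}(\partial)\}$. *)

theory Defs
  imports "HOL-Analysis.Analysis"
begin

text \<open>
  \<open>\<complex>\<^sup>n\<close> is \<open>complex ^ 'n\<close> with \<open>n = CARD('n)\<close>; its norm is the Hermitian one and \<open>lborel\<close> on it is
  Lebesgue measure on \<open>\<real>\<^sup>2\<^sup>n\<close>. The linear order on \<open>'n\<close> gives meaning to strictly increasing
  multi-indices.
\<close>

definition entire :: "(complex ^ 'n::finite \<Rightarrow> complex) \<Rightarrow> bool" where
  "entire f \<longleftrightarrow>
    (\<forall>z. \<exists>D. (f has_derivative D) (at z) \<and> (\<forall>c v. D (c *s v) = c * D v))"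

definition dz_deriv :: "'n::finite \<Rightarrow> (complex ^ 'n \<Rightarrow> complex) \<Rightarrow> complex ^ 'n \<Rightarrow> complex" where
  "dz_deriv j f z = deriv (\<lambda>w. f (z + axis j w)) 0"

text \<open>Elements are genuine functions: entire functions that agree almost everywhere are equal.\<close>

definition fock :: "(complex ^ 'n::finite \<Rightarrow> complex) set" where
  "fock = {f. entire f \<and> integrable lborel (\<lambda>z. (cmod (f z))\<^sup>2 * exp (- (norm z)\<^sup>2))}"

definition fock_inner ::
  "(complex ^ 'n::finite \<Rightarrow> complex) \<Rightarrow> (complex ^ 'n \<Rightarrow> complex) \<Rightarrow> complex" where
  "fock_inner f g = (LINT z|lborel. f z * cnj (g z) * of_real (exp (- (norm z)\<^sup>2)))"

definition fock_norm :: "(complex ^ 'n::finite \<Rightarrow> complex) \<Rightarrow> real" where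
  "fock_norm f = sqrt (LINT z|lborel. (cmod (f z))\<^sup>2 * exp (- (norm z)\<^sup>2))"

text \<open>
  A strictly increasing multi-index is represented by its set \<open>J\<close> of entries, listed in
  increasing order. A form is the family of its coefficients, \<open>f J\<close> being the coefficient of
  \<open>dz\<^sub>J\<close>; a \<open>(p,0)\<close>-form has zero coefficients at all \<open>J\<close> with \<open>card J \<noteq> p\<close>.
\<close>

type_synonym 'n form = "'n set \<Rightarrow> complex ^ 'n \<Rightarrow> complex"

definition form_add :: "'n form \<Rightarrow> 'n form \<Rightarrow> ('n::finite) form" where
  "form_add f g = (\<lambda>J z. f J z + g J z)"

definition form_scale :: "complex \<Rightarrow> 'n form \<Rightarrow> ('n::finite) form" where
  "form_scale c f = (\<lambda>J z. c * f J z)"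

definition fock_forms :: "nat \<Rightarrow> ('n::finite) form set" where
  "fock_forms p =
    {f. (\<forall>J. card J = p \<longrightarrow> f J \<in> fock) \<and> (\<forall>J. card J \<noteq> p \<longrightarrow> f J = (\<lambda>_. 0))}"

definition form_inner :: "nat \<Rightarrow> 'n form \<Rightarrow> ('n::finite) form \<Rightarrow> complex" where
  "form_inner p f g = (\<Sum>J | card J = p. fock_inner (f J) (g J))"

definition form_norm :: "nat \<Rightarrow> ('n::finite) form \<Rightarrow> real" where
  "form_norm p f = sqrt (\<Sum>J | card J = p. (fock_norm (f J))\<^sup>2)"

text \<open>
  The coefficient of \<open>dz\<^sub>K\<close> in \<open>dz\<^sub>j \<and> dz\<^sub>J\<close>. The sign comes from moving \<open>dz\<^sub>j\<close> past the
  \<open>dz\<^sub>k\<close> with \<open>k \<in> J\<close>, \<open>k < j\<close>.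
\<close>

definition wedge_coeff :: "'n::{finite,linorder} \<Rightarrow> 'n set \<Rightarrow> 'n set \<Rightarrow> complex" where
  "wedge_coeff j J K =
    (if j \<notin> J \<and> K = insert j J then (- 1) ^ card {k \<in> J. k < j} else 0)"

definition del :: "nat \<Rightarrow> 'n form \<Rightarrow> ('n::{finite,linorder}) form" where
  "del p f = (\<lambda>K z. \<Sum>J | card J = p. \<Sum>j\<in>UNIV. dz_deriv j (f J) z * wedge_coeff j J K)"

definition dom_del :: "nat \<Rightarrow> ('n::{finite,linorder}) form set" where
  "dom_del p = {f \<in> fock_forms p. del p f \<in> fock_forms (p + 1)}"

text \<open>
  \<open>del_adj p\<close> is the adjoint of \<open>del p\<close>, so it maps \<open>(p+1,0)\<close>-forms to \<open>(p,0)\<close>-forms. The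
  description is meaningful on \<open>dom_del_adj p\<close>, where \<open>h\<close> is unique since \<open>dom_del p\<close> is dense.
\<close>

definition dom_del_adj :: "nat \<Rightarrow> ('n::{finite,linorder}) form set" where
  "dom_del_adj p =
    {g \<in> fock_forms (p + 1).
      \<exists>h\<in>fock_forms p. \<forall>f\<in>dom_del p. form_inner (p + 1) (del p f) g = form_inner p f h}"

definition del_adj :: "nat \<Rightarrow> 'n form \<Rightarrow> ('n::{finite,linorder}) form" where
  "del_adj p g =
    (THE h. h \<in> fock_forms p \<and>
      (\<forall>f\<in>dom_del p. form_inner (p + 1) (del p f) g = form_inner p f h))"

text \<open>
  These are intended for \<open>p \<ge> 1\<close>: on \<open>(p,0)\<close>-forms the adjoint that lowers the degree is
  \<open>del_adj (p - 1)\<close>.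
\<close>

definition dom_box_tilde :: "nat \<Rightarrow> ('n::{finite,linorder}) form set" where
  "dom_box_tilde p =
    {f \<in> dom_del p \<inter> dom_del_adj (p - 1).
      del p f \<in> dom_del_adj p \<and> del_adj (p - 1) f \<in> dom_del (p - 1)}"

definition box_tilde :: "nat \<Rightarrow> 'n form \<Rightarrow> ('n::{finite,linorder}) form" where
  "box_tilde p f = form_add (del_adj p (del p f)) (del (p - 1) (del_adj (p - 1) f))"

definition N_tilde :: "nat \<Rightarrow> 'n form \<Rightarrow> ('n::{finite,linorder}) form" where
  "N_tilde p = inv_into (dom_box_tilde p) (box_tilde p)"

definition bounded_operator :: "nat \<Rightarrow> ('n form \<Rightarrow> ('n::finite) form) \<Rightarrow> bool" where
  "bounded_operator p T \<longleftrightarrow>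
    T ` fock_forms p \<subseteq> fock_forms p \<and>
    (\<forall>u\<in>fock_forms p. \<forall>v\<in>fock_forms p. T (form_add u v) = form_add (T u) (T v)) \<and>
    (\<forall>c. \<forall>u\<in>fock_forms p. T (form_scale c u) = form_scale c (T u)) \<and>
    (\<exists>C. \<forall>u\<in>fock_forms p. form_norm p (T u) \<le> C * form_norm p u)"

end

theory Submission
  imports Defs "HOL-Probability.Distributions" "HOL-Complex_Analysis.Cauchy_Integral_Formula"
begin

text \<open>
  On the Fock space multiplication by \<open>z\<^sub>j\<close> is the adjoint of \<open>\<partial>\<^sub>j\<close>, so the adjoint of \<open>\<partial>\<close> is the contraction
  with the Euler field \<open>\<Sum>\<^sub>j z\<^sub>j \<partial>/\<partial>z\<^sub>j\<close>, and by Cartan's formula the box operator is the Lie derivative along it: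
  it acts on every coefficient of a \<open>(p,0)\<close>-form as \<open>E + p\<close> with \<open>E = \<Sum>\<^sub>j z\<^sub>j \<partial>\<^sub>j\<close>. The inverse of \<open>E + p\<close> is
  \<open>u \<mapsto> f\<close>, \<open>f(z) = \<integral>\<^sub>0\<^sup>1 t\<^sup>p\<^sup>-\<^sup>1 u(tz) dt\<close>. Since \<open>(f, Ef) = \<Sum>\<^sub>j \<parallel>\<partial>\<^sub>jf\<parallel>\<^sup>2 \<ge> 0\<close>, pairing \<open>Ef + pf = u\<close> with \<open>f\<close> gives
  \<open>p \<parallel>f\<parallel>\<^sup>2 \<le> \<parallel>f\<parallel> \<parallel>u\<parallel>\<close>. Pairing the differentiated equation \<open>(E + p + 1) \<partial>\<^sub>kf = \<partial>\<^sub>ku\<close> with \<open>\<partial>\<^sub>kf\<close> bounds the second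
  derivatives of \<open>f\<close>, so that \<open>f\<close> lies in the domain of the box operator.
\<close>

section \<open>Gaussian integrals and isometry invariance of Lebesgue measure\<close>

text \<open>A function of the Fock space need not have its derivatives or its products with the
  coordinates in the Fock space, so the energy identities cannot be applied at weight 1 to an
  \<open>f\<close> whose regularity is still to be shown. They are proved with the weight
  \<open>exp (- s * (norm z)\<^sup>2)\<close>, \<open>s > 1\<close>, and bounds independent of
  \<open>s\<close>; monotone convergence then gives membership and the norm bound together. The
  differentiated equation has the datum \<open>\<partial>\<^sub>ku\<close>, which may again lie
  outside the space; one more integration by parts turns its pairings into one of \<open>u\<close>
  with \<open>Ef = u - pf\<close>. All calculus rests on the reproducing formula, which is the mean
  value property averaged over a rotation invariant Gaussian. Derivatives, growth and integration by
  parts are read off kernel integrals, and replacing the kernel \<open>exp\<close> by a suitable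
  power series produces the inverse of \<open>E + p\<close>. The adjoint comes with its maximal
  domain. Pairing with exponential test forms determines it pointwise, so that its domain and its
  values are known exactly.\<close>

lemma nn_integral_exp_neg_square_finite:
  fixes a :: real assumes "a > 0"
  shows "(\<integral>\<^sup>+(x::real). ennreal (exp (- a * x\<^sup>2)) \<partial>lborel) < \<infinity>"
proof -
  define s where "s = sqrt (1 / (2 * a))"
  have s: "s > 0" "s\<^sup>2 = 1 / (2 * a)" using assms by (auto simp: s_def)
  have "integrable lborel (\<lambda>x. sqrt (2 * pi * s\<^sup>2) * normal_density 0 s x)"
    using s by (intro integrable_mult_right integrable_normal_density)
  moreover have "(\<lambda>x. sqrt (2 * pi * s\<^sup>2) * normal_density 0 s x) = (\<lambda>x. exp (- a * x\<^sup>2))"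
    unfolding normal_density_def using s assms by (auto simp: fun_eq_iff field_simps)
  ultimately have "integrable lborel (\<lambda>x::real. exp (- a * x\<^sup>2))" by simp
  then show ?thesis
    by (simp add: integrable_iff_bounded)
qed

lemma integrable_exp_neg_square:
  fixes a :: real assumes "a > 0"
  shows "integrable lborel (\<lambda>z::'a::euclidean_space. exp (- a * (norm z)\<^sup>2))"
proof -
  have sq: "(norm z)\<^sup>2 = (\<Sum>b\<in>Basis. (z \<bullet> b)\<^sup>2)" for z :: 'a
    by (subst power2_norm_eq_inner, subst euclidean_inner) (simp add: power2_eq_square)
  have "(\<integral>\<^sup>+(z::'a). ennreal (exp (- a * (norm z)\<^sup>2)) \<partial>lborel)
      = (\<integral>\<^sup>+(z::'a). (\<Prod>b\<in>Basis. ennreal (exp (- a * (z \<bullet> b)\<^sup>2))) \<partial>lborel)"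
    by (intro nn_integral_cong) (simp add: sq prod_ennreal sum_distrib_left sum_negf flip: exp_sum)
  also have "\<dots> = (\<Prod>b\<in>(Basis :: 'a set). (\<integral>\<^sup>+x. ennreal (exp (- a * x\<^sup>2)) \<partial>lborel))"
    by (intro nn_integral_lborel_prod) auto
  also have "\<dots> < \<infinity>"
    using nn_integral_exp_neg_square_finite[OF assms] by (simp add: power_less_top_ennreal)
  finally show ?thesis by (auto intro!: integrableI_bounded)
qed

text \<open>Half of the quadratic decay pays for the linear term; the other half is kept so that the
  bound is still integrable.\<close>

lemma linear_minus_square_le:
  fixes a b r :: real assumes "a > 0"
  shows "b * r - a * r\<^sup>2 \<le> b\<^sup>2 / (2 * a) - (a / 2) * r\<^sup>2"
proof -
  have "b * r - a * r\<^sup>2 = b\<^sup>2 / (2 * a) - (a / 2) * r\<^sup>2 - (a / 2) * (r - b / a)\<^sup>2"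
    using assms by (simp add: field_simps power2_eq_square)
  moreover have "(a / 2) * (r - b / a)\<^sup>2 \<ge> 0" using assms by simp
  ultimately show ?thesis by linarith
qed

text \<open>Weighted arithmetic-geometric mean inequality. The free \<open>a\<close> decides how a
  product is shared: it makes a linear exponent arbitrarily cheap in growth estimates and sets the
  split in the bound for inner products.\<close>

lemma linear_le_square:
  fixes a b r :: real assumes "a > 0"
  shows "b * r \<le> b\<^sup>2 / (4 * a) + a * r\<^sup>2"
proof -
  have "b\<^sup>2 / (4 * a) + a * r\<^sup>2 - b * r = a * (r - b / (2 * a))\<^sup>2"
    using assms by (simp add: field_simps power2_eq_square)
  moreover have "a * (r - b / (2 * a))\<^sup>2 \<ge> 0" using assms by simp
  ultimately show ?thesis by linarith
qed

lemma integrable_exp_linear_minus_square: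
  fixes a b :: real assumes "a > 0"
  shows "integrable lborel (\<lambda>z::'a::euclidean_space. exp (b * norm z - a * (norm z)\<^sup>2))"
proof (rule Bochner_Integration.integrable_bound)
  show "integrable lborel (\<lambda>z::'a. exp (b\<^sup>2 / (2 * a)) * exp (- (a / 2) * (norm z)\<^sup>2))"
    using assms by (intro integrable_mult_right integrable_exp_neg_square) simp
  show "AE z in lborel. norm (exp (b * norm (z::'a) - a * (norm z)\<^sup>2))
      \<le> norm (exp (b\<^sup>2 / (2 * a)) * exp (- (a / 2) * (norm z)\<^sup>2))"
    using linear_minus_square_le[OF assms] by (auto simp flip: exp_add)
qed auto

text \<open>Comparing two ways of evaluating
  \<open>\<integral>\<integral> 1\<^sub>A(x) 1\<^sub>B(x + y) d\<mu>(x) dy\<close> shows that a translation invariant measure \<open>\<mu>\<close> satisfies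
  \<open>\<mu>(A) |B| = \<mu>(B) |A|\<close>.\<close>

lemma translation_invariant_emeasure_mult:
  fixes M :: "'a::euclidean_space measure"
  assumes [simp, measurable_cong]: "sets M = sets borel" and "sigma_finite_measure M"
    and inv: "\<And>c. distr M borel (\<lambda>x. c + x) = M"
    and [measurable]: "A \<in> sets borel" "B \<in> sets borel"
  shows "emeasure M A * emeasure lborel B = emeasure M B * emeasure lborel A"
proof -
  interpret M: sigma_finite_measure M by fact
  interpret P: pair_sigma_finite M "lborel :: 'a measure" ..
  have neg: "distr lborel borel (\<lambda>x. c - x) = (lborel :: 'a measure)" for c
    using lborel_affine[of "-1" c] by (simp add: density_1)
  have "emeasure M A * emeasure lborel B = (\<integral>\<^sup>+x. indicator A x * emeasure lborel B \<partial>M)"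
    by (simp add: nn_integral_multc)
  also have "\<dots> = (\<integral>\<^sup>+x. (\<integral>\<^sup>+y. indicator A x * indicator B (x + y) \<partial>lborel) \<partial>M)"
  proof (rule nn_integral_cong)
    fix x
    have "emeasure lborel B = (\<integral>\<^sup>+y. indicator B y \<partial>lborel)" by simp
    also have "\<dots> = (\<integral>\<^sup>+y. indicator B (x + y) \<partial>lborel)"
      by (subst lborel_distr_plus[symmetric, of x], subst nn_integral_distr) auto
    finally show "indicator A x * emeasure lborel B = (\<integral>\<^sup>+y. indicator A x * indicator B (x + y) \<partial>lborel)"
      by (simp add: nn_integral_cmult)
  qed
  also have "\<dots> = (\<integral>\<^sup>+y. (\<integral>\<^sup>+x. indicator A x * indicator B (x + y) \<partial>M) \<partial>lborel)"
    by (rule P.Fubini'[symmetric]) measurable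
  also have "\<dots> = (\<integral>\<^sup>+y. (\<integral>\<^sup>+x. indicator A (x - y) * indicator B x \<partial>M) \<partial>lborel)"
  proof (rule nn_integral_cong)
    fix y :: 'a
    show "(\<integral>\<^sup>+x. indicator A x * indicator B (x + y) \<partial>M) = (\<integral>\<^sup>+x. indicator A (x - y) * indicator B x \<partial>M)"
      by (subst (2) inv[symmetric, of y], subst nn_integral_distr) (auto simp: add.commute)
  qed
  also have "\<dots> = (\<integral>\<^sup>+x. (\<integral>\<^sup>+y. indicator A (x - y) * indicator B x \<partial>lborel) \<partial>M)"
    by (rule P.Fubini') measurable
  also have "\<dots> = (\<integral>\<^sup>+x. indicator B x * emeasure lborel A \<partial>M)"
  proof (rule nn_integral_cong)
    fix x :: 'a
    have "emeasure lborel A = (\<integral>\<^sup>+y. indicator A y \<partial>lborel)" by simp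
    also have "\<dots> = (\<integral>\<^sup>+y. indicator A (x - y) \<partial>lborel)"
      by (subst neg[symmetric, of x], subst nn_integral_distr) auto
    finally show "(\<integral>\<^sup>+y. indicator A (x - y) * indicator B x \<partial>lborel) = indicator B x * emeasure lborel A"
      by (subst nn_integral_multc) (auto simp: mult.commute)
  qed
  also have "\<dots> = emeasure M B * emeasure lborel A"
    by (simp add: nn_integral_multc)
  finally show ?thesis .
qed

text \<open>The image measure is translation invariant, because \<open>T\<close> is onto and turns
  translation by \<open>d\<close> into translation by \<open>T d\<close>, and it agrees with
  \<open>lborel\<close> on balls about 0, because \<open>T\<close> preserves norms. The
  proportionality just proved, with the unit ball as one of the sets, forces equality.\<close>

lemma lborel_distr_isometry:
  fixes T :: "'a::euclidean_space \<Rightarrow> 'a"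
  assumes "linear T" "surj T" and iso: "\<And>x. norm (T x) = norm x"
  shows "distr lborel borel T = lborel"
proof -
  let ?M = "distr lborel borel T"
  have bl: "bounded_linear T" using assms(1) by (simp add: linear_linear)
  have [measurable]: "T \<in> borel \<rightarrow>\<^sub>M borel"
    using linear_continuous_on[OF bl, of UNIV] by (rule borel_measurable_continuous_onI)
  have vimage_ball: "T -` ball 0 r = ball 0 r" for r by (auto simp: iso)
  have em_ball: "emeasure ?M (ball 0 r) = emeasure lborel (ball 0 r :: 'a set)" for r
    by (subst emeasure_distr) (auto simp: vimage_ball)
  have "sigma_finite_measure ?M"
  proof (unfold_locales, intro exI[of _ "range (\<lambda>n::nat. ball 0 (real n) :: 'a set)"] conjI ballI)
    show "\<Union> (range (\<lambda>n::nat. ball 0 (real n))) = space ?M"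
      using reals_Archimedean2 by (auto simp: space_distr)
  next
    fix A assume "A \<in> range (\<lambda>n::nat. ball 0 (real n) :: 'a set)"
    then show "emeasure ?M A \<noteq> \<infinity>"
      using em_ball emeasure_lborel_ball_finite by (metis (no_types, lifting) imageE less_irrefl)
  qed auto
  moreover have "distr ?M borel (\<lambda>x. c + x) = ?M" for c
  proof -
    obtain d where d: "c = T d" using assms(2) by auto
    have "distr ?M borel (\<lambda>x. c + x) = distr lborel borel (\<lambda>x. T (d + x))"
      by (subst distr_distr) (auto simp: comp_def d linear_add[OF assms(1)])
    also have "\<dots> = distr (distr lborel borel (\<lambda>x. d + x)) borel T"
      by (subst distr_distr) (auto simp: comp_def)
    finally show ?thesis by (simp add: lborel_distr_plus)
  qed
  ultimately have eq: "emeasure ?M A * emeasure lborel (ball 0 1 :: 'a set) = emeasure ?M (ball 0 1) * emeasure lborel A"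
    if "A \<in> sets borel" for A
    by (intro translation_invariant_emeasure_mult that) auto
  have "emeasure lborel (ball 0 1 :: 'a set) > 0"
    by (simp add: emeasure_ball unit_ball_vol_pos)
  moreover have "emeasure lborel (ball 0 1 :: 'a set) < \<infinity>" by (rule emeasure_lborel_ball_finite)
  ultimately have "emeasure ?M A = emeasure lborel A" if "A \<in> sets borel" for A
    using eq[OF that] unfolding em_ball
    by (metis ennreal_mult_cancel_left infinity_ennreal_def less_irrefl mult.commute)
  then show ?thesis by (intro measure_eqI) auto
qed

section \<open>Entire functions of several variables\<close>

text \<open>Linear in the first argument, so that \<open>exp (cdot w z)\<close> is holomorphic in
  \<open>w\<close>; up to a constant it is the reproducing kernel of the Fock space.\<close>

definition cdot :: "complex ^ 'n::finite \<Rightarrow> complex ^ 'n \<Rightarrow> complex" where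
  "cdot w z = (\<Sum>j\<in>UNIV. w $ j * cnj (z $ j))"

lemma cdot_add_left: "cdot (v + w) z = cdot v z + cdot w z"
  by (simp add: cdot_def algebra_simps sum.distrib)

lemma cdot_diff_left: "cdot (v - w) z = cdot v z - cdot w z"
  by (simp add: cdot_def algebra_simps sum_subtractf)

lemma cdot_add_right: "cdot z (v + w) = cdot z v + cdot z w"
  by (simp add: cdot_def algebra_simps sum.distrib)

lemma cnj_cdot: "cnj (cdot w z) = cdot z w"
  by (simp add: cdot_def mult.commute)

lemma cdot_zero_left [simp]: "cdot 0 z = 0"
  by (simp add: cdot_def)

lemma norm_vec_square: "(norm (z :: complex ^ 'n))\<^sup>2 = (\<Sum>j\<in>UNIV. (cmod (z $ j))\<^sup>2)"
  by (simp add: norm_vec_def L2_set_def sum_nonneg)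

lemma cdot_self: "cdot z z = of_real ((norm z)\<^sup>2)"
  by (simp only: cdot_def norm_vec_square complex_norm_square of_real_sum)

lemma norm_cdot_le: "cmod (cdot w z) \<le> norm w * norm z"
proof -
  have "cmod (cdot w z) \<le> (\<Sum>j\<in>UNIV. \<bar>cmod (w $ j)\<bar> * \<bar>cmod (z $ j)\<bar>)"
    unfolding cdot_def by (rule order_trans[OF norm_sum]) (simp add: norm_mult)
  also have "\<dots> \<le> norm w * norm z"
    unfolding norm_vec_def by (rule L2_set_mult_ineq)
  finally show ?thesis .
qed

lemma norm_add_square:
  "complex_of_real ((norm (z + w))\<^sup>2) = of_real ((norm z)\<^sup>2) + cdot z w + cdot w z + of_real ((norm w)\<^sup>2)"
  unfolding cdot_self[symmetric] by (simp add: cdot_add_left cdot_add_right)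

lemma norm_vector_smult: "norm (c *s (z :: complex ^ 'n)) = cmod c * norm z"
  by (simp add: norm_vec_def norm_mult L2_set_right_distrib)

text \<open>Lets a coordinate factor be absorbed by raising \<open>R\<close> in a bound
  \<open>exp (R * norm z)\<close>.\<close>

lemma cmod_vec_nth_le_exp: "cmod (z $ j) \<le> exp (norm (z :: complex ^ 'n))"
  by (rule order_trans[OF Finite_Cartesian_Product.norm_nth_le]) (use exp_ge_add_one_self[of "norm z"] in linarith)

lemma borel_measurable_vec_nth [measurable]:
  fixes f :: "'a \<Rightarrow> complex ^ 'n"
  assumes [measurable]: "f \<in> borel_measurable M"
  shows "(\<lambda>x. f x $ j) \<in> borel_measurable M"
proof -
  have "(\<lambda>x. x $ j) \<in> borel_measurable (borel :: (complex ^ 'n) measure)"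
    by (intro borel_measurable_continuous_onI continuous_intros)
  then show ?thesis by measurable
qed

lemma borel_measurable_cnj [measurable]:
  assumes [measurable]: "f \<in> borel_measurable M"
  shows "(\<lambda>x. cnj (f x)) \<in> borel_measurable M"
proof -
  have "cnj \<in> borel_measurable borel"
    by (intro borel_measurable_continuous_onI continuous_intros)
  then show ?thesis by measurable
qed

lemma borel_measurable_cdot [measurable]:
  assumes [measurable]: "f \<in> borel_measurable M" "g \<in> borel_measurable M"
  shows "(\<lambda>x. cdot (f x) (g x)) \<in> borel_measurable M"
  unfolding cdot_def by measurable

lemma vec_expansion: "(v :: complex ^ 'n) = (\<Sum>j\<in>UNIV. v $ j *s axis j 1)"
  by (simp add: basis_expansion)

lemma axis_eq_smult: "axis j c = c *s (axis j 1 :: complex ^ 'n)"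
  by (simp add: vec_eq_iff axis_def)

section \<open>Complex derivatives in coordinates\<close>

lemma dz_deriv_eq:
  fixes f :: "complex ^ 'n::finite \<Rightarrow> complex"
  assumes "(f has_derivative D) (at z)" "\<And>c v. D (c *s v) = c * D v"
  shows "dz_deriv j f z = D (axis j 1)"
proof -
  have "bounded_linear (\<lambda>w. axis j w :: complex ^ 'n)"
    unfolding linear_conv_bounded_linear[symmetric] by (rule linearI) (auto simp: vec_eq_iff axis_def)
  then have "((\<lambda>w. z + axis j w) has_derivative (\<lambda>w. axis j w)) (at 0)"
    by (auto intro!: derivative_eq_intros dest: bounded_linear_imp_has_derivative)
  moreover have "(f has_derivative D) (at (z + axis j 0))"
    using assms(1) by (simp add: axis_def vec_eq_iff zero_vec_def[symmetric])
  ultimately have "((\<lambda>w. f (z + axis j w)) has_derivative (\<lambda>w. D (axis j w))) (at 0)"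
    by (rule has_derivative_compose)
  moreover have "(\<lambda>w. D (axis j w)) = (*) (D (axis j 1))"
    by (subst axis_eq_smult) (auto simp: assms(2) mult.commute)
  ultimately show ?thesis
    unfolding dz_deriv_def by (intro DERIV_imp_deriv) (simp add: has_field_derivative_def)
qed

lemma entire_has_derivative:
  fixes f :: "complex ^ 'n::finite \<Rightarrow> complex"
  assumes "entire f"
  shows "(f has_derivative (\<lambda>v. \<Sum>j\<in>UNIV. v $ j * dz_deriv j f z)) (at z)"
proof -
  obtain D where D: "(f has_derivative D) (at z)" "\<And>c v. D (c *s v) = c * D v"
    using assms unfolding entire_def by blast
  interpret bounded_linear D using D(1) by (rule has_derivative_bounded_linear)
  have "D v = (\<Sum>j\<in>UNIV. v $ j * dz_deriv j f z)" for v
    by (subst vec_expansion[of v]) (simp only: sum D(2) dz_deriv_eq[OF D])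
  then have "D = (\<lambda>v. \<Sum>j\<in>UNIV. v $ j * dz_deriv j f z)" by auto
  with D(1) show ?thesis by simp
qed

lemma sum_axis_mult: "(\<Sum>i\<in>UNIV. (axis j 1 :: complex ^ 'n) $ i * d i) = d j"
proof -
  have "(\<Sum>i\<in>UNIV. (axis j 1 :: complex ^ 'n) $ i * d i) = (\<Sum>i\<in>UNIV. if i = j then d i else 0)"
    by (intro sum.cong) (auto simp: axis_def)
  then show ?thesis by simp
qed

text \<open>Converse to \<open>entire_has_derivative\<close>: a derivative in coordinate form is
  automatically complex linear. One computation yields entirety and all partial derivatives, which
  is why the two statements come in pairs below.\<close>

lemma
  fixes f :: "complex ^ 'n::finite \<Rightarrow> complex"
  assumes "\<And>z. (f has_derivative (\<lambda>v. \<Sum>j\<in>UNIV. v $ j * d j z)) (at z)"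
  shows entireI: "entire f" and dz_derivI: "dz_deriv j f z = d j z"
proof -
  have lin: "(\<Sum>j\<in>UNIV. (c *s v) $ j * d j z) = c * (\<Sum>j\<in>UNIV. v $ j * d j z)" for c z and v :: "complex ^ 'n"
    by (simp add: sum_distrib_left mult.assoc)
  show "entire f" unfolding entire_def using assms lin by blast
  show "dz_deriv j f z = d j z"
    by (subst dz_deriv_eq[OF assms lin]) (rule sum_axis_mult)
qed

lemma entire_continuous_on: "entire f \<Longrightarrow> continuous_on A f"
  by (meson entire_has_derivative has_derivative_at_withinI has_derivative_continuous_on)

lemma entire_measurable: "entire f \<Longrightarrow> f \<in> borel_measurable borel"
  by (intro borel_measurable_continuous_onI entire_continuous_on)

lemma
  assumes "entire f" "entire g"
  shows entire_add: "entire (\<lambda>z. f z + g z)"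
    and dz_deriv_add: "dz_deriv j (\<lambda>z. f z + g z) z = dz_deriv j f z + dz_deriv j g z"
proof -
  have *: "((\<lambda>z. f z + g z) has_derivative (\<lambda>v. \<Sum>j\<in>UNIV. v $ j * (dz_deriv j f z + dz_deriv j g z))) (at z)" for z
    using has_derivative_add[OF entire_has_derivative[OF assms(1)] entire_has_derivative[OF assms(2)]]
    by (simp add: algebra_simps sum.distrib)
  show "entire (\<lambda>z. f z + g z)" using * by (rule entireI)
  show "dz_deriv j (\<lambda>z. f z + g z) z = dz_deriv j f z + dz_deriv j g z" using * by (rule dz_derivI)
qed

lemma
  assumes "entire f" "entire g"
  shows entire_mult: "entire (\<lambda>z. f z * g z)"
    and dz_deriv_mult: "dz_deriv j (\<lambda>z. f z * g z) z = f z * dz_deriv j g z + dz_deriv j f z * g z"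
proof -
  have *: "((\<lambda>z. f z * g z) has_derivative (\<lambda>v. \<Sum>j\<in>UNIV. v $ j * (f z * dz_deriv j g z + dz_deriv j f z * g z))) (at z)" for z
    using has_derivative_mult[OF entire_has_derivative[OF assms(1)] entire_has_derivative[OF assms(2)]]
    by (simp add: algebra_simps sum.distrib sum_distrib_left)
  show "entire (\<lambda>z. f z * g z)" using * by (rule entireI)
  show "dz_deriv j (\<lambda>z. f z * g z) z = f z * dz_deriv j g z + dz_deriv j f z * g z" using * by (rule dz_derivI)
qed

lemma
  shows entire_const: "entire (\<lambda>z. c)" and dz_deriv_const: "dz_deriv j (\<lambda>z. c) z = 0"
proof -
  have *: "((\<lambda>z. c) has_derivative (\<lambda>v. \<Sum>j\<in>UNIV. v $ j * 0)) (at z)" for z :: "complex ^ 'n"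
    by simp
  show "entire (\<lambda>z :: complex ^ 'n. c)" using * by (rule entireI)
  show "dz_deriv j (\<lambda>z. c) z = 0" using * by (rule dz_derivI)
qed

lemma
  fixes j k :: "'n::finite"
  shows entire_coord: "entire (\<lambda>z. z $ j)"
    and dz_deriv_coord: "dz_deriv k (\<lambda>z. z $ j) z = (if k = j then 1 else 0)"
proof -
  have "((\<lambda>z. z $ j) has_derivative (\<lambda>v. v $ j)) (at z)" for z :: "complex ^ 'n"
    by (intro bounded_linear_imp_has_derivative bounded_linear_vec_nth)
  moreover have "(\<lambda>v. v $ j) = (\<lambda>v :: complex ^ 'n. \<Sum>k\<in>UNIV. v $ k * (if k = j then 1 else 0))"
    by (simp add: if_distrib cong: if_cong)
  ultimately have *: "((\<lambda>z. z $ j) has_derivative (\<lambda>v. \<Sum>k\<in>UNIV. v $ k * (if k = j then 1 else 0))) (at z)" for z :: "complex ^ 'n"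
    by simp
  show "entire (\<lambda>z :: complex ^ 'n. z $ j)" using * by (rule entireI)
  show "dz_deriv k (\<lambda>z. z $ j) z = (if k = j then 1 else 0)" using * by (rule dz_derivI)
qed

lemma
  assumes "entire f"
  shows entire_cmult: "entire (\<lambda>z. c * f z)"
    and dz_deriv_cmult: "dz_deriv j (\<lambda>z. c * f z) z = c * dz_deriv j f z"
  using entire_mult[OF entire_const assms] dz_deriv_mult[OF entire_const assms] by (auto simp: dz_deriv_const)

lemma
  assumes "entire f"
  shows entire_coord_mult: "entire (\<lambda>z. z $ j * f z)"
    and dz_deriv_coord_mult: "dz_deriv k (\<lambda>z. z $ j * f z) z = z $ j * dz_deriv k f z + (if k = j then f z else 0)"
  using entire_mult[OF entire_coord assms] dz_deriv_mult[OF entire_coord assms] by (auto simp: dz_deriv_coord)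

lemma
  fixes f :: "'i \<Rightarrow> complex ^ 'n::finite \<Rightarrow> complex"
  assumes "finite I" "\<And>i. i \<in> I \<Longrightarrow> entire (f i)"
  shows entire_sum: "entire (\<lambda>z. \<Sum>i\<in>I. f i z)"
    and dz_deriv_sum: "dz_deriv j (\<lambda>z. \<Sum>i\<in>I. f i z) z = (\<Sum>i\<in>I. dz_deriv j (f i) z)"
proof -
  have *: "entire (\<lambda>z. \<Sum>i\<in>I. f i z) \<and> (\<forall>z. dz_deriv j (\<lambda>z. \<Sum>i\<in>I. f i z) z = (\<Sum>i\<in>I. dz_deriv j (f i) z))"
    using assms
  proof (induction I rule: finite_induct)
    case empty then show ?case by (simp add: entire_const dz_deriv_const)
  next
    case (insert i I)
    then show ?case by (simp add: entire_add dz_deriv_add)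
  qed
  then show "entire (\<lambda>z. \<Sum>i\<in>I. f i z)" by blast
  show "dz_deriv j (\<lambda>z. \<Sum>i\<in>I. f i z) z = (\<Sum>i\<in>I. dz_deriv j (f i) z)" using * by blast
qed

text \<open>Serves with \<open>c = - s\<close> for the cross term of a translated Gaussian, and with
  \<open>c = 1\<close> for the test functions that determine the adjoint.\<close>

lemma
  fixes a :: "complex ^ 'n::finite"
  shows entire_exp_cdot: "entire (\<lambda>z. exp (c * cdot z a))"
    and dz_deriv_exp_cdot: "dz_deriv j (\<lambda>z. exp (c * cdot z a)) z = c * cnj (a $ j) * exp (c * cdot z a)"
proof -
  have *: "((\<lambda>z. exp (c * cdot z a)) has_derivative
      (\<lambda>v. \<Sum>j\<in>UNIV. v $ j * (c * cnj (a $ j) * exp (c * cdot z a)))) (at z)" for z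
  proof -
    have "((\<lambda>z. cdot z a) has_derivative (\<lambda>v. cdot v a)) (at z)"
      unfolding cdot_def
      by (intro has_derivative_sum has_derivative_mult_left bounded_linear_imp_has_derivative bounded_linear_vec_nth)
    then have "((\<lambda>z. exp (c * cdot z a)) has_derivative (\<lambda>v. c * cdot v a * exp (c * cdot z a))) (at z)"
      using has_derivative_compose[OF has_derivative_mult_right DERIV_exp[unfolded has_field_derivative_def]]
      by (auto simp: mult_ac)
    moreover have "(\<lambda>v. c * cdot v a * exp (c * cdot z a)) = (\<lambda>v. \<Sum>j\<in>UNIV. v $ j * (c * cnj (a $ j) * exp (c * cdot z a)))"
      unfolding cdot_def by (auto simp: sum_distrib_left sum_distrib_right algebra_simps)
    ultimately show ?thesis by simp
  qed
  show "entire (\<lambda>z. exp (c * cdot z a))" using * by (rule entireI)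
  show "dz_deriv j (\<lambda>z. exp (c * cdot z a)) z = c * cnj (a $ j) * exp (c * cdot z a)" using * by (rule dz_derivI)
qed

section \<open>The reproducing formula\<close>

text \<open>The value is \<open>(\<pi>/s)\<^sup>n\<close> with \<open>n = CARD('n)\<close>, but it
  only normalises kernels, so positivity suffices and it stays symbolic. The \<open>itself\<close>
  argument carries the dimension.\<close>

definition gauss_mass :: "'n::finite itself \<Rightarrow> real \<Rightarrow> real" where
  "gauss_mass _ s = (LINT z::complex ^ 'n|lborel. exp (- s * (norm z)\<^sup>2))"

lemma gauss_mass_pos:
  assumes "s > 0" shows "gauss_mass TYPE('n::finite) s > 0"
proof -
  have "gauss_mass TYPE('n) s \<noteq> 0"
  proof
    assume "gauss_mass TYPE('n) s = 0"
    then have "AE z::complex ^ 'n in lborel. exp (- s * (norm z)\<^sup>2) = 0"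
      unfolding gauss_mass_def using integrable_exp_neg_square[OF assms]
      by (subst (asm) integral_nonneg_eq_0_iff_AE) auto
    then have "AE z::complex ^ 'n in lborel. False" by simp
    then have "emeasure lborel (UNIV :: (complex ^ 'n) set) = 0"
      by (subst (asm) AE_iff_measurable[OF _ refl]) auto
    then show False by simp
  qed
  moreover have "gauss_mass TYPE('n) s \<ge> 0"
    unfolding gauss_mass_def by (intro integral_nonneg_AE) auto
  ultimately show ?thesis by simp
qed

lemma lborel_distr_rotation:
  assumes "cmod c = 1"
  shows "distr lborel borel (\<lambda>z::complex ^ 'n::finite. c *s z) = lborel"
proof (rule lborel_distr_isometry)
  show "linear (\<lambda>z::complex ^ 'n. c *s z)"
    by (rule linearI) (auto simp: vec_eq_iff algebra_simps)
  have "c \<noteq> 0" using assms by auto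
  then show "surj (\<lambda>z::complex ^ 'n. c *s z)"
    by (intro surjI[of _ "\<lambda>z. inverse c *s z"]) (simp add: vector_smult_assoc)
qed (simp add: norm_vector_smult assms)

text \<open>Cauchy's formula at the centre of the unit circle: the derivative of the parametrisation
  cancels the denominator up to \<open>2 * pi * \<i>\<close>.\<close>

lemma circle_mean_value:
  assumes "h holomorphic_on UNIV"
  shows "((\<lambda>t. h (cis (2 * pi * t))) has_integral h 0) {0..1}"
proof -
  have "((\<lambda>u. h u / (u - 0)) has_contour_integral 2 * of_real pi * \<i> * h 0) (circlepath 0 1)"
    using assms by (intro Cauchy_integral_circlepath_simple) (auto intro: holomorphic_on_subset)
  then have "((\<lambda>t. h (circlepath 0 1 t) / circlepath 0 1 t * vector_derivative (circlepath 0 1) (at t within {0..1}))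
      has_integral 2 * of_real pi * \<i> * h 0) {0..1}"
    by (simp add: has_contour_integral_def)
  then have "((\<lambda>t. 2 * of_real pi * \<i> * h (cis (2 * pi * t))) has_integral 2 * of_real pi * \<i> * h 0) {0..1}"
  proof (rule has_integral_eq[rotated])
    fix t :: real assume t: "t \<in> {0..1}"
    have c: "circlepath 0 1 t = cis (2 * pi * t)"
      by (simp add: circlepath cis_conv_exp mult_ac)
    have "vector_derivative (circlepath 0 1) (at t within {0..1}) = 2 * of_real pi * \<i> * cis (2 * pi * t)"
      using t vector_derivative_circlepath01[of t 0 1] by (simp add: cis_conv_exp mult_ac)
    then show "h (circlepath 0 1 t) / circlepath 0 1 t * vector_derivative (circlepath 0 1) (at t within {0..1})
        = 2 * of_real pi * \<i> * h (cis (2 * pi * t))"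
      unfolding c by simp
  qed
  from has_integral_mult_right[OF this, of "1 / (2 * of_real pi * \<i>)"] show ?thesis by simp
qed

text \<open>At \<open>c = 1\<close> the derivative is the Euler operator. Restriction to complex
  lines reduces both the mean value property and the injectivity of \<open>E + p\<close> to one
  variable.\<close>

lemma has_field_derivative_entire_line:
  assumes "entire G"
  shows "((\<lambda>c. G (c *s z)) has_field_derivative (\<Sum>j\<in>UNIV. z $ j * dz_deriv j G (c *s z))) (at c)"
proof -
  have "bounded_linear (\<lambda>c. c *s z)"
    unfolding linear_conv_bounded_linear[symmetric] by (rule linearI) (auto simp: vec_eq_iff algebra_simps)
  from has_derivative_compose[OF bounded_linear_imp_has_derivative[OF this] entire_has_derivative[OF assms]]
  show ?thesis unfolding has_field_derivative_def
    by (rule has_derivative_eq_rhs) (auto simp: fun_eq_iff sum_distrib_left mult_ac)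
qed

lemma entire_holomorphic_line:
  assumes "entire G"
  shows "(\<lambda>c. G (c *s z)) holomorphic_on UNIV"
  using has_field_derivative_entire_line[OF assms]
  by (auto simp: holomorphic_on_def field_differentiable_def intro: has_field_derivative_at_within)

text \<open>The Gaussian and Lebesgue measure are invariant under multiplication by
  \<open>cis (2 * pi * t)\<close>, so the integral may be averaged over \<open>t\<close>. By Fubini
  the average can be taken first, where it is the mean of a holomorphic function over a circle and
  equals \<open>G 0\<close>.\<close>

lemma gaussian_mean_value:
  fixes G :: "complex ^ 'n::finite \<Rightarrow> complex"
  assumes G: "entire G"
    and int: "integrable lborel (\<lambda>z. G z * of_real (exp (- s * (norm z)\<^sup>2)))"
  shows "(LINT z|lborel. G z * of_real (exp (- s * (norm z)\<^sup>2))) = of_real (gauss_mass TYPE('n) s) * G 0"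
proof -
  note [measurable] = entire_measurable[OF G]
  define \<rho> :: "complex ^ 'n \<Rightarrow> complex" where "\<rho> z = of_real (exp (- s * (norm z)\<^sup>2))" for z
  have [measurable]: "\<rho> \<in> borel_measurable borel" unfolding \<rho>_def by measurable
  have \<rho>_rot: "\<rho> (c *s z) = \<rho> z" if "cmod c = 1" for c z
    using that by (simp add: \<rho>_def norm_vector_smult)
  have [measurable]: "(\<lambda>z. c *s z) \<in> borel_measurable (borel :: (complex ^ 'n) measure)" for c
  proof -
    have "linear (\<lambda>z. c *s z)" by (rule linearI) (auto simp: vec_eq_iff algebra_simps)
    then show ?thesis
      by (intro borel_measurable_continuous_onI linear_continuous_on) (simp add: linear_linear)
  qed
  define H where "H t z = indicator {0..1::real} t *\<^sub>R (G (cis (2 * pi * t) *s z) * \<rho> z)" for t z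
  have [measurable]: "(\<lambda>(t, z). cis (2 * pi * t) *s z) \<in> borel_measurable (lborel \<Otimes>\<^sub>M (lborel :: (complex ^ 'n) measure))"
  proof -
    have "continuous_on UNIV (\<lambda>p :: real \<times> (complex ^ 'n). \<chi> i. cis (2 * pi * fst p) * snd p $ i)"
      by (intro continuous_intros)
    moreover have "(\<chi> i. cis (2 * pi * fst p) * snd p $ i) = cis (2 * pi * fst p) *s snd p" for p :: "real \<times> (complex ^ 'n)"
      by (simp add: vec_eq_iff)
    ultimately have "(\<lambda>p :: real \<times> (complex ^ 'n). cis (2 * pi * fst p) *s snd p) \<in> borel_measurable borel"
      by (intro borel_measurable_continuous_onI) simp
    then show ?thesis by (simp add: case_prod_beta borel_prod measurable_lborel1 lborel_prod)
  qed
  have H_meas [measurable]: "(\<lambda>(t, z). H t z) \<in> borel_measurable (lborel \<Otimes>\<^sub>M lborel)"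
    unfolding H_def by measurable
  have rot: "integrable lborel (\<lambda>z. f (c *s z)) \<longleftrightarrow> integrable lborel f"
    "(LINT z|lborel. f (c *s z)) = (LINT z|lborel. f z)"
    if [measurable]: "f \<in> borel_measurable borel" and c: "cmod c = 1"
    for c and f :: "complex ^ 'n \<Rightarrow> 'b::{banach,second_countable_topology}"
  proof -
    show "integrable lborel (\<lambda>z. f (c *s z)) \<longleftrightarrow> integrable lborel f"
      using integrable_distr_eq[of "\<lambda>z. c *s z" lborel borel f] by (simp add: lborel_distr_rotation[OF c])
    show "(LINT z|lborel. f (c *s z)) = (LINT z|lborel. f z)"
      using integral_distr[of "\<lambda>z. c *s z" lborel borel f] by (simp add: lborel_distr_rotation[OF c])
  qed
  have int': "integrable lborel (\<lambda>z. G z * \<rho> z)" using int by (simp add: \<rho>_def)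
  have H_rot: "H t z = indicator {0..1} t *\<^sub>R (\<lambda>z. G z * \<rho> z) (cis (2 * pi * t) *s z)" for t z
    by (simp add: H_def \<rho>_rot)
  have H_int: "integrable (lborel \<Otimes>\<^sub>M lborel) (\<lambda>(t, z). H t z)"
  proof (rule lborel_pair.Fubini_integrable)
    have "(LINT z|lborel. norm (H t z)) = indicator {0..1} t * (LINT z|lborel. norm (G z * \<rho> z))" for t
    proof -
      have "(LINT z|lborel. norm (H t z)) = indicator {0..1} t * (LINT z|lborel. (\<lambda>z. norm (G z * \<rho> z)) (cis (2 * pi * t) *s z))"
        by (simp add: H_rot)
      then show ?thesis by (subst (asm) rot(2)) auto
    qed
    then show "integrable lborel (\<lambda>t. LINT z|lborel. norm (case (t, z) of (t, z) \<Rightarrow> H t z))"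
      by (simp add: lborel_pair.integrable_fst)
    show "AE t in lborel. integrable lborel (\<lambda>z. case (t, z) of (t, z) \<Rightarrow> H t z)"
      unfolding H_rot using int' rot(1)[of "\<lambda>z. G z * \<rho> z"]
      by (auto intro!: integrable_scaleR_right)
  qed measurable
  have in_z: "(LINT z|lborel. H t z) = indicator {0..1} t *\<^sub>R (LINT z|lborel. G z * \<rho> z)" for t
    unfolding H_rot using rot(2)[of "\<lambda>z. G z * \<rho> z" "cis (2 * pi * t)"] by simp
  have in_t: "(LINT t|lborel. H t z) = G 0 * \<rho> z" for z
  proof -
    have h: "(\<lambda>c. G (c *s z)) holomorphic_on UNIV" by (rule entire_holomorphic_line[OF G])
    have "continuous_on {0..1} (\<lambda>t. G (cis (2 * pi * t) *s z))"
      by (intro continuous_on_compose2[OF holomorphic_on_imp_continuous_on[OF h]] continuous_intros) auto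
    then have si: "set_integrable lborel {0..1} (\<lambda>t. G (cis (2 * pi * t) *s z))"
      by (rule borel_integrable_compact[OF compact_Icc, folded set_integrable_def, rotated -1])
    have "(LINT t:{0..1}|lborel. G (cis (2 * pi * t) *s z)) = G 0"
      using set_borel_integral_eq_integral(2)[OF si] integral_unique[OF circle_mean_value[OF h]] by simp
    moreover have "(LINT t|lborel. H t z) = (LINT t|lborel. (indicator {0..1} t *\<^sub>R G (cis (2 * pi * t) *s z)) * \<rho> z)"
      by (simp add: H_def)
    moreover have "\<dots> = (LINT t|lborel. indicator {0..1} t *\<^sub>R G (cis (2 * pi * t) *s z)) * \<rho> z"
      using si unfolding set_integrable_def by (intro Bochner_Integration.integral_mult_left)
    ultimately show ?thesis by (simp add: set_lebesgue_integral_def)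
  qed
  have "(LINT z|lborel. G z * \<rho> z) = (LINT t|lborel. LINT z|lborel. H t z)"
    unfolding in_z by simp
  also have "\<dots> = (LINT z|lborel. LINT t|lborel. H t z)"
    by (rule lborel_pair.Fubini_integral[OF H_int, symmetric])
  also have "\<dots> = G 0 * (LINT z|lborel. \<rho> z)"
    unfolding in_t by simp
  also have "(LINT z|lborel. \<rho> z) = of_real (gauss_mass TYPE('n) s)"
    unfolding \<rho>_def gauss_mass_def by simp
  finally show ?thesis by (simp add: \<rho>_def mult.commute)
qed

text \<open>Translation by \<open>w\<close> expands the Gaussian, and the kernel cancels its factors
  with \<open>(norm w)\<^sup>2\<close> and \<open>cdot w z\<close>. Besides \<open>F (z + w)\<close>
  and the centred Gaussian only \<open>exp (- s * cdot z w)\<close> is left. It is holomorphic in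
  \<open>z\<close>, so the mean value property applies, and \<open>G 0 = F w\<close>.\<close>

lemma reproducing_formula:
  fixes F :: "complex ^ 'n::finite \<Rightarrow> complex"
  assumes F: "entire F"
    and int: "integrable lborel (\<lambda>z. F z * exp (of_real s * cdot w z) * of_real (exp (- s * (norm z)\<^sup>2)))"
  shows "(LINT z|lborel. F z * exp (of_real s * cdot w z) * of_real (exp (- s * (norm z)\<^sup>2)))
    = of_real (gauss_mass TYPE('n) s) * F w"
proof -
  define G where "G z = F (z + w) * exp (- of_real s * cdot z w)" for z
  define \<Phi> where "\<Phi> z = F z * exp (of_real s * cdot w z) * of_real (exp (- s * (norm z)\<^sup>2))" for z
  have [measurable]: "F \<in> borel_measurable borel" by (rule entire_measurable[OF F])
  have [measurable]: "\<Phi> \<in> borel_measurable borel" unfolding \<Phi>_def by measurable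
  have shift: "\<Phi> (w + z) = G z * of_real (exp (- s * (norm z)\<^sup>2))" for z
  proof -
    have "complex_of_real (exp (- s * (norm (w + z))\<^sup>2))
        = exp (- of_real s * (of_real ((norm w)\<^sup>2) + cdot w z + cdot z w + of_real ((norm z)\<^sup>2)))"
      unfolding norm_add_square[symmetric] exp_of_real[symmetric] by simp
    moreover have "cdot w (w + z) = of_real ((norm w)\<^sup>2) + cdot w z"
      by (simp only: cdot_add_right cdot_self)
    ultimately have "\<Phi> (w + z) = F (w + z) * (exp (of_real s * (of_real ((norm w)\<^sup>2) + cdot w z))
        * exp (- of_real s * (of_real ((norm w)\<^sup>2) + cdot w z + cdot z w + of_real ((norm z)\<^sup>2))))"
      unfolding \<Phi>_def by (simp only: mult.assoc)
    also have "\<dots> = F (w + z) * (exp (- of_real s * cdot z w) * exp (- of_real s * of_real ((norm z)\<^sup>2)))"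
      unfolding exp_add[symmetric] by (simp add: algebra_simps)
    also have "exp (- of_real s * of_real ((norm z)\<^sup>2)) = complex_of_real (exp (- s * (norm z)\<^sup>2))"
      unfolding exp_of_real[symmetric] by simp
    finally show ?thesis by (simp add: G_def mult_ac add.commute)
  qed
  have "entire (\<lambda>z. F (z + w))"
  proof (rule entireI)
    show "((\<lambda>z. F (z + w)) has_derivative (\<lambda>v. \<Sum>j\<in>UNIV. v $ j * dz_deriv j F (z + w))) (at z)" for z
      using has_derivative_compose[OF has_derivative_add[OF has_derivative_ident has_derivative_const] entire_has_derivative[OF F]]
      by simp
  qed
  then have G: "entire G" unfolding G_def by (intro entire_mult entire_exp_cdot)
  have int\<Phi>: "integrable lborel \<Phi>" using int by (simp add: \<Phi>_def[abs_def])
  have "integrable lborel (\<lambda>z. \<Phi> (w + z))"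
    using int\<Phi> integrable_distr_eq[of "\<lambda>z. w + z" lborel borel \<Phi>] by (simp add: lborel_distr_plus)
  then have intG: "integrable lborel (\<lambda>z. G z * of_real (exp (- s * (norm z)\<^sup>2)))" by (simp add: shift)
  have "(LINT z|lborel. \<Phi> z) = (LINT z|lborel. \<Phi> (w + z))"
    using integral_distr[of "\<lambda>z. w + z" lborel borel \<Phi>] by (simp add: lborel_distr_plus)
  also have "\<dots> = of_real (gauss_mass TYPE('n) s) * G 0"
    unfolding shift by (rule gaussian_mean_value[OF G intG])
  finally show ?thesis by (simp add: G_def \<Phi>_def)
qed

section \<open>Integral transforms with kernel \<open>\<phi>(\<langle>w,z\<rangle>)\<close>\<close>

definition gauss :: "real \<Rightarrow> complex ^ 'n::finite \<Rightarrow> real" where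
  "gauss s z = exp (- s * (norm z)\<^sup>2)"

lemma gauss_nonneg [simp]: "gauss s z \<ge> 0"
  and abs_gauss [simp]: "\<bar>gauss s z\<bar> = gauss s z"
  by (simp_all add: gauss_def)

lemma borel_measurable_gauss [measurable]: "gauss s \<in> borel_measurable borel"
  unfolding gauss_def[abs_def] by measurable

lemma integrable_bound_nonneg:
  fixes f :: "'a \<Rightarrow> 'b::{banach,second_countable_topology}"
  assumes "integrable M g" "f \<in> borel_measurable M" "\<And>x. norm (f x) \<le> g x"
  shows "integrable M f"
  using assms by (intro Bochner_Integration.integrable_bound[OF assms(1,2)]) (auto intro: order_trans[OF _ abs_ge_self])

text \<open>The Gaussian weight is meant to be part of \<open>F\<close>. Integrability against every
  exponential is what differentiating a kernel of exponential type under the integral requires, and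
  the class absorbs the factors \<open>cnj (z $ j)\<close> that each differentiation brings
  out.\<close>

definition exp_integrable :: "(complex ^ 'n::finite \<Rightarrow> complex) \<Rightarrow> bool" where
  "exp_integrable F \<longleftrightarrow> F \<in> borel_measurable borel \<and>
    (\<forall>R. integrable lborel (\<lambda>z. exp (R * norm z) * cmod (F z)))"

lemma exp_integrable_measurable: "exp_integrable F \<Longrightarrow> F \<in> borel_measurable borel"
  by (simp add: exp_integrable_def)

lemma exp_integrable_cnj_mult:
  assumes "exp_integrable F"
  shows "exp_integrable (\<lambda>z. cnj (z $ j) * F z)"
  unfolding exp_integrable_def
proof (intro conjI allI)
  have [measurable]: "F \<in> borel_measurable borel" by (rule exp_integrable_measurable[OF assms])
  show "(\<lambda>z. cnj (z $ j) * F z) \<in> borel_measurable borel" by measurable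
  fix R
  show "integrable lborel (\<lambda>z. exp (R * norm z) * cmod (cnj (z $ j) * F z))"
  proof (rule integrable_bound_nonneg)
    show "integrable lborel (\<lambda>z. exp ((R + 1) * norm z) * cmod (F z))"
      using assms unfolding exp_integrable_def by blast
    fix z :: "complex ^ 'a"
    have "cmod (z $ j) \<le> exp (norm z)"
      by (rule cmod_vec_nth_le_exp)
    then have "exp (R * norm z) * cmod (z $ j) * cmod (F z) \<le> exp (R * norm z) * exp (norm z) * cmod (F z)"
      by (intro mult_mono) auto
    then show "norm (exp (R * norm z) * cmod (cnj (z $ j) * F z)) \<le> exp ((R + 1) * norm z) * cmod (F z)"
      by (simp add: norm_mult distrib_right exp_add mult.assoc)
  qed measurable
qed

text \<open>One transform for all purposes: \<open>\<phi> = exp\<close> gives the reproducing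
  formula, \<open>\<phi> = exp_mean p\<close> the inverse of \<open>E + p\<close>.\<close>

definition kernel_int :: "(complex \<Rightarrow> complex) \<Rightarrow> (complex ^ 'n::finite \<Rightarrow> complex) \<Rightarrow> complex ^ 'n \<Rightarrow> complex" where
  "kernel_int \<phi> F w = (LINT z|lborel. F z * \<phi> (cdot w z))"

lemma kernel_integrable:
  fixes F :: "complex ^ 'n::finite \<Rightarrow> complex"
  assumes F: "exp_integrable F" and \<phi>: "continuous_on UNIV \<phi>"
    and bound: "\<And>x. cmod (\<phi> x) \<le> B * exp (s * cmod x)" and "s \<ge> 0"
  shows "integrable lborel (\<lambda>z. F z * \<phi> (cdot w z))"
proof (rule integrable_bound_nonneg)
  have [measurable]: "F \<in> borel_measurable borel" by (rule exp_integrable_measurable[OF F])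
  have [measurable]: "\<phi> \<in> borel_measurable borel" by (rule borel_measurable_continuous_onI[OF \<phi>])
  show "(\<lambda>z. F z * \<phi> (cdot w z)) \<in> borel_measurable lborel" by measurable
  have B: "B \<ge> 0" using order_trans[OF norm_ge_zero bound[of 0]] by simp
  show "integrable lborel (\<lambda>z. B * (exp ((s * norm w) * norm z) * cmod (F z)))"
    using F unfolding exp_integrable_def by (intro integrable_mult_right) blast
  show "norm (F z * \<phi> (cdot w z)) \<le> B * (exp ((s * norm w) * norm z) * cmod (F z))" for z
  proof -
    have "cmod (\<phi> (cdot w z)) \<le> B * exp (s * (norm w * norm z))"
      by (rule order_trans[OF bound[of "cdot w z"]]) (use B \<open>s \<ge> 0\<close> norm_cdot_le in \<open>auto intro!: mult_left_mono\<close>)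
    then have "cmod (F z) * cmod (\<phi> (cdot w z)) \<le> cmod (F z) * (B * exp (s * (norm w * norm z)))"
      by (intro mult_left_mono) auto
    then show ?thesis by (simp add: norm_mult mult_ac)
  qed
qed

text \<open>Differentiation under the integral by Taylor's formula: the error of the kernel is
  quadratic in \<open>cdot (y - w) z\<close> with a factor controlled by \<open>\<phi>2\<close>, and
  it integrates to a multiple of \<open>(norm (y - w))\<^sup>2\<close>. This gives the total
  derivative at once, not just the partial ones.\<close>

lemma kernel_has_derivative:
  fixes F :: "complex ^ 'n::finite \<Rightarrow> complex"
  assumes F: "exp_integrable F"
    and d1: "\<And>x. (\<phi> has_field_derivative \<phi>1 x) (at x)"
    and d2: "\<And>x. (\<phi>1 has_field_derivative \<phi>2 x) (at x)"
    and b0: "\<And>x. cmod (\<phi> x) \<le> B * exp (s * cmod x)"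
    and b1: "\<And>x. cmod (\<phi>1 x) \<le> B * exp (s * cmod x)"
    and b2: "\<And>x. cmod (\<phi>2 x) \<le> B * exp (s * cmod x)"
    and s: "s \<ge> 0"
  shows "(kernel_int \<phi> F has_derivative (\<lambda>v. \<Sum>j\<in>UNIV. v $ j * kernel_int \<phi>1 (\<lambda>z. cnj (z $ j) * F z) w)) (at w)"
proof -
  have c0: "continuous_on UNIV \<phi>" and c1: "continuous_on UNIV \<phi>1"
    using d1 d2 by (meson DERIV_isCont continuous_at_imp_continuous_on)+
  have B: "B \<ge> 0" using order_trans[OF norm_ge_zero b0[of 0]] by simp
  define D where "D v = (\<Sum>j\<in>UNIV. v $ j * kernel_int \<phi>1 (\<lambda>z. cnj (z $ j) * F z) w)" for v
  have I1: "integrable lborel (\<lambda>z. v $ j * (cnj (z $ j) * F z * \<phi>1 (cdot w z)))" for v j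
    by (intro integrable_mult_right kernel_integrable[OF exp_integrable_cnj_mult[OF F] c1 b1 s])
  have D_eq: "D v = (LINT z|lborel. F z * (\<phi>1 (cdot w z) * cdot v z))"
    and D_int: "integrable lborel (\<lambda>z. F z * (\<phi>1 (cdot w z) * cdot v z))" for v
  proof -
    have eq: "F z * (\<phi>1 (cdot w z) * cdot v z) = (\<Sum>j\<in>UNIV. v $ j * (cnj (z $ j) * F z * \<phi>1 (cdot w z)))" for z
      unfolding cdot_def[of v z] by (simp add: sum_distrib_left sum_distrib_right mult_ac)
    show "D v = (LINT z|lborel. F z * (\<phi>1 (cdot w z) * cdot v z))"
      unfolding eq D_def kernel_int_def by (subst Bochner_Integration.integral_sum) (auto intro: I1)
    show "integrable lborel (\<lambda>z. F z * (\<phi>1 (cdot w z) * cdot v z))"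
      unfolding eq by (intro Bochner_Integration.integrable_sum I1)
  qed
  \<comment> \<open>The part \<open>s * (norm w + 1)\<close> covers the kernel at all points within
    distance 1 of \<open>w\<close>; the extra 1 absorbs the factor \<open>(norm z)\<^sup>2\<close>
    of the remainder.\<close>
  define R where "R = s * (norm w + 1) + 1"
  define M where "M = (LINT z|lborel. exp (R * norm z) * cmod (F z))"
  have M_int: "integrable lborel (\<lambda>z. exp (R * norm z) * cmod (F z))"
    using F unfolding exp_integrable_def by blast
  have remainder: "cmod (kernel_int \<phi> F y - kernel_int \<phi> F w - D (y - w)) \<le> 2 * B * M * (norm (y - w))\<^sup>2"
    if y: "dist y w < 1" for y
  proof -
    have ny: "norm y \<le> norm w + 1"
      using y norm_triangle_ineq2[of y w] by (simp add: dist_norm)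
    define E where "E z = F z * (\<phi> (cdot y z) - \<phi> (cdot w z) - \<phi>1 (cdot w z) * cdot (y - w) z)" for z
    have K: "integrable lborel (\<lambda>z. F z * \<phi> (cdot u z))" for u
      by (rule kernel_integrable[OF F c0 b0 s])
    have E_eq: "E = (\<lambda>z. F z * \<phi> (cdot y z) - F z * \<phi> (cdot w z) - F z * (\<phi>1 (cdot w z) * cdot (y - w) z))"
      by (auto simp: E_def algebra_simps)
    have "kernel_int \<phi> F y - kernel_int \<phi> F w - D (y - w) = (LINT z|lborel. E z)"
      unfolding E_eq D_eq kernel_int_def using K D_int by (simp add: Bochner_Integration.integral_diff)
    also have "cmod \<dots> \<le> (LINT z|lborel. cmod (E z))" by (rule integral_norm_bound)
    also have "\<dots> \<le> (LINT z|lborel. 2 * B * (norm (y - w))\<^sup>2 * (exp (R * norm z) * cmod (F z)))"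
    proof (rule integral_mono')
      show "integrable lborel (\<lambda>z. 2 * B * (norm (y - w))\<^sup>2 * (exp (R * norm z) * cmod (F z)))"
        using M_int by (rule integrable_mult_right)
      fix z :: "complex ^ 'n"
      define r where "r = (norm w + 1) * norm z"
      have "cmod (\<phi> (cdot y z) - (\<phi> (cdot w z) + \<phi>1 (cdot w z) * (cdot y z - cdot w z)))
          \<le> B * exp (s * r) * (cmod (cdot y z - cdot w z))\<^sup>2"
      proof -
        define f where "f i = (if i = 0 then \<phi> else if i = 1 then \<phi>1 else \<phi>2)" for i :: nat
        have "cmod (f 0 (cdot y z) - (\<Sum>i\<le>1. f i (cdot w z) * (cdot y z - cdot w z) ^ i / fact i))
            \<le> B * exp (s * r) * (cmod (cdot y z - cdot w z)) ^ Suc 1 / fact 1"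
        proof (rule complex_Taylor[of "cball 0 r"])
          show "(f i has_field_derivative f (Suc i) x) (at x within cball 0 r)" if "i \<le> 1" for i x
            using that d1[of x] d2[of x] by (cases i) (auto simp: f_def intro: has_field_derivative_at_within)
          show "cmod (f (Suc 1) x) \<le> B * exp (s * r)" if "x \<in> cball 0 r" for x
            using that s B by (auto simp: f_def intro!: order_trans[OF b2[of x]] mult_left_mono)
          show "cdot w z \<in> cball 0 r" "cdot y z \<in> cball 0 r"
            using norm_cdot_le[of w z] norm_cdot_le[of y z] mult_right_mono[OF ny, of "norm z"]
              mult_right_mono[of "norm w" "norm w + 1" "norm z"] by (auto simp: r_def)
        qed (rule convex_cball)
        then show ?thesis by (simp add: f_def power2_eq_square)
      qed
      also have "\<dots> \<le> B * exp (s * r) * ((norm (y - w))\<^sup>2 * (2 * exp (norm z)))"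
      proof (rule mult_left_mono)
        have "(cmod (cdot (y - w) z))\<^sup>2 \<le> (norm (y - w) * norm z)\<^sup>2"
          by (intro power_mono norm_cdot_le) simp
        also have "\<dots> = (norm (y - w))\<^sup>2 * (norm z)\<^sup>2" by (rule power_mult_distrib)
        also have "\<dots> \<le> (norm (y - w))\<^sup>2 * (2 * exp (norm z))"
        proof (rule mult_left_mono)
          show "(norm z)\<^sup>2 \<le> 2 * exp (norm z)"
            using exp_lower_Taylor_quadratic[of "norm z"] norm_ge_zero[of z] by linarith
        qed simp
        finally show "(cmod (cdot y z - cdot w z))\<^sup>2 \<le> (norm (y - w))\<^sup>2 * (2 * exp (norm z))"
          by (simp add: cdot_diff_left)
      qed (use B in auto)
      also have "\<dots> = 2 * B * (norm (y - w))\<^sup>2 * (exp (s * r) * exp (norm z))"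
        by (simp only: mult_ac)
      also have "exp (s * r) * exp (norm z) = exp (R * norm z)"
        unfolding exp_add[symmetric] by (simp add: R_def r_def algebra_simps)
      finally have "cmod (F z) * cmod (\<phi> (cdot y z) - \<phi> (cdot w z) - \<phi>1 (cdot w z) * cdot (y - w) z)
          \<le> cmod (F z) * (2 * B * (norm (y - w))\<^sup>2 * exp (R * norm z))"
        by (intro mult_left_mono) (auto simp: cdot_diff_left algebra_simps)
      then show "cmod (E z) \<le> 2 * B * (norm (y - w))\<^sup>2 * (exp (R * norm z) * cmod (F z))"
        by (simp add: E_def norm_mult mult_ac)
      show "0 \<le> 2 * B * (norm (y - w))\<^sup>2 * (exp (R * norm z) * cmod (F z))" using B by simp
    qed
    also have "\<dots> = 2 * B * M * (norm (y - w))\<^sup>2" by (simp add: M_def)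
    finally show ?thesis .
  qed
  have "bounded_linear D"
    unfolding linear_conv_bounded_linear[symmetric] D_def
    by (rule linearI) (auto simp: algebra_simps sum.distrib scaleR_sum_right)
  then have "(kernel_int \<phi> F has_derivative D) (at w)"
  proof (rule has_derivativeI_sandwich[of 1, rotated])
    show "((\<lambda>y. 2 * B * M * norm (y - w)) \<longlongrightarrow> 0) (at w)"
      by (auto intro!: tendsto_eq_intros)
    fix y assume "y \<in> UNIV" "y \<noteq> w" "dist y w < 1"
    then show "norm (kernel_int \<phi> F y - kernel_int \<phi> F w - D (y - w)) / norm (y - w) \<le> 2 * B * M * norm (y - w)"
      using remainder[of y] by (simp add: divide_le_eq power2_eq_square mult.assoc)
  qed auto
  then show ?thesis by (simp add: D_def[abs_def])
qed

text \<open>The exponent \<open>2 * a * norm w * norm z\<close> is split so that \<open>w\<close>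
  receives the rate \<open>b\<close> and \<open>z\<close> the rate \<open>a\<^sup>2 / b\<close>:
  allowing more growth in \<open>w\<close> asks for less decay of \<open>F\<close>.\<close>

lemma kernel_growth:
  fixes F :: "complex ^ 'n::finite \<Rightarrow> complex"
  assumes a: "a > 0" "b > 0" and \<phi>: "\<And>x. cmod (\<phi> x) \<le> B * exp (2 * a * cmod x)"
    and int: "integrable lborel (\<lambda>z. exp (a\<^sup>2 / b * (norm z)\<^sup>2) * cmod (F z))"
  shows "\<exists>C. \<forall>w. cmod (kernel_int \<phi> F w) \<le> C * exp (b * (norm w)\<^sup>2)"
proof (intro exI allI)
  fix w :: "complex ^ 'n"
  have B: "B \<ge> 0" using order_trans[OF norm_ge_zero \<phi>[of 0]] by simp
  have "cmod (kernel_int \<phi> F w) \<le> (LINT z|lborel. cmod (F z * \<phi> (cdot w z)))"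
    unfolding kernel_int_def by (rule integral_norm_bound)
  also have "\<dots> \<le> (LINT z|lborel. B * exp (b * (norm w)\<^sup>2) * (exp (a\<^sup>2 / b * (norm z)\<^sup>2) * cmod (F z)))"
  proof (rule integral_mono')
    fix z :: "complex ^ 'n"
    have "2 * a * cmod (cdot w z) \<le> (2 * a * norm z) * norm w"
      using norm_cdot_le[of w z] a by (simp add: mult_ac)
    also have "\<dots> \<le> a\<^sup>2 / b * (norm z)\<^sup>2 + b * (norm w)\<^sup>2"
      using linear_le_square[OF a(2), of "2 * a * norm z" "norm w"] by (simp add: power_mult_distrib)
    finally have "cmod (\<phi> (cdot w z)) \<le> B * exp (a\<^sup>2 / b * (norm z)\<^sup>2 + b * (norm w)\<^sup>2)"
      using B by (intro order_trans[OF \<phi>[of "cdot w z"]] mult_left_mono) auto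
    then have "cmod (F z) * cmod (\<phi> (cdot w z)) \<le> cmod (F z) * (B * exp (a\<^sup>2 / b * (norm z)\<^sup>2 + b * (norm w)\<^sup>2))"
      by (intro mult_left_mono) auto
    then show "cmod (F z * \<phi> (cdot w z)) \<le> B * exp (b * (norm w)\<^sup>2) * (exp (a\<^sup>2 / b * (norm z)\<^sup>2) * cmod (F z))"
      by (simp add: norm_mult exp_add mult_ac)
    show "0 \<le> B * exp (b * (norm w)\<^sup>2) * (exp (a\<^sup>2 / b * (norm z)\<^sup>2) * cmod (F z))" using B by simp
  qed (use int in \<open>rule integrable_mult_right\<close>)
  also have "\<dots> = (B * (LINT z|lborel. exp (a\<^sup>2 / b * (norm z)\<^sup>2) * cmod (F z))) * exp (b * (norm w)\<^sup>2)"
    by simp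
  finally show "cmod (kernel_int \<phi> F w) \<le> \<dots>" .
qed

text \<open>\<open>exp_integrable\<close> is the only growth condition, so this serves Fock
  functions at \<open>s = 1\<close> as well as more general functions at larger \<open>s\<close>.
  The freedom in \<open>s\<close> is what later controls the growth of derivatives.\<close>

lemma gaussian_representation:
  fixes F :: "complex ^ 'n::finite \<Rightarrow> complex"
  assumes F: "entire F" and E: "exp_integrable (\<lambda>z. F z * of_real (gauss s z))" and s: "s > 0"
  defines "c \<equiv> complex_of_real (gauss_mass TYPE('n) s)"
  shows "F w = kernel_int (\<lambda>x. exp (of_real s * x)) (\<lambda>z. F z * of_real (gauss s z)) w / c"
    and "dz_deriv j F w = kernel_int (\<lambda>x. of_real s * exp (of_real s * x)) (\<lambda>z. cnj (z $ j) * (F z * of_real (gauss s z))) w / c"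
proof -
  \<comment> \<open>Dominates the constants 1, \<open>s\<close> and \<open>s\<^sup>2\<close> that
    the kernel and its first two derivatives carry.\<close>
  define B where "B = Max {1, s, s\<^sup>2}"
  have B: "1 \<le> B" "s \<le> B" "s\<^sup>2 \<le> B" by (auto simp: B_def)
  have B0: "0 \<le> B" using B(1) by simp
  let ?F = "\<lambda>z. F z * complex_of_real (gauss s z)"
  have expb: "cmod (exp (of_real s * x)) \<le> exp (s * cmod x)" for x :: complex
    using s by (simp add: norm_exp_eq_Re) (metis complex_Re_le_cmod mult_left_mono less_imp_le)
  have b: "cmod (of_real t * exp (of_real s * x)) \<le> B * exp (s * cmod x)" if "0 \<le> t" "t \<le> B" for t x
  proof -
    have "t * cmod (exp (of_real s * x)) \<le> B * exp (s * cmod x)"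
      by (rule mult_mono[OF that(2) expb B0 norm_ge_zero])
    then show ?thesis by (simp only: norm_mult norm_of_real abs_of_nonneg[OF that(1)])
  qed
  have b0: "cmod (exp (of_real s * x)) \<le> B * exp (s * cmod x)" for x :: complex
    using b[of 1 x] B by (simp only: of_real_1 mult_1_left zero_le_one)
  have b1: "cmod (of_real s * exp (of_real s * x)) \<le> B * exp (s * cmod x)" for x :: complex
    by (rule b) (use s B in linarith)+
  have b2: "cmod (of_real (s\<^sup>2) * exp (of_real s * x)) \<le> B * exp (s * cmod x)" for x :: complex
    by (rule b[OF zero_le_power2 B(3)])
  have c: "c \<noteq> 0" using gauss_mass_pos[OF s, where 'n='n] by (simp add: c_def)
  have int: "integrable lborel (\<lambda>z. ?F z * exp (of_real s * cdot w z))" for w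
    by (rule kernel_integrable[OF E _ b0]) (use s in \<open>auto intro!: continuous_intros\<close>)
  have rep: "F w = kernel_int (\<lambda>x. exp (of_real s * x)) ?F w / c" for w
    using reproducing_formula[OF F, of s w] int[of w] c
    by (simp add: kernel_int_def gauss_def c_def mult_ac)
  then show "F w = kernel_int (\<lambda>x. exp (of_real s * x)) ?F w / c" .
  have d1: "((\<lambda>x. exp (of_real s * x)) has_field_derivative of_real s * exp (of_real s * x)) (at x)" for x :: complex
    by (auto intro!: derivative_eq_intros)
  have d2: "((\<lambda>x. of_real s * exp (of_real s * x)) has_field_derivative of_real (s\<^sup>2) * exp (of_real s * x)) (at x)" for x :: complex
    by (auto intro!: derivative_eq_intros simp: power2_eq_square)
  define K where "K = kernel_int (\<lambda>x. exp (of_real s * x)) ?F"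
  have K': "(K has_derivative (\<lambda>v. \<Sum>j\<in>UNIV. v $ j *
      kernel_int (\<lambda>x. of_real s * exp (of_real s * x)) (\<lambda>z. cnj (z $ j) * ?F z) w)) (at w)" for w
    unfolding K_def by (rule kernel_has_derivative[OF E d1 d2 b0 b1 b2]) (use s in simp)
  have K_entire: "entire K" using K' by (rule entireI)
  have K_deriv: "dz_deriv j K w = kernel_int (\<lambda>x. of_real s * exp (of_real s * x)) (\<lambda>z. cnj (z $ j) * ?F z) w"
    using K' by (rule dz_derivI)
  have F_eq: "F = (\<lambda>w. inverse c * K w)"
    by (rule ext, rule trans[OF rep]) (simp add: K_def divide_inverse mult.commute)
  have "dz_deriv j F w = inverse c * dz_deriv j K w"
    by (subst F_eq) (rule dz_deriv_cmult[OF K_entire])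
  then show "dz_deriv j F w = kernel_int (\<lambda>x. of_real s * exp (of_real s * x)) (\<lambda>z. cnj (z $ j) * (F z * of_real (gauss s z))) w / c"
    by (simp only: K_deriv divide_inverse mult.commute)
qed

text \<open>The derivative is again a kernel transform, with kernel \<open>s * exp (s * x)\<close>,
  so differentiating once more under the integral shows that it is entire.\<close>

lemma entire_dz_deriv_representation:
  fixes F :: "complex ^ 'n::finite \<Rightarrow> complex"
  assumes F: "entire F" and E: "exp_integrable (\<lambda>z. F z * of_real (gauss s z))" and s: "s > 0"
  shows "entire (dz_deriv j F)"
proof -
  let ?F = "\<lambda>z. cnj (z $ j) * (F z * complex_of_real (gauss s z))"
  let ?c = "complex_of_real (gauss_mass TYPE('n) s)"
  have d: "((\<lambda>x. of_real (s ^ k) * exp (of_real s * x)) has_field_derivative of_real (s ^ Suc k) * exp (of_real s * x)) (at x)" for x :: complex and k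
    by (auto intro!: derivative_eq_intros)
  have b: "cmod (of_real (s ^ k) * exp (of_real s * x)) \<le> Max {s, s\<^sup>2, s ^ 3} * exp (s * cmod x)" if k: "k \<in> {1,2,3}" for x :: complex and k
  proof -
    have "s ^ k \<le> Max {s, s\<^sup>2, s ^ 3}" using k by auto
    moreover have "cmod (exp (of_real s * x)) \<le> exp (s * cmod x)"
      using s by (simp add: norm_exp_eq_Re) (metis complex_Re_le_cmod mult_left_mono less_imp_le)
    ultimately have "s ^ k * cmod (exp (of_real s * x)) \<le> Max {s, s\<^sup>2, s ^ 3} * exp (s * cmod x)"
      using s by (intro mult_mono) (auto simp: le_max_iff_disj)
    then show ?thesis using s by (simp add: norm_mult norm_power)
  qed
  have "(kernel_int (\<lambda>x. of_real (s ^ 1) * exp (of_real s * x)) ?F has_derivative (\<lambda>v. \<Sum>i\<in>UNIV. v $ i *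
      kernel_int (\<lambda>x. of_real (s ^ Suc 1) * exp (of_real s * x)) (\<lambda>z. cnj (z $ i) * ?F z) w)) (at w)" for w
    by (rule kernel_has_derivative[OF exp_integrable_cnj_mult[OF E] d d b b b]) (use s in auto)
  then have "entire (kernel_int (\<lambda>x. of_real (s ^ 1) * exp (of_real s * x)) ?F)" by (rule entireI)
  then have "entire (\<lambda>w. inverse ?c * kernel_int (\<lambda>x. of_real (s ^ 1) * exp (of_real s * x)) ?F w)"
    by (rule entire_cmult)
  moreover have "dz_deriv j F = (\<lambda>w. inverse ?c * kernel_int (\<lambda>x. of_real (s ^ 1) * exp (of_real s * x)) ?F w)"
    using gaussian_representation(2)[OF F E s] by (auto simp: fun_eq_iff divide_inverse mult.commute)
  ultimately show ?thesis by simp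
qed

section \<open>Growth of functions in the Fock space\<close>

text \<open>Functions in the Fock space are \<open>O(e\<^bsup>|z|\<^sup>2/2\<^esup>)\<close>. Allowing every exponent \<open>a > 1/2\<close> gives a class that is
  closed under \<open>\<partial>\<^sub>j\<close> and under multiplication by \<open>z\<^sub>j\<close>, and in which all products are integrable against
  \<open>e\<^bsup>-s|z|\<^sup>2\<^esup>\<close> for \<open>s > 1\<close>. Identities in the Fock space are proved for \<open>s > 1\<close> and extended to \<open>s = 1\<close> in the limit.\<close>

definition slow :: "(complex ^ 'n::finite \<Rightarrow> complex) set" where
  "slow = {F. entire F \<and> (\<forall>a>1/2. \<exists>C. \<forall>z. cmod (F z) \<le> C * exp (a * (norm z)\<^sup>2))}"

lemma slow_entire: "F \<in> slow \<Longrightarrow> entire F"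
  by (simp add: slow_def)

lemma slow_bound:
  assumes "F \<in> slow" "a > 1/2"
  obtains C where "C > 0" "\<And>z. cmod (F z) \<le> C * exp (a * (norm z)\<^sup>2)"
proof -
  obtain C where C: "\<And>z. cmod (F z) \<le> C * exp (a * (norm z)\<^sup>2)"
    using assms unfolding slow_def by blast
  show thesis
  proof (rule that[of "max C 1"])
    show "cmod (F z) \<le> max C 1 * exp (a * (norm z)\<^sup>2)" for z
      by (rule order_trans[OF C]) (intro mult_right_mono, auto)
  qed simp
qed

lemma slowI:
  assumes "entire F" "\<And>a. a > 1/2 \<Longrightarrow> \<exists>C. \<forall>z. cmod (F z) \<le> C * exp (a * (norm z)\<^sup>2)"
  shows "F \<in> slow"
  using assms by (auto simp: slow_def)

lemma slow_add:
  assumes "F \<in> slow" "G \<in> slow" shows "(\<lambda>z. F z + G z) \<in> slow"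
proof (rule slowI)
  show "entire (\<lambda>z. F z + G z)" using assms by (intro entire_add slow_entire)
  fix a :: real assume "a > 1/2"
  obtain C where C: "\<And>z. cmod (F z) \<le> C * exp (a * (norm z)\<^sup>2)" using slow_bound[OF assms(1) \<open>a > 1/2\<close>] by metis
  obtain D where D: "\<And>z. cmod (G z) \<le> D * exp (a * (norm z)\<^sup>2)" using slow_bound[OF assms(2) \<open>a > 1/2\<close>] by metis
  show "\<exists>C. \<forall>z. cmod (F z + G z) \<le> C * exp (a * (norm z)\<^sup>2)"
    by (intro exI[of _ "C + D"] allI order_trans[OF norm_triangle_ineq]) (use add_mono[OF C D] in \<open>simp add: distrib_right\<close>)
qed

lemma slow_cmult:
  assumes "F \<in> slow" shows "(\<lambda>z. c * F z) \<in> slow"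
proof (rule slowI)
  show "entire (\<lambda>z. c * F z)" using assms by (intro entire_cmult slow_entire)
  fix a :: real assume "a > 1/2"
  obtain C where C: "\<And>z. cmod (F z) \<le> C * exp (a * (norm z)\<^sup>2)" using slow_bound[OF assms(1) \<open>a > 1/2\<close>] by metis
  show "\<exists>C. \<forall>z. cmod (c * F z) \<le> C * exp (a * (norm z)\<^sup>2)"
    by (intro exI[of _ "cmod c * C"] allI) (use mult_left_mono[OF C, of "cmod c"] in \<open>simp add: norm_mult mult.assoc\<close>)
qed

lemma slow_sum:
  assumes "finite I" "\<And>i. i \<in> I \<Longrightarrow> F i \<in> slow"
  shows "(\<lambda>z. \<Sum>i\<in>I. F i z) \<in> slow"
  using assms
proof (induction I rule: finite_induct)
  case empty
  have "(\<lambda>z. 0) \<in> slow" by (rule slowI) (auto simp: entire_const intro: exI[of _ 0])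
  then show ?case by simp
next
  case (insert i I)
  then show ?case by (simp add: slow_add)
qed

lemma slow_coord_mult:
  assumes "F \<in> slow" shows "(\<lambda>z. z $ j * F z) \<in> slow"
proof (rule slowI)
  show "entire (\<lambda>z. z $ j * F z)" using assms by (intro entire_coord_mult slow_entire)
  fix a :: real assume a: "a > 1/2"
  define b where "b = (a + 1/2) / 2"
  have b: "b > 1/2" "a - b > 0" using a by (auto simp: b_def field_simps)
  obtain C where C: "C > 0" "\<And>z. cmod (F z) \<le> C * exp (b * (norm z)\<^sup>2)" using slow_bound[OF assms b(1)] by metis
  have "cmod (z $ j * F z) \<le> exp (1 / (4 * (a - b))) * C * exp (a * (norm z)\<^sup>2)" for z
  proof -
    have "cmod (z $ j) \<le> exp (norm z)"
      by (rule cmod_vec_nth_le_exp)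
    also have "\<dots> \<le> exp (1 / (4 * (a - b)) + (a - b) * (norm z)\<^sup>2)"
      using linear_le_square[OF b(2), of 1 "norm z"] by simp
    finally have "cmod (z $ j) * cmod (F z) \<le> exp (1 / (4 * (a - b)) + (a - b) * (norm z)\<^sup>2) * (C * exp (b * (norm z)\<^sup>2))"
      using C by (intro mult_mono) auto
    also have "\<dots> = C * exp (1 / (4 * (a - b)) + (a - b) * (norm z)\<^sup>2 + b * (norm z)\<^sup>2)"
      by (simp add: exp_add)
    also have "1 / (4 * (a - b)) + (a - b) * (norm z)\<^sup>2 + b * (norm z)\<^sup>2 = 1 / (4 * (a - b)) + a * (norm z)\<^sup>2"
      by (simp add: algebra_simps)
    finally show ?thesis by (simp add: norm_mult exp_add mult_ac)
  qed
  then show "\<exists>C. \<forall>z. cmod (z $ j * F z) \<le> C * exp (a * (norm z)\<^sup>2)" by blast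
qed

lemma slow_weighted_integrable:
  fixes F :: "complex ^ 'n::finite \<Rightarrow> complex"
  assumes F: "F \<in> slow" and s: "d + 1/2 < s"
  shows "integrable lborel (\<lambda>z. exp (R * norm z + d * (norm z)\<^sup>2) * (cmod (F z) * gauss s z))"
proof -
  have [measurable]: "F \<in> borel_measurable borel" by (intro entire_measurable slow_entire F)
  \<comment> \<open>Midway between 1/2 and \<open>s - d\<close>: an admissible growth rate for
    \<open>F\<close> that leaves the decay \<open>s - d - a > 0\<close>.\<close>
  define a where "a = (1/2 + (s - d)) / 2"
  have a: "a > 1/2" "s - d - a > 0" using s by (auto simp: a_def field_simps)
  obtain C where C: "C > 0" "\<And>z. cmod (F z) \<le> C * exp (a * (norm z)\<^sup>2)" using slow_bound[OF F a(1)] by metis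
  show ?thesis
  proof (rule integrable_bound_nonneg)
    show "integrable lborel (\<lambda>z::complex ^ 'n. C * exp (R * norm z - (s - d - a) * (norm z)\<^sup>2))"
      by (intro integrable_mult_right integrable_exp_linear_minus_square a)
    fix z :: "complex ^ 'n"
    have "exp (R * norm z + d * (norm z)\<^sup>2) * (cmod (F z) * gauss s z) \<le> exp (R * norm z + d * (norm z)\<^sup>2) * ((C * exp (a * (norm z)\<^sup>2)) * gauss s z)"
      by (intro mult_left_mono mult_right_mono C) auto
    also have "\<dots> = C * (exp (R * norm z + d * (norm z)\<^sup>2) * exp (a * (norm z)\<^sup>2) * exp (- s * (norm z)\<^sup>2))"
      by (simp add: gauss_def)
    also have "\<dots> = C * exp (R * norm z - (s - d - a) * (norm z)\<^sup>2)"
      unfolding exp_add[symmetric] by (simp add: algebra_simps)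
    finally show "norm (exp (R * norm z + d * (norm z)\<^sup>2) * (cmod (F z) * gauss s z)) \<le> C * exp (R * norm z - (s - d - a) * (norm z)\<^sup>2)"
      by (simp add: abs_mult)
  qed measurable
qed

lemma slow_exp_integrable:
  fixes F :: "complex ^ 'n::finite \<Rightarrow> complex"
  assumes F: "F \<in> slow" and s: "s > 1/2"
  shows "exp_integrable (\<lambda>z. F z * of_real (gauss s z))"
  unfolding exp_integrable_def
proof (intro conjI allI)
  have [measurable]: "F \<in> borel_measurable borel" by (intro entire_measurable slow_entire F)
  show "(\<lambda>z. F z * of_real (gauss s z)) \<in> borel_measurable borel" by measurable
  show "integrable lborel (\<lambda>z. exp (R * norm z) * cmod (F z * of_real (gauss s z)))" for R
    using slow_weighted_integrable[OF F, of 0 s R] s by (simp add: norm_mult)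
qed

text \<open>\<open>F\<close> is represented with the weight \<open>2 * a\<close>, where
  \<open>1/2 < a < b\<close>. Growth rate \<open>b\<close> of the transform requires integrability
  with the extra exponent \<open>a\<^sup>2 / b < a\<close>, and the weight leaves room for every
  exponent below \<open>2 * a - 1/2 > a\<close>.\<close>

lemma slow_dz_deriv:
  fixes F :: "complex ^ 'n::finite \<Rightarrow> complex"
  assumes F: "F \<in> slow" shows "dz_deriv j F \<in> slow"
proof (rule slowI)
  show "entire (dz_deriv j F)"
    by (rule entire_dz_deriv_representation[OF slow_entire[OF F] slow_exp_integrable[OF F, of 1]]) auto
  fix b :: real assume b: "b > 1/2"
  define a where "a = (b + 1/2) / 2"
  have a: "a > 1/2" "a < b" using b by (auto simp: a_def field_simps)
  have [measurable]: "F \<in> borel_measurable borel" by (intro entire_measurable slow_entire F)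
  let ?F = "\<lambda>z. cnj (z $ j) * (F z * complex_of_real (gauss (2 * a) z))"
  have "a\<^sup>2 / b < a" using a b by (simp add: power2_eq_square field_simps)
  then have lt: "a\<^sup>2 / b + 1/2 < 2 * a" using a by linarith
  have "integrable lborel (\<lambda>z. exp (a\<^sup>2 / b * (norm z)\<^sup>2) * cmod (?F z))"
  proof (rule integrable_bound_nonneg[OF slow_weighted_integrable[OF F lt, of 1]])
    fix z :: "complex ^ 'n"
    have "cmod (z $ j) \<le> exp (norm z)"
      by (rule cmod_vec_nth_le_exp)
    then have "exp (a\<^sup>2 / b * (norm z)\<^sup>2) * (cmod (z $ j) * (cmod (F z) * gauss (2 * a) z)) \<le>
      exp (a\<^sup>2 / b * (norm z)\<^sup>2) * (exp (norm z) * (cmod (F z) * gauss (2 * a) z))"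
      by (intro mult_left_mono mult_right_mono) auto
    then show "norm (exp (a\<^sup>2 / b * (norm z)\<^sup>2) * cmod (?F z)) \<le> exp (1 * norm z + a\<^sup>2 / b * (norm z)\<^sup>2) * (cmod (F z) * gauss (2 * a) z)"
      by (simp add: norm_mult exp_add mult_ac)
  qed measurable
  moreover have "cmod (of_real (2 * a) * exp (of_real (2 * a) * x)) \<le> 2 * a * exp (2 * a * cmod x)" for x :: complex
    using a complex_Re_le_cmod[of x] by (simp add: norm_mult norm_exp_eq_Re)
  ultimately obtain C where C: "\<And>w. cmod (kernel_int (\<lambda>x. of_real (2 * a) * exp (of_real (2 * a) * x)) ?F w) \<le> C * exp (b * (norm w)\<^sup>2)"
    using kernel_growth[of a b "\<lambda>x. of_real (2 * a) * exp (of_real (2 * a) * x)" "2 * a" ?F] a b by auto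
  let ?c = "gauss_mass TYPE('n) (2 * a)"
  have c: "?c > 0" using a by (intro gauss_mass_pos) simp
  have "cmod (dz_deriv j F w) \<le> C / ?c * exp (b * (norm w)\<^sup>2)" for w
  proof -
    have "cmod (dz_deriv j F w) = cmod (kernel_int (\<lambda>x. of_real (2 * a) * exp (of_real (2 * a) * x)) ?F w) / ?c"
      using gaussian_representation(2)[OF slow_entire[OF F] slow_exp_integrable[OF F], of "2 * a" j w] a c
      by (simp add: norm_divide)
    also have "\<dots> \<le> C * exp (b * (norm w)\<^sup>2) / ?c" using C c by (intro divide_right_mono) auto
    finally show ?thesis by simp
  qed
  then show "\<exists>C. \<forall>z. cmod (dz_deriv j F z) \<le> C * exp (b * (norm z)\<^sup>2)" by blast
qed

lemma slow_product_integrable: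
  fixes F G :: "complex ^ 'n::finite \<Rightarrow> complex"
  assumes F: "F \<in> slow" and G: "G \<in> slow" and s: "s > 1"
  shows "integrable lborel (\<lambda>z. F z * cnj (G z) * of_real (gauss s z))"
proof -
  have [measurable]: "F \<in> borel_measurable borel" "G \<in> borel_measurable borel"
    by (intro entire_measurable slow_entire F G)+
  define a where "a = (1 + s) / 4"
  have a: "a > 1/2" "a + 1/2 < s" using s by (auto simp: a_def field_simps)
  obtain C where C: "C > 0" "\<And>z. cmod (G z) \<le> C * exp (a * (norm z)\<^sup>2)" using slow_bound[OF G a(1)] by metis
  show ?thesis
  proof (rule integrable_bound_nonneg)
    show "integrable lborel (\<lambda>z. C * (exp (0 * norm z + a * (norm z)\<^sup>2) * (cmod (F z) * gauss s z)))"
      by (intro integrable_mult_right slow_weighted_integrable F a)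
    fix z
    have "cmod (F z) * cmod (G z) * gauss s z \<le> cmod (F z) * (C * exp (a * (norm z)\<^sup>2)) * gauss s z"
      by (intro mult_left_mono mult_right_mono C) auto
    then show "norm (F z * cnj (G z) * of_real (gauss s z)) \<le> C * (exp (0 * norm z + a * (norm z)\<^sup>2) * (cmod (F z) * gauss s z))"
      by (simp add: norm_mult mult_ac)
  qed measurable
qed

section \<open>Integrability and growth of Fock functions\<close>

lemma fock_entire: "f \<in> fock \<Longrightarrow> entire f"
  by (simp add: fock_def)

lemma fock_integrable: "f \<in> fock \<Longrightarrow> integrable lborel (\<lambda>z. (cmod (f z))\<^sup>2 * gauss 1 z)"
  by (simp add: fock_def gauss_def)

text \<open>Square integrability is traded for integrability by halving the Gaussian:
  \<open>A\<close> is \<open>f\<close> with half the weight, \<open>B\<close> collects the rest and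
  decays because \<open>d < 1/2\<close>, and \<open>A * B\<close> is bounded by the sum of the
  squares.\<close>

lemma fock_weighted_integrable:
  fixes f :: "complex ^ 'n::finite \<Rightarrow> complex"
  assumes f: "f \<in> fock" and d: "d < 1/2"
  shows "integrable lborel (\<lambda>z. exp (R * norm z + d * (norm z)\<^sup>2) * (cmod (f z) * gauss 1 z))"
proof (rule integrable_bound_nonneg)
  have [measurable]: "f \<in> borel_measurable borel" by (intro entire_measurable fock_entire f)
  show "integrable lborel (\<lambda>z. (cmod (f z))\<^sup>2 * gauss 1 z + exp (2 * R * norm z - (1 - 2 * d) * (norm z)\<^sup>2))"
    using d by (intro Bochner_Integration.integrable_add fock_integrable f integrable_exp_linear_minus_square) simp
  fix z :: "complex ^ 'n"
  define A where "A = cmod (f z) * exp (- 1/2 * (norm z)\<^sup>2)"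
  define B where "B = exp (R * norm z - (1/2 - d) * (norm z)\<^sup>2)"
  have "exp (R * norm z + d * (norm z)\<^sup>2) * (cmod (f z) * gauss 1 z) = A * B"
  proof -
    have "exp (R * norm z + d * (norm z)\<^sup>2) * gauss 1 z = exp (- 1/2 * (norm z)\<^sup>2) * B"
      unfolding B_def gauss_def exp_add[symmetric] by (simp add: algebra_simps)
    then show ?thesis by (simp add: A_def mult_ac)
  qed
  also have "\<dots> \<le> A\<^sup>2 + B\<^sup>2"
  proof -
    have "A \<ge> 0" "B \<ge> 0" by (auto simp: A_def B_def)
    then have "A * B \<ge> 0" by simp
    moreover have "2 * A * B \<le> A\<^sup>2 + B\<^sup>2" by (rule sum_squares_bound)
    ultimately show ?thesis by linarith
  qed
  also have "A\<^sup>2 = (cmod (f z))\<^sup>2 * gauss 1 z"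
    by (simp add: A_def gauss_def power_mult_distrib flip: exp_of_nat_mult)
  also have "B\<^sup>2 = exp (2 * R * norm z - (1 - 2 * d) * (norm z)\<^sup>2)"
    by (simp add: B_def algebra_simps flip: exp_of_nat_mult)
  finally show "norm (exp (R * norm z + d * (norm z)\<^sup>2) * (cmod (f z) * gauss 1 z))
      \<le> (cmod (f z))\<^sup>2 * gauss 1 z + exp (2 * R * norm z - (1 - 2 * d) * (norm z)\<^sup>2)"
    by (simp add: abs_mult)
next
  have [measurable]: "f \<in> borel_measurable borel" by (intro entire_measurable fock_entire f)
  show "(\<lambda>z. exp (R * norm z + d * (norm z)\<^sup>2) * (cmod (f z) * gauss 1 z)) \<in> borel_measurable lborel" by measurable
qed

lemma fock_exp_integrable:
  fixes f :: "complex ^ 'n::finite \<Rightarrow> complex"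
  assumes f: "f \<in> fock"
  shows "exp_integrable (\<lambda>z. f z * of_real (gauss 1 z))"
  unfolding exp_integrable_def
proof (intro conjI allI)
  have [measurable]: "f \<in> borel_measurable borel" by (intro entire_measurable fock_entire f)
  show "(\<lambda>z. f z * of_real (gauss 1 z)) \<in> borel_measurable borel" by measurable
  show "integrable lborel (\<lambda>z. exp (R * norm z) * cmod (f z * of_real (gauss 1 z)))" for R
    using fock_weighted_integrable[OF f, of 0 R] by (simp add: norm_mult)
qed

text \<open>The origin of the threshold 1/2: a kernel bounded by \<open>exp (cmod x)\<close> means
  \<open>a = 1/2\<close>, and growth rate \<open>b\<close> then needs the extra exponent
  \<open>1 / (4 * b)\<close>, which is below the limit 1/2 for Fock functions precisely when
  \<open>b > 1/2\<close>.\<close>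

lemma kernel_slow_growth:
  fixes f :: "complex ^ 'n::finite \<Rightarrow> complex"
  assumes f: "f \<in> fock" and \<phi>: "\<And>x. cmod (\<phi> x) \<le> exp (cmod x)" and b: "b > 1/2"
  shows "\<exists>C. \<forall>w. cmod (kernel_int \<phi> (\<lambda>z. f z * of_real (gauss 1 z)) w) \<le> C * exp (b * (norm w)\<^sup>2)"
proof (rule kernel_growth[of "1/2" b \<phi> 1])
  have "(1/2)\<^sup>2 / b < 1/2" using b by (simp add: power2_eq_square field_simps)
  from fock_weighted_integrable[OF f this, of 0]
  show "integrable lborel (\<lambda>z. exp ((1/2)\<^sup>2 / b * (norm z)\<^sup>2) * cmod (f z * of_real (gauss 1 z)))"
    by (simp add: norm_mult)
qed (use \<phi> b in auto)

lemma fock_subset_slow: "fock \<subseteq> slow"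
proof
  fix f :: "complex ^ 'n::finite \<Rightarrow> complex" assume f: "f \<in> fock"
  let ?c = "gauss_mass TYPE('n) 1"
  have c: "?c > 0" by (intro gauss_mass_pos) simp
  show "f \<in> slow"
  proof (rule slowI[OF fock_entire[OF f]])
    fix b :: real assume "b > 1/2"
    then obtain C where C: "\<And>w. cmod (kernel_int exp (\<lambda>z. f z * of_real (gauss 1 z)) w) \<le> C * exp (b * (norm w)\<^sup>2)"
      using kernel_slow_growth[OF f, of exp b] by (auto simp: norm_exp_eq_Re complex_Re_le_cmod)
    have "cmod (f w) \<le> C / ?c * exp (b * (norm w)\<^sup>2)" for w
    proof -
      have "cmod (f w) = cmod (kernel_int exp (\<lambda>z. f z * of_real (gauss 1 z)) w) / ?c"
        using gaussian_representation(1)[OF fock_entire[OF f] fock_exp_integrable[OF f], of w] c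
        by (simp add: norm_divide)
      also have "\<dots> \<le> C * exp (b * (norm w)\<^sup>2) / ?c" using C c by (intro divide_right_mono) auto
      finally show ?thesis by simp
    qed
    then show "\<exists>C. \<forall>z. cmod (f z) \<le> C * exp (b * (norm z)\<^sup>2)" by blast
  qed
qed

section \<open>Integration by parts\<close>

definition weighted_inner ::
  "real \<Rightarrow> (complex ^ 'n::finite \<Rightarrow> complex) \<Rightarrow> (complex ^ 'n \<Rightarrow> complex) \<Rightarrow> complex" where
  "weighted_inner s f g = (LINT z|lborel. f z * cnj (g z) * of_real (gauss s z))"

definition weighted_norm2 :: "real \<Rightarrow> (complex ^ 'n::finite \<Rightarrow> complex) \<Rightarrow> real" where
  "weighted_norm2 s f = (LINT z|lborel. (cmod (f z))\<^sup>2 * gauss s z)"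

lemma fock_inner_eq: "fock_inner f g = weighted_inner 1 f g"
  by (simp add: fock_inner_def weighted_inner_def gauss_def)

lemma fock_norm_eq: "fock_norm f = sqrt (weighted_norm2 1 f)"
  by (simp add: fock_norm_def weighted_norm2_def gauss_def)

lemma weighted_norm2_nonneg: "weighted_norm2 s f \<ge> 0"
  unfolding weighted_norm2_def by (intro integral_nonneg_AE) auto

lemma weighted_inner_self: "weighted_inner s f f = of_real (weighted_norm2 s f)"
  unfolding weighted_inner_def weighted_norm2_def integral_complex_of_real[symmetric]
  by (intro Bochner_Integration.integral_cong) (auto simp: complex_norm_square[symmetric] simp flip: of_real_power)

lemma cnj_weighted_inner: "cnj (weighted_inner s f g) = weighted_inner s g f"
  unfolding weighted_inner_def Bochner_Integration.integral_cnj[symmetric] by (simp add: mult_ac)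

lemma weighted_inner_diff_right:
  assumes "s > 1" "f \<in> slow" "g \<in> slow" "h \<in> slow"
  shows "weighted_inner s f (\<lambda>z. g z - c * h z) = weighted_inner s f g - cnj c * weighted_inner s f h"
proof -
  have "weighted_inner s f (\<lambda>z. g z - c * h z) =
    (LINT z|lborel. f z * cnj (g z) * of_real (gauss s z) - cnj c * (f z * cnj (h z) * of_real (gauss s z)))"
    unfolding weighted_inner_def by (simp add: algebra_simps)
  also have "\<dots> = weighted_inner s f g - cnj c * weighted_inner s f h"
    unfolding weighted_inner_def using assms
    by (subst Bochner_Integration.integral_diff) (auto intro!: slow_product_integrable)
  finally show ?thesis .
qed

lemma weighted_inner_add_left:
  assumes "s > 1" "f \<in> slow" "g \<in> slow" "h \<in> slow"
  shows "weighted_inner s (\<lambda>z. f z + g z) h = weighted_inner s f h + weighted_inner s g h"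
  unfolding weighted_inner_def distrib_right using assms
  by (subst Bochner_Integration.integral_add) (auto intro!: slow_product_integrable)

lemma weighted_inner_sum_right:
  assumes "s > 1" "f \<in> slow" "\<And>i. i \<in> I \<Longrightarrow> g i \<in> slow"
  shows "weighted_inner s f (\<lambda>z. \<Sum>i\<in>I. g i z) = (\<Sum>i\<in>I. weighted_inner s f (g i))"
  unfolding weighted_inner_def cnj_sum sum_distrib_left sum_distrib_right using assms
  by (subst Bochner_Integration.integral_sum) (auto intro!: slow_product_integrable)

text \<open>Inserting the reproducing formula for \<open>G\<close> into the formula for \<open>\<partial>\<^sub>jF\<close> obtained by differentiating
  that of \<open>F\<close> turns \<open>\<partial>\<^sub>j\<close> into multiplication by \<open>z\<^sub>j\<close>, without any boundary terms.\<close>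

lemma weighted_inner_dz_deriv:
  fixes F G :: "complex ^ 'n::finite \<Rightarrow> complex"
  assumes s: "s > 1" and F: "F \<in> slow" and G: "G \<in> slow"
  shows "weighted_inner s (dz_deriv j F) G = of_real s * weighted_inner s F (\<lambda>z. z $ j * G z)"
proof -
  have [measurable]: "F \<in> borel_measurable borel" "G \<in> borel_measurable borel"
    by (intro entire_measurable slow_entire F G)+
  define c where "c = complex_of_real (gauss_mass TYPE('n) s)"
  have c: "c \<noteq> 0" using gauss_mass_pos[of s, where 'n='n] s by (simp add: c_def)
  define \<Phi> where "\<Phi> z w = F z * cnj (z $ j) * of_real (gauss s z) * exp (of_real s * cdot w z)
      * (cnj (G w) * of_real (gauss s w))" for z w
  have G_exp: "integrable lborel (\<lambda>w. G w * exp (of_real s * cdot z w) * of_real (gauss s w))" for z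
  proof -
    have "continuous_on UNIV (\<lambda>x. exp (complex_of_real s * x))" by (intro continuous_intros)
    then have "integrable lborel (\<lambda>w. G w * of_real (gauss s w) * exp (of_real s * cdot z w))"
      using s complex_Re_le_cmod
      by (intro kernel_integrable[OF slow_exp_integrable[OF G], where B=1 and s=s]) (auto simp: norm_exp_eq_Re)
    then show ?thesis by (simp only: mult_ac)
  qed
  have "(LINT w|lborel. G w * exp (of_real s * cdot z w) * of_real (gauss s w)) = c * G z" for z
    using reproducing_formula[OF slow_entire[OF G], of s z] G_exp[of z] by (simp add: gauss_def c_def)
  then have in_w: "(LINT w|lborel. \<Phi> z w) = c * (F z * cnj (z $ j * G z) * of_real (gauss s z))" for z
  proof -
    assume *: "\<And>z. (LINT w|lborel. G w * exp (of_real s * cdot z w) * of_real (gauss s w)) = c * G z"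
    have "(LINT w|lborel. \<Phi> z w) = F z * cnj (z $ j) * of_real (gauss s z)
        * (LINT w|lborel. cnj (G w * exp (of_real s * cdot z w) * of_real (gauss s w)))"
      by (simp add: \<Phi>_def cnj_cdot exp_cnj mult_ac flip: Bochner_Integration.integral_mult_right_zero)
    also have "\<dots> = F z * cnj (z $ j) * of_real (gauss s z) * cnj (c * G z)"
      unfolding Bochner_Integration.integral_cnj * ..
    finally show ?thesis by (simp add: c_def mult_ac)
  qed
  have rep: "dz_deriv j F w = of_real s / c * (LINT z|lborel. F z * cnj (z $ j) * of_real (gauss s z) * exp (of_real s * cdot w z))" for w
    using gaussian_representation(2)[OF slow_entire[OF F] slow_exp_integrable[OF F, of s], of j w] s
    by (simp add: kernel_int_def c_def mult_ac flip: Bochner_Integration.integral_mult_right_zero)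
  have in_z: "(LINT z|lborel. \<Phi> z w) = c / of_real s * (dz_deriv j F w * cnj (G w) * of_real (gauss s w))" for w
    using s c by (simp add: rep \<Phi>_def)
  have [measurable]: "(\<lambda>(z, w). \<Phi> z w) \<in> borel_measurable (lborel \<Otimes>\<^sub>M lborel)"
    unfolding \<Phi>_def by measurable
  \<comment> \<open>The kernel costs at most
    \<open>exp (s / 2 * (norm z)\<^sup>2 + s / 2 * (norm w)\<^sup>2)\<close>, half of each Gaussian.
    The remaining weight \<open>s / 2 > 1/2\<close> still beats the growth of slow functions, so
    \<open>\<Phi>\<close> is dominated by an integrable product and Fubini applies.\<close>
  define a where "a z = cmod (z $ j * F z) * gauss (s / 2) z" for z
  define b where "b w = cmod (G w) * gauss (s / 2) w" for w
  have [measurable]: "a \<in> borel_measurable borel" "b \<in> borel_measurable borel"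
    unfolding a_def b_def by measurable
  have a: "integrable lborel a"
    using slow_weighted_integrable[OF slow_coord_mult[OF F], of 0 "s / 2" 0] s by (simp add: a_def[abs_def])
  have b: "integrable lborel b"
    using slow_weighted_integrable[OF G, of 0 "s / 2" 0] s by (simp add: b_def[abs_def])
  have half: "gauss s x * exp (s / 2 * (norm x)\<^sup>2) = gauss (s / 2) x" for x :: "complex ^ 'n"
    unfolding gauss_def exp_add[symmetric] by (simp add: field_simps)
  have bound: "cmod (\<Phi> z w) \<le> a z * b w" for z w
  proof -
    have "s * Re (cdot w z) \<le> s * cmod (cdot w z)"
      using s by (intro mult_left_mono complex_Re_le_cmod) auto
    also have "\<dots> \<le> s * (norm w * norm z)"
      using s norm_cdot_le by (intro mult_left_mono) auto
    also have "\<dots> \<le> s / 2 * (norm z)\<^sup>2 + s / 2 * (norm w)\<^sup>2"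
      using mult_left_mono[OF sum_squares_bound[of "norm w" "norm z"], of "s / 2"] s by (simp add: algebra_simps)
    finally have "cmod (exp (of_real s * cdot w z)) \<le> exp (s / 2 * (norm z)\<^sup>2 + s / 2 * (norm w)\<^sup>2)"
      by (simp add: norm_exp_eq_Re)
    then have "cmod (\<Phi> z w) \<le> cmod (z $ j * F z) * gauss s z * exp (s / 2 * (norm z)\<^sup>2 + s / 2 * (norm w)\<^sup>2) * (cmod (G w) * gauss s w)"
      by (simp add: \<Phi>_def norm_mult mult_ac mult_left_mono)
    also have "\<dots> = cmod (z $ j * F z) * (gauss s z * exp (s / 2 * (norm z)\<^sup>2)) * (cmod (G w) * (gauss s w * exp (s / 2 * (norm w)\<^sup>2)))"
      by (simp add: exp_add)
    also have "\<dots> = a z * b w"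
      unfolding a_def b_def half ..
    finally show ?thesis .
  qed
  have "integrable (lborel \<Otimes>\<^sub>M lborel) (\<lambda>(z, w). a z * b w)"
  proof (rule lborel_pair.Fubini_integrable)
    have "a z \<ge> 0" "b z \<ge> 0" for z by (auto simp: a_def b_def)
    then show "integrable lborel (\<lambda>z. LINT w|lborel. norm (case (z, w) of (z, w) \<Rightarrow> a z * b w))"
      using a by (simp add: abs_mult)
  qed (use b in auto)
  then have "integrable (lborel \<Otimes>\<^sub>M lborel) (\<lambda>(z, w). \<Phi> z w)"
    by (rule integrable_bound_nonneg) (use bound in auto)
  then have "(LINT w|lborel. LINT z|lborel. \<Phi> z w) = (LINT z|lborel. LINT w|lborel. \<Phi> z w)"
    by (rule lborel_pair.Fubini_integral)
  then have "c / of_real s * weighted_inner s (dz_deriv j F) G = c * weighted_inner s F (\<lambda>z. z $ j * G z)"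
    unfolding in_w in_z weighted_inner_def by simp
  then show ?thesis using c s by (simp add: field_simps)
qed

section \<open>Estimates uniform in the weight and passage to the Fock norm\<close>

lemma weighted_norm2_integrable:
  assumes "F \<in> slow" "s > 1"
  shows "integrable lborel (\<lambda>z. (cmod (F z))\<^sup>2 * gauss s z)"
proof -
  have "(\<lambda>z. F z * cnj (F z) * of_real (gauss s z)) = (\<lambda>z. complex_of_real ((cmod (F z))\<^sup>2 * gauss s z))"
    by (rule ext) (simp only: of_real_mult complex_norm_square)
  then have "integrable lborel (\<lambda>z. complex_of_real ((cmod (F z))\<^sup>2 * gauss s z))"
    using slow_product_integrable[OF assms(1,1,2)] by simp
  then show ?thesis by (simp only: complex_of_real_integrable_eq)
qed

lemma gauss_antimono: "s \<le> t \<Longrightarrow> gauss t z \<le> gauss s z"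
  by (simp add: gauss_def mult_right_mono)

lemma weighted_norm2_le_fock:
  assumes "f \<in> fock" "s > 1"
  shows "weighted_norm2 s f \<le> weighted_norm2 1 f"
  unfolding weighted_norm2_def
  by (intro integral_mono' fock_integrable assms mult_left_mono gauss_antimono) (use assms in auto)

text \<open>Young's inequality in place of Cauchy-Schwarz. With this split, half of
  \<open>p * weighted_norm2 s f\<close> in the energy identity absorbs the first term, and the rest
  gives exactly the constant \<open>1 / p\<^sup>2\<close> for squared norms.\<close>

lemma weighted_inner_le:
  assumes s: "s > 1" and f: "f \<in> slow" and g: "g \<in> slow" and p: "p > 0"
  shows "cmod (weighted_inner s f g) \<le> p / 2 * weighted_norm2 s f + 1 / (2 * p) * weighted_norm2 s g"
proof -
  have "cmod (weighted_inner s f g) \<le> (LINT z|lborel. cmod (f z * cnj (g z) * of_real (gauss s z)))"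
    unfolding weighted_inner_def by (rule integral_norm_bound)
  also have "\<dots> \<le> (LINT z|lborel. p / 2 * ((cmod (f z))\<^sup>2 * gauss s z) + 1 / (2 * p) * ((cmod (g z))\<^sup>2 * gauss s z))"
  proof (rule integral_mono')
    show "integrable lborel (\<lambda>z. p / 2 * ((cmod (f z))\<^sup>2 * gauss s z) + 1 / (2 * p) * ((cmod (g z))\<^sup>2 * gauss s z))"
      using assms by (intro Bochner_Integration.integrable_add integrable_mult_right weighted_norm2_integrable)
    fix z
    have "cmod (f z) * cmod (g z) \<le> p / 2 * (cmod (f z))\<^sup>2 + 1 / (2 * p) * (cmod (g z))\<^sup>2"
      using linear_le_square[of "p / 2" "cmod (g z)" "cmod (f z)"] p by (simp add: mult.commute)
    from mult_right_mono[OF this gauss_nonneg, of s z]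
    show "cmod (f z * cnj (g z) * of_real (gauss s z)) \<le> p / 2 * ((cmod (f z))\<^sup>2 * gauss s z) + 1 / (2 * p) * ((cmod (g z))\<^sup>2 * gauss s z)"
      by (simp add: norm_mult algebra_simps)
    show "0 \<le> p / 2 * ((cmod (f z))\<^sup>2 * gauss s z) + 1 / (2 * p) * ((cmod (g z))\<^sup>2 * gauss s z)"
      using p by (intro add_nonneg_nonneg) auto
  qed
  also have "\<dots> = p / 2 * weighted_norm2 s f + 1 / (2 * p) * weighted_norm2 s g"
    unfolding weighted_norm2_def using assms
    by (subst Bochner_Integration.integral_add) (auto intro!: integrable_mult_right weighted_norm2_integrable)
  finally show ?thesis .
qed

text \<open>The integrands increase as \<open>s\<close> decreases to 1, so by monotone convergence a
  uniform bound gives integrability at weight 1 and passes to the limit. The restriction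
  \<open>s < 2\<close> lets factors \<open>s\<close> in such bounds be replaced by 2.\<close>

lemma fock_if_bounded:
  fixes F :: "complex ^ 'n::finite \<Rightarrow> complex"
  assumes F: "F \<in> slow" and bd: "\<And>s. 1 < s \<Longrightarrow> s < 2 \<Longrightarrow> weighted_norm2 s F \<le> B"
  shows "F \<in> fock" and "weighted_norm2 1 F \<le> B"
proof -
  \<comment> \<open>The shift by 2 keeps even \<open>s 0\<close> strictly below 2.\<close>
  define s where "s k = 1 + 1 / real (k + 2)" for k
  have s: "s k > 1" "s k < 2" for k by (auto simp: s_def field_simps)
  have s_dec: "s (Suc k) \<le> s k" for k by (simp add: s_def field_simps)
  have s_lim: "s \<longlonglongrightarrow> 1"
    unfolding s_def by (rule tendsto_eq_rhs[OF tendsto_add[OF tendsto_const LIMSEQ_ignore_initial_segment[OF lim_1_over_n]]]) simp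
  let ?f = "\<lambda>k z. (cmod (F z))\<^sup>2 * gauss (s k) z"
  have [measurable]: "F \<in> borel_measurable borel" by (intro entire_measurable slow_entire F)
  have mono_norm: "incseq (\<lambda>k. weighted_norm2 (s k) F)"
    unfolding weighted_norm2_def
    by (intro incseq_SucI integral_mono' weighted_norm2_integrable F s mult_left_mono gauss_antimono s_dec) auto
  have "Bseq (\<lambda>k. weighted_norm2 (s k) F)"
    using bd s weighted_norm2_nonneg[of _ F] by (intro BseqI'[of _ B]) (simp add: abs_of_nonneg)
  then obtain L where L: "(\<lambda>k. weighted_norm2 (s k) F) \<longlonglongrightarrow> L"
    using Bseq_mono_convergent[of "\<lambda>k. weighted_norm2 (s k) F"] mono_norm by (auto simp: convergent_def incseq_def)
  have LB: "L \<le> B"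
    by (rule LIMSEQ_le_const2[OF L]) (use bd s in auto)
  have mono: "AE z in lborel. mono (\<lambda>k. ?f k z)"
    by (intro AE_I2 incseq_SucI mult_left_mono gauss_antimono s_dec) auto
  have lim: "AE z in lborel. (\<lambda>k. ?f k z) \<longlonglongrightarrow> (cmod (F z))\<^sup>2 * gauss 1 z"
    unfolding gauss_def by (intro AE_I2 tendsto_intros s_lim)
  have int: "integrable lborel (\<lambda>z. (cmod (F z))\<^sup>2 * gauss 1 z)" "(LINT z|lborel. (cmod (F z))\<^sup>2 * gauss 1 z) = L"
    using integrable_monotone_convergence[OF weighted_norm2_integrable[OF F s(1)] mono lim L[unfolded weighted_norm2_def]]
      integral_monotone_convergence[OF weighted_norm2_integrable[OF F s(1)] mono lim L[unfolded weighted_norm2_def]]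
    by auto
  show "F \<in> fock" using int(1) slow_entire[OF F] by (simp add: fock_def gauss_def)
  show "weighted_norm2 1 F \<le> B" using int(2) LB by (simp add: weighted_norm2_def)
qed

text \<open>The commutation relation of \<open>\<partial>\<^sub>j\<close> and
  \<open>z\<^sub>j\<close>: moving \<open>z $ j\<close> across the inner product as a derivative and
  applying the product rule expresses the norm of \<open>z $ j * h\<close> by those of
  \<open>dz_deriv j h\<close> and \<open>h\<close>.\<close>

lemma coord_mult_fock:
  assumes h: "h \<in> slow" "h \<in> fock" "dz_deriv j h \<in> fock"
  shows "(\<lambda>z. z $ j * h z) \<in> fock"
proof (rule fock_if_bounded(1)[OF slow_coord_mult[OF h(1)]])
  fix s :: real assume s: "1 < s" "s < 2"
  have d: "dz_deriv j h \<in> slow" by (rule slow_dz_deriv[OF h(1)])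
  have "weighted_inner s h (\<lambda>z. z $ j * dz_deriv j h z) = weighted_norm2 s (dz_deriv j h) / s"
    using weighted_inner_dz_deriv[OF s(1) h(1) d, of j] s by (simp add: weighted_inner_self field_simps)
  then have "cnj (weighted_inner s h (\<lambda>z. z $ j * dz_deriv j h z)) = weighted_norm2 s (dz_deriv j h) / s"
    by simp
  then have 1: "weighted_inner s (\<lambda>z. z $ j * dz_deriv j h z) h = weighted_norm2 s (dz_deriv j h) / s"
    unfolding cnj_weighted_inner .
  have "dz_deriv j (\<lambda>z. z $ j * h z) = (\<lambda>z. z $ j * dz_deriv j h z + h z)"
    using dz_deriv_coord_mult[OF slow_entire[OF h(1)], of j j] by auto
  then have "weighted_inner s (dz_deriv j (\<lambda>z. z $ j * h z)) h = weighted_norm2 s (dz_deriv j h) / s + weighted_norm2 s h"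
    using weighted_inner_add_left[OF s(1) slow_coord_mult[OF d, of j] h(1) h(1)]
    by (simp add: 1 weighted_inner_self)
  then have "complex_of_real (s * weighted_norm2 s (\<lambda>z. z $ j * h z)) = of_real (weighted_norm2 s (dz_deriv j h) / s + weighted_norm2 s h)"
    using weighted_inner_dz_deriv[OF s(1) slow_coord_mult[OF h(1)] h(1), of j j] by (simp add: weighted_inner_self)
  then have eq: "s * weighted_norm2 s (\<lambda>z. z $ j * h z) = weighted_norm2 s (dz_deriv j h) / s + weighted_norm2 s h"
    unfolding of_real_eq_iff .
  have "weighted_norm2 s (\<lambda>z. z $ j * h z) \<le> s * weighted_norm2 s (\<lambda>z. z $ j * h z)"
    using s weighted_norm2_nonneg[of s "\<lambda>z. z $ j * h z"] by (simp add: mult_le_cancel_right1)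
  also have "\<dots> \<le> weighted_norm2 s (dz_deriv j h) + weighted_norm2 s h"
    unfolding eq using s weighted_norm2_nonneg[of s "dz_deriv j h"] by (simp add: divide_le_eq mult_le_cancel_left1)
  also have "\<dots> \<le> weighted_norm2 1 (dz_deriv j h) + weighted_norm2 1 h"
    by (intro add_mono weighted_norm2_le_fock h s)
  finally show "weighted_norm2 s (\<lambda>z. z $ j * h z) \<le> weighted_norm2 1 (dz_deriv j h) + weighted_norm2 1 h" .
qed

section \<open>Inverting \<open>\<Sum>\<^sub>j z\<^sub>j \<partial>\<^sub>j + p\<close>\<close>

lemma fock_measurable: "f \<in> fock \<Longrightarrow> f \<in> borel_measurable borel"
  by (intro entire_measurable fock_entire)

lemma fock_slow: "f \<in> fock \<Longrightarrow> f \<in> slow"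
  using fock_subset_slow by blast

lemma fockI: "entire f \<Longrightarrow> integrable lborel (\<lambda>z. (cmod (f z))\<^sup>2 * gauss 1 z) \<Longrightarrow> f \<in> fock"
  by (simp add: fock_def gauss_def)

lemma fock_zero: "(\<lambda>z. 0) \<in> fock"
  by (intro fockI) (auto simp: entire_const)

lemma fock_add:
  assumes "f \<in> fock" "g \<in> fock" shows "(\<lambda>z. f z + g z) \<in> fock"
proof (rule fockI)
  show "entire (\<lambda>z. f z + g z)" using assms by (intro entire_add fock_entire)
  note [measurable] = fock_measurable[OF assms(1)] fock_measurable[OF assms(2)]
  show "integrable lborel (\<lambda>z. (cmod (f z + g z))\<^sup>2 * gauss 1 z)"
  proof (rule integrable_bound_nonneg)
    show "integrable lborel (\<lambda>z. 2 * ((cmod (f z))\<^sup>2 * gauss 1 z) + 2 * ((cmod (g z))\<^sup>2 * gauss 1 z))"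
      using assms by (intro Bochner_Integration.integrable_add integrable_mult_right fock_integrable)
    fix z
    have "(cmod (f z + g z))\<^sup>2 \<le> (cmod (f z) + cmod (g z))\<^sup>2"
      by (intro power_mono norm_triangle_ineq) simp
    also have "\<dots> \<le> 2 * (cmod (f z))\<^sup>2 + 2 * (cmod (g z))\<^sup>2"
      using sum_squares_bound[of "cmod (f z)" "cmod (g z)"] by (simp add: power2_sum)
    finally have "(cmod (f z + g z))\<^sup>2 * gauss 1 z \<le> (2 * (cmod (f z))\<^sup>2 + 2 * (cmod (g z))\<^sup>2) * gauss 1 z"
      by (intro mult_right_mono) auto
    then show "norm ((cmod (f z + g z))\<^sup>2 * gauss 1 z) \<le> 2 * ((cmod (f z))\<^sup>2 * gauss 1 z) + 2 * ((cmod (g z))\<^sup>2 * gauss 1 z)"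
      by (simp add: abs_mult algebra_simps)
  qed measurable
qed

lemma fock_cmult:
  assumes "f \<in> fock" shows "(\<lambda>z. c * f z) \<in> fock"
proof (rule fockI)
  show "entire (\<lambda>z. c * f z)" using assms by (intro entire_cmult fock_entire)
  show "integrable lborel (\<lambda>z. (cmod (c * f z))\<^sup>2 * gauss 1 z)"
    using integrable_mult_right[OF fock_integrable[OF assms], of "(cmod c)\<^sup>2"]
    by (simp add: norm_mult power_mult_distrib mult.assoc)
qed

lemma fock_sum:
  assumes "finite I" "\<And>i. i \<in> I \<Longrightarrow> f i \<in> fock"
  shows "(\<lambda>z. \<Sum>i\<in>I. f i z) \<in> fock"
  using assms by (induction I rule: finite_induct) (auto simp: fock_zero fock_add)

text \<open>For \<open>p \<ge> 1\<close> this is \<open>\<integral>\<^sub>0\<^sup>1 t\<^sup>p\<^sup>-\<^sup>1 e\<^sup>t\<^sup>x dt\<close>.\<close>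

definition exp_mean :: "nat \<Rightarrow> complex \<Rightarrow> complex" where
  "exp_mean p x = (\<Sum>k. 1 / (fact k * of_nat (k + p)) * x ^ k)"

lemma exp_mean_term_bound:
  fixes x :: complex
  assumes "p \<ge> 1"
  shows "cmod (1 / (fact k * of_nat (k + p)) * x ^ k) \<le> cmod x ^ k /\<^sub>R fact k"
proof -
  have "1 / (real k + real p) \<le> 1" using assms by (simp add: field_simps)
  then have "1 / (real k + real p) * (cmod x ^ k / fact k) \<le> 1 * (cmod x ^ k / fact k)"
    by (intro mult_right_mono) auto
  moreover have "cmod (1 / (fact k * of_nat (k + p)) * x ^ k) = 1 / (real k + real p) * (cmod x ^ k / fact k)"
    by (simp add: norm_mult norm_divide norm_power flip: of_nat_add)
  ultimately show ?thesis by (simp add: divide_inverse mult.commute)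
qed

lemma exp_mean_summable:
  fixes x :: complex
  assumes "p \<ge> 1" shows "summable (\<lambda>k. 1 / (fact k * of_nat (k + p)) * x ^ k)"
  by (rule summable_comparison_test[OF _ summable_exp_generic[of "cmod x"]])
    (use exp_mean_term_bound[OF assms] in auto)

lemma exp_mean_bound:
  assumes "p \<ge> 1" shows "cmod (exp_mean p x) \<le> exp (cmod x)"
proof -
  have "norm (\<Sum>k. 1 / (fact k * of_nat (k + p)) * x ^ k) \<le> (\<Sum>k. cmod x ^ k /\<^sub>R fact k)"
    by (rule norm_suminf_le[OF exp_mean_term_bound[OF assms] summable_exp_generic])
  then show ?thesis by (simp add: exp_mean_def exp_def)
qed

text \<open>Differentiation only shifts the parameter, so the family supplies its own higher
  derivatives, all with the same exponential bound, as \<open>kernel_has_derivative\<close>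
  asks.\<close>

lemma exp_mean_deriv:
  assumes "p \<ge> 1" shows "(exp_mean p has_field_derivative exp_mean (Suc p) x) (at x)"
proof -
  have "diffs (\<lambda>k. 1 / (fact k * of_nat (k + p))) = (\<lambda>k. 1 / (fact k * of_nat (k + Suc p)) :: complex)"
  proof
    fix k
    have "of_nat (Suc k) \<noteq> (0 :: complex)" by (rule of_nat_neq_0)
    then show "diffs (\<lambda>k. 1 / (fact k * of_nat (k + p))) k = (1 / (fact k * of_nat (k + Suc p)) :: complex)"
      by (simp add: diffs_def fact_Suc del: of_nat_Suc of_nat_add)
  qed
  then show ?thesis
    using termdiffs_strong_converges_everywhere[OF exp_mean_summable[OF assms], of x]
    unfolding exp_mean_def[abs_def] by (simp only:)
qed

text \<open>The one-variable case of inverting \<open>E + p\<close>: the operator multiplies the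
  coefficient of \<open>x ^ k\<close> by \<open>k + p\<close>, which cancels the denominator and
  leaves the exponential series.\<close>

lemma exp_mean_euler:
  assumes "p \<ge> 1" shows "x * exp_mean (Suc p) x + of_nat p * exp_mean p x = exp x"
proof -
  define a where "a k = 1 / (fact k * of_nat (k + p)) * x ^ k" for k
  have exp_mean_a: "exp_mean p x = suminf a" unfolding exp_mean_def a_def ..
  define g where "g k = of_nat k * a k" for k
  have g_Suc: "g (Suc k) = x * (1 / (fact k * of_nat (k + Suc p)) * x ^ k)" for k
  proof -
    have "of_nat (Suc k) \<noteq> (0 :: complex)" by (rule of_nat_neq_0)
    then show ?thesis by (simp add: g_def a_def fact_Suc del: of_nat_Suc)
  qed
  have a: "summable a" unfolding a_def by (rule exp_mean_summable[OF assms])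
  have sum_Suc: "summable (\<lambda>k. g (Suc k))"
    unfolding g_Suc using exp_mean_summable[of "Suc p"] by (intro summable_mult) auto
  then have g: "summable g" by (simp add: summable_Suc_iff)
  have "x * exp_mean (Suc p) x = (\<Sum>k. g (Suc k))"
    unfolding g_Suc exp_mean_def using exp_mean_summable[of "Suc p"] by (intro suminf_mult[symmetric]) auto
  also have "\<dots> = suminf g" using suminf_split_head[OF g] by (simp add: g_def)
  finally have "x * exp_mean (Suc p) x + of_nat p * exp_mean p x = suminf g + (\<Sum>k. of_nat p * a k)"
    using a by (simp add: exp_mean_a suminf_mult)
  also have "\<dots> = (\<Sum>k. g k + of_nat p * a k)" using g a by (intro suminf_add summable_mult) auto
  also have "(\<lambda>k. g k + of_nat p * a k) = (\<lambda>k. x ^ k /\<^sub>R fact k)"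
  proof
    fix k
    have "of_nat (k + p) \<noteq> (0 :: complex)" using assms by (simp del: of_nat_add)
    moreover have "g k + of_nat p * a k = of_nat (k + p) * a k" by (simp add: g_def algebra_simps)
    ultimately show "g k + of_nat p * a k = x ^ k /\<^sub>R fact k"
      by (simp add: a_def scaleR_conv_of_real divide_inverse del: of_nat_add)
  qed
  finally show ?thesis by (simp add: exp_def)
qed

lemma
  fixes F :: "complex ^ 'n::finite \<Rightarrow> complex"
  assumes F: "exp_integrable F" and p: "p \<ge> 1"
  shows kernel_exp_mean_entire: "entire (kernel_int (exp_mean p) F)"
    and kernel_exp_mean_dz_deriv: "dz_deriv j (kernel_int (exp_mean p) F) w = kernel_int (exp_mean (Suc p)) (\<lambda>z. cnj (z $ j) * F z) w"
proof -
  have *: "(kernel_int (exp_mean p) F has_derivative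
      (\<lambda>v. \<Sum>j\<in>UNIV. v $ j * kernel_int (exp_mean (Suc p)) (\<lambda>z. cnj (z $ j) * F z) w)) (at w)" for w
    using p exp_mean_bound
    by (intro kernel_has_derivative[OF F exp_mean_deriv exp_mean_deriv, where B=1 and s=1]) auto
  show "entire (kernel_int (exp_mean p) F)" using * by (rule entireI)
  show "dz_deriv j (kernel_int (exp_mean p) F) w = kernel_int (exp_mean (Suc p)) (\<lambda>z. cnj (z $ j) * F z) w"
    using * by (rule dz_derivI)
qed

text \<open>The kernel depends on \<open>w\<close> only through \<open>cdot w z\<close>, which is
  linear in \<open>w\<close>; hence the Euler operator in \<open>w\<close> acts on it as
  \<open>x * d/dx\<close> at \<open>x = cdot w z\<close>, and the scalar identity applies under the
  integral.\<close>

lemma kernel_exp_mean_euler: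
  fixes F :: "complex ^ 'n::finite \<Rightarrow> complex"
  assumes F: "exp_integrable F" and p: "p \<ge> 1"
  shows "(\<Sum>j\<in>UNIV. w $ j * dz_deriv j (kernel_int (exp_mean p) F) w) + of_nat p * kernel_int (exp_mean p) F w
    = kernel_int exp F w"
proof -
  have cont: "continuous_on UNIV (exp_mean q)" if "q \<ge> 1" for q
    using exp_mean_deriv[OF that] by (meson DERIV_isCont continuous_at_imp_continuous_on)
  have int: "integrable lborel (\<lambda>z. G z * exp_mean q (cdot w z))"
    if "exp_integrable G" "q \<ge> 1" for G :: "complex ^ 'n \<Rightarrow> complex" and q
    using exp_mean_bound[OF that(2)] by (intro kernel_integrable[OF that(1) cont[OF that(2)], where B=1 and s=1]) auto
  have int1: "integrable lborel (\<lambda>z. w $ j * (cnj (z $ j) * F z * exp_mean (Suc p) (cdot w z)))" for j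
    by (intro integrable_mult_right int exp_integrable_cnj_mult F) simp
  have "(\<Sum>j\<in>UNIV. w $ j * dz_deriv j (kernel_int (exp_mean p) F) w)
      = (LINT z|lborel. (\<Sum>j\<in>UNIV. w $ j * (cnj (z $ j) * F z * exp_mean (Suc p) (cdot w z))))"
    by (subst Bochner_Integration.integral_sum[OF int1]) (simp add: kernel_exp_mean_dz_deriv[OF F p] kernel_int_def)
  moreover have "of_nat p * kernel_int (exp_mean p) F w = (LINT z|lborel. of_nat p * (F z * exp_mean p (cdot w z)))"
    by (simp add: kernel_int_def)
  ultimately have "(\<Sum>j\<in>UNIV. w $ j * dz_deriv j (kernel_int (exp_mean p) F) w) + of_nat p * kernel_int (exp_mean p) F w
      = (LINT z|lborel. (\<Sum>j\<in>UNIV. w $ j * (cnj (z $ j) * F z * exp_mean (Suc p) (cdot w z))) + of_nat p * (F z * exp_mean p (cdot w z)))"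
    using int1 int[OF F p] by (simp add: Bochner_Integration.integral_add)
  also have "\<dots> = kernel_int exp F w"
    unfolding kernel_int_def
  proof (intro Bochner_Integration.integral_cong refl)
    fix z
    have "(\<Sum>j\<in>UNIV. w $ j * (cnj (z $ j) * F z * exp_mean (Suc p) (cdot w z))) = F z * (cdot w z * exp_mean (Suc p) (cdot w z))"
      unfolding cdot_def[of w z] sum_distrib_left sum_distrib_right by (intro sum.cong) (auto simp: mult_ac)
    then show "(\<Sum>j\<in>UNIV. w $ j * (cnj (z $ j) * F z * exp_mean (Suc p) (cdot w z))) + of_nat p * (F z * exp_mean p (cdot w z)) = F z * exp (cdot w z)"
      unfolding exp_mean_euler[OF p, of "cdot w z", symmetric] by (simp add: algebra_simps)
  qed
  finally show ?thesis .
qed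

text \<open>The inverse of \<open>\<Sum>\<^sub>j z\<^sub>j \<partial>\<^sub>j + p\<close> on functions, \<open>(euler_inverse p u)(z) = \<integral>\<^sub>0\<^sup>1 t\<^sup>p\<^sup>-\<^sup>1 u(tz) dt\<close>.\<close>

definition euler_inverse :: "nat \<Rightarrow> (complex ^ 'n::finite \<Rightarrow> complex) \<Rightarrow> complex ^ 'n \<Rightarrow> complex" where
  "euler_inverse p u = (\<lambda>w. inverse (of_real (gauss_mass TYPE('n) 1)) * kernel_int (exp_mean p) (\<lambda>z. u z * of_real (gauss 1 z)) w)"

text \<open>The equation for \<open>dz_deriv k\<close> is not obtained by differentiating the first
  one: this derivative is itself a transform with kernel \<open>exp_mean (Suc p)\<close>, so the
  same identity applies with \<open>Suc p\<close>, and no partial derivatives have to be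
  interchanged.\<close>

lemma
  fixes u :: "complex ^ 'n::finite \<Rightarrow> complex"
  assumes p: "p \<ge> 1" and u: "u \<in> fock"
  shows euler_inverse_entire: "entire (euler_inverse p u)"
    and euler_inverse_slow: "euler_inverse p u \<in> slow"
    and euler_inverse_eq: "(\<Sum>j\<in>UNIV. w $ j * dz_deriv j (euler_inverse p u) w) + of_nat p * euler_inverse p u w = u w"
    and euler_inverse_dz_deriv_eq: "(\<Sum>j\<in>UNIV. w $ j * dz_deriv j (dz_deriv k (euler_inverse p u)) w)
      + of_nat (Suc p) * dz_deriv k (euler_inverse p u) w = dz_deriv k u w"
proof -
  let ?u = "\<lambda>z. u z * complex_of_real (gauss 1 z)"
  define c where "c = complex_of_real (gauss_mass TYPE('n) 1)"
  have cpos: "gauss_mass TYPE('n) 1 > 0" by (intro gauss_mass_pos) simp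
  then have c: "c \<noteq> 0" by (simp add: c_def)
  have E: "exp_integrable ?u" by (rule fock_exp_integrable[OF u])
  note E' = exp_integrable_cnj_mult[OF E, of k]
  have def: "euler_inverse p u = (\<lambda>w. inverse c * kernel_int (exp_mean p) ?u w)"
    by (simp add: euler_inverse_def c_def)
  note K = kernel_exp_mean_entire[OF E p]
  show ent: "entire (euler_inverse p u)" unfolding def by (rule entire_cmult[OF K])
  have d: "dz_deriv j (euler_inverse p u) w = inverse c * dz_deriv j (kernel_int (exp_mean p) ?u) w" for j w
    unfolding def by (rule dz_deriv_cmult[OF K])
  show "euler_inverse p u \<in> slow"
  proof (rule slowI[OF ent])
    fix b :: real assume "b > 1/2"
    then obtain C where C: "\<And>w. cmod (kernel_int (exp_mean p) ?u w) \<le> C * exp (b * (norm w)\<^sup>2)"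
      using kernel_slow_growth[OF u exp_mean_bound[OF p]] by blast
    have "cmod (euler_inverse p u w) \<le> (cmod (inverse c) * C) * exp (b * (norm w)\<^sup>2)" for w
      unfolding def norm_mult mult.assoc by (intro mult_left_mono C) simp
    then show "\<exists>C. \<forall>w. cmod (euler_inverse p u w) \<le> C * exp (b * (norm w)\<^sup>2)" by blast
  qed
  have "(\<Sum>j\<in>UNIV. w $ j * dz_deriv j (euler_inverse p u) w) + of_nat p * euler_inverse p u w
      = inverse c * ((\<Sum>j\<in>UNIV. w $ j * dz_deriv j (kernel_int (exp_mean p) ?u) w) + of_nat p * kernel_int (exp_mean p) ?u w)"
    unfolding d unfolding def by (simp add: algebra_simps sum_distrib_left)
  also have "\<dots> = inverse c * kernel_int exp ?u w"
    unfolding kernel_exp_mean_euler[OF E p] ..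
  also have "\<dots> = u w"
    using gaussian_representation(1)[OF fock_entire[OF u] E, of w] by (simp add: c_def divide_inverse mult.commute)
  finally show "(\<Sum>j\<in>UNIV. w $ j * dz_deriv j (euler_inverse p u) w) + of_nat p * euler_inverse p u w = u w" .
  have p': "Suc p \<ge> 1" by simp
  let ?v = "\<lambda>z. cnj (z $ k) * ?u z"
  have def': "dz_deriv k (euler_inverse p u) = (\<lambda>w. inverse c * kernel_int (exp_mean (Suc p)) ?v w)"
    unfolding d kernel_exp_mean_dz_deriv[OF E p] ..
  have d': "dz_deriv j (dz_deriv k (euler_inverse p u)) w = inverse c * dz_deriv j (kernel_int (exp_mean (Suc p)) ?v) w" for j w
    unfolding def' by (rule dz_deriv_cmult[OF kernel_exp_mean_entire[OF E' p']])
  have "(\<Sum>j\<in>UNIV. w $ j * dz_deriv j (dz_deriv k (euler_inverse p u)) w) + of_nat (Suc p) * dz_deriv k (euler_inverse p u) w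
      = inverse c * ((\<Sum>j\<in>UNIV. w $ j * dz_deriv j (kernel_int (exp_mean (Suc p)) ?v) w) + of_nat (Suc p) * kernel_int (exp_mean (Suc p)) ?v w)"
    unfolding d' unfolding def' by (simp add: algebra_simps sum_distrib_left del: of_nat_Suc)
  also have "\<dots> = inverse c * kernel_int exp ?v w"
    unfolding kernel_exp_mean_euler[OF E' p'] ..
  also have "\<dots> = dz_deriv k u w"
    using gaussian_representation(2)[OF fock_entire[OF u] E, of k w] by (simp add: c_def divide_inverse mult.commute)
  finally show "(\<Sum>j\<in>UNIV. w $ j * dz_deriv j (dz_deriv k (euler_inverse p u)) w)
      + of_nat (Suc p) * dz_deriv k (euler_inverse p u) w = dz_deriv k u w" .
qed

text \<open>Integration by parts with \<open>dz_deriv j h\<close> in both slots. As the left side is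
  real and nonnegative, this is the positivity of the Euler operator.\<close>

lemma sum_dz_deriv_norm2:
  fixes h :: "complex ^ 'n::finite \<Rightarrow> complex"
  assumes s: "s > 1" and h: "h \<in> slow"
  shows "of_real (\<Sum>j\<in>UNIV. weighted_norm2 s (dz_deriv j h))
    = of_real s * weighted_inner s h (\<lambda>z. \<Sum>j\<in>UNIV. z $ j * dz_deriv j h z)"
proof -
  have d: "dz_deriv j h \<in> slow" for j by (rule slow_dz_deriv[OF h])
  have "weighted_inner s h (\<lambda>z. \<Sum>j\<in>UNIV. z $ j * dz_deriv j h z) = (\<Sum>j\<in>UNIV. weighted_inner s h (\<lambda>z. z $ j * dz_deriv j h z))"
    by (intro weighted_inner_sum_right s h slow_coord_mult d)
  then show ?thesis
    unfolding of_real_sum sum_distrib_left weighted_inner_self[symmetric] weighted_inner_dz_deriv[OF s h d]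
    by (simp add: sum_distrib_left)
qed

text \<open>Multiplying by a coordinate costs one derivative, by \<open>coord_mult_fock\<close>.
  Hence first derivatives in the Fock space yield \<open>z $ j * f\<close>, and second derivatives
  yield \<open>z $ j * dz_deriv k f\<close>; these are what the two contractions in the box operator
  need.\<close>

lemma
  fixes u :: "complex ^ 'n::finite \<Rightarrow> complex"
  assumes p: "p \<ge> 1" and u: "u \<in> fock"
  shows euler_inverse_fock: "euler_inverse p u \<in> fock"
    and euler_inverse_norm: "weighted_norm2 1 (euler_inverse p u) \<le> weighted_norm2 1 u / (real p)\<^sup>2"
    and euler_inverse_dz_deriv_fock: "dz_deriv k (euler_inverse p u) \<in> fock"
    and euler_inverse_coord_dz_deriv_fock: "(\<lambda>z. z $ j * dz_deriv k (euler_inverse p u) z) \<in> fock"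
    and euler_inverse_coord_fock: "(\<lambda>z. z $ j * euler_inverse p u z) \<in> fock"
proof -
  define f where "f = euler_inverse p u"
  have us: "u \<in> slow" by (rule fock_slow[OF u])
  have fs: "f \<in> slow" unfolding f_def by (rule euler_inverse_slow[OF p u])
  have ds: "dz_deriv k f \<in> slow" for k by (rule slow_dz_deriv[OF fs])
  have p0: "real p > 0" using p by simp
  define A where "A s = (\<Sum>j\<in>UNIV. weighted_norm2 s (dz_deriv j f))" for s
  define B where "B s = (\<Sum>k\<in>UNIV. \<Sum>j\<in>UNIV. weighted_norm2 s (dz_deriv j (dz_deriv k f)))" for s
  define Ef where "Ef z = u z - of_nat p * f z" for z
  have Ef: "(\<lambda>z. \<Sum>j\<in>UNIV. z $ j * dz_deriv j f z) = Ef"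
    using euler_inverse_eq[OF p u] by (auto simp: fun_eq_iff Ef_def f_def[symmetric] algebra_simps)
  have Efs: "Ef \<in> slow" unfolding Ef[symmetric] by (intro slow_sum slow_coord_mult ds) simp
  have A_nonneg: "A s \<ge> 0" for s unfolding A_def by (intro sum_nonneg weighted_norm2_nonneg)
  \<comment> \<open>Both terms on the left are nonnegative: dropping the first bounds
    \<open>f\<close>, dropping the second bounds its first derivatives.\<close>
  have energy: "A s / s + real p / 2 * weighted_norm2 s f \<le> weighted_norm2 1 u / (2 * real p)" if s: "s > 1" for s
  proof -
    have "complex_of_real (A s) = of_real s * (weighted_inner s f u - of_nat p * of_real (weighted_norm2 s f))"
      unfolding A_def sum_dz_deriv_norm2[OF s fs] Ef
      unfolding Ef_def weighted_inner_diff_right[OF s fs us fs] by (simp add: weighted_inner_self)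
    from arg_cong[OF this, of Re] have "A s = s * (Re (weighted_inner s f u) - real p * weighted_norm2 s f)"
      by simp
    then have "A s / s + real p * weighted_norm2 s f = Re (weighted_inner s f u)"
      using s by simp
    also have "\<dots> \<le> real p / 2 * weighted_norm2 s f + 1 / (2 * real p) * weighted_norm2 s u"
      using weighted_inner_le[OF s fs us p0] complex_Re_le_cmod[of "weighted_inner s f u"] by linarith
    also have "1 / (2 * real p) * weighted_norm2 s u \<le> 1 / (2 * real p) * weighted_norm2 1 u"
      by (intro mult_left_mono weighted_norm2_le_fock u s) simp
    finally show ?thesis by simp
  qed
  have f_bound: "weighted_norm2 s f \<le> weighted_norm2 1 u / (real p)\<^sup>2" if s: "s > 1" for s
  proof -
    have "A s / s \<ge> 0" using A_nonneg s by simp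
    then have "real p / 2 * weighted_norm2 s f \<le> weighted_norm2 1 u / (2 * real p)" using energy[OF s] by linarith
    then show ?thesis using p0 by (simp add: field_simps power2_eq_square)
  qed
  show f: "euler_inverse p u \<in> fock" and "weighted_norm2 1 (euler_inverse p u) \<le> weighted_norm2 1 u / (real p)\<^sup>2"
    using fock_if_bounded[OF fs f_bound] by (auto simp: f_def)
  have Eff: "Ef \<in> fock"
  proof -
    have "Ef = (\<lambda>z. u z + (- of_nat p) * f z)" by (auto simp: Ef_def)
    then show ?thesis using fock_add[OF u fock_cmult[OF f, of "- of_nat p"]] by (simp add: f_def)
  qed
  have df: "dz_deriv k f \<in> fock" for k
  proof (rule fock_if_bounded(1)[OF ds])
    fix s :: real assume s: "1 < s" "s < 2"
    have "weighted_norm2 s (dz_deriv k f) \<le> A s"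
      unfolding A_def by (rule member_le_sum) (auto simp: weighted_norm2_nonneg)
    also have "A s \<le> s * (weighted_norm2 1 u / (2 * real p))"
    proof -
      have "real p / 2 * weighted_norm2 s f \<ge> 0" using weighted_norm2_nonneg[of s f] by simp
      then have "A s / s \<le> weighted_norm2 1 u / (2 * real p)" using energy[OF s(1)] by linarith
      then show ?thesis using s by (simp add: divide_le_eq mult.commute)
    qed
    also have "\<dots> \<le> 2 * (weighted_norm2 1 u / (2 * real p))"
      using s p0 weighted_norm2_nonneg[of 1 u] by (intro mult_right_mono) auto
    finally show "weighted_norm2 s (dz_deriv k f) \<le> 2 * (weighted_norm2 1 u / (2 * real p))" .
  qed
  then show "dz_deriv k (euler_inverse p u) \<in> fock" by (simp add: f_def)
  show "(\<lambda>z. z $ j * euler_inverse p u z) \<in> fock"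
    using coord_mult_fock[OF fs _ df] f by (simp add: f_def)
  have ddf: "dz_deriv j (dz_deriv k f) \<in> fock" for j k
  proof (rule fock_if_bounded(1)[OF slow_dz_deriv[OF ds]])
    fix s :: real assume s: "1 < s" "s < 2"
    have us': "dz_deriv k u \<in> slow" for k by (rule slow_dz_deriv[OF us])
    have E2: "(\<lambda>z. \<Sum>j\<in>UNIV. z $ j * dz_deriv j (dz_deriv k f) z) = (\<lambda>z. dz_deriv k u z - of_nat (Suc p) * dz_deriv k f z)" for k
      using euler_inverse_dz_deriv_eq[OF p u] by (auto simp: fun_eq_iff f_def[symmetric] algebra_simps)
    \<comment> \<open>\<open>dz_deriv k u\<close> need not lie in the Fock space, so it must not
      survive in the bound. Integration by parts moves the derivative off \<open>u\<close>; summing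
      over \<open>k\<close> then assembles \<open>Ef\<close>, which has already been placed in the
      Fock space.\<close>
    have inner: "weighted_inner s (dz_deriv k f) (dz_deriv k u) = of_real s * cnj (weighted_inner s u (\<lambda>z. z $ k * dz_deriv k f z))" for k
      using arg_cong[OF weighted_inner_dz_deriv[OF s(1) us ds[of k], of k], of cnj] by (simp add: cnj_weighted_inner)
    have sum_inner: "weighted_inner s u Ef = (\<Sum>k\<in>UNIV. weighted_inner s u (\<lambda>z. z $ k * dz_deriv k f z))"
      unfolding Ef[symmetric] by (intro weighted_inner_sum_right s us slow_coord_mult ds)
    have "complex_of_real (B s) = (\<Sum>k\<in>UNIV. of_real (\<Sum>j\<in>UNIV. weighted_norm2 s (dz_deriv j (dz_deriv k f))))"
      unfolding B_def by (rule of_real_sum)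
    also have "\<dots> = (\<Sum>k\<in>UNIV. of_real s * (weighted_inner s (dz_deriv k f) (dz_deriv k u) - of_nat (Suc p) * of_real (weighted_norm2 s (dz_deriv k f))))"
      unfolding sum_dz_deriv_norm2[OF s(1) ds] E2
      unfolding weighted_inner_diff_right[OF s(1) ds us' ds] weighted_inner_self complex_cnj_of_nat ..
    also have "\<dots> = of_real s * (of_real s * cnj (weighted_inner s u Ef) - of_nat (Suc p) * of_real (A s))"
      unfolding inner sum_inner A_def by (simp add: sum_subtractf sum_distrib_left algebra_simps sum.distrib)
    finally have "complex_of_real (B s) = of_real s * (of_real s * cnj (weighted_inner s u Ef) - of_nat (Suc p) * of_real (A s))" .
    from arg_cong[OF this, of Re] have B_eq: "B s = s * (s * Re (weighted_inner s u Ef) - real (Suc p) * A s)"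
      by simp
    have "weighted_norm2 s (dz_deriv j (dz_deriv k f)) \<le> (\<Sum>j\<in>UNIV. weighted_norm2 s (dz_deriv j (dz_deriv k f)))"
      by (rule member_le_sum) (auto simp: weighted_norm2_nonneg)
    also have "\<dots> \<le> B s"
      unfolding B_def by (rule member_le_sum[of k UNIV "\<lambda>k. \<Sum>j\<in>UNIV. weighted_norm2 s (dz_deriv j (dz_deriv k f))"])
        (auto simp: weighted_norm2_nonneg intro!: sum_nonneg)
    also have "B s \<le> s * (s * cmod (weighted_inner s u Ef))"
      unfolding B_eq
    proof (rule mult_left_mono)
      have "s * Re (weighted_inner s u Ef) \<le> s * cmod (weighted_inner s u Ef)"
        using s complex_Re_le_cmod by (intro mult_left_mono) auto
      moreover have "real (Suc p) * A s \<ge> 0" using A_nonneg by simp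
      ultimately show "s * Re (weighted_inner s u Ef) - real (Suc p) * A s \<le> s * cmod (weighted_inner s u Ef)" by linarith
    qed (use s in simp)
    also have "\<dots> \<le> 2 * (2 * cmod (weighted_inner s u Ef))"
      using s by (intro mult_mono mult_right_mono) auto
    also have "\<dots> \<le> 2 * (2 * (1 / 2 * weighted_norm2 s u + 1 / (2 * 1) * weighted_norm2 s Ef))"
      by (intro mult_left_mono weighted_inner_le s us Efs) auto
    also have "\<dots> \<le> 2 * (2 * (1 / 2 * weighted_norm2 1 u + 1 / (2 * 1) * weighted_norm2 1 Ef))"
      by (intro mult_left_mono add_mono weighted_norm2_le_fock s u Eff) auto
    finally show "weighted_norm2 s (dz_deriv j (dz_deriv k f)) \<le> \<dots>" .
  qed
  show "(\<lambda>z. z $ j * dz_deriv k (euler_inverse p u) z) \<in> fock"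
    using coord_mult_fock[OF ds df ddf] by (simp add: f_def)
qed

section \<open>The adjoint of \<open>del\<close>\<close>

lemma fock_product_integrable:
  assumes f: "f \<in> fock" and g: "g \<in> fock"
  shows "integrable lborel (\<lambda>z. cmod (f z) * cmod (g z) * gauss 1 z)"
proof (rule integrable_bound_nonneg)
  note [measurable] = fock_measurable[OF f] fock_measurable[OF g]
  show "integrable lborel (\<lambda>z. (cmod (f z))\<^sup>2 * gauss 1 z + (cmod (g z))\<^sup>2 * gauss 1 z)"
    using assms by (intro Bochner_Integration.integrable_add fock_integrable)
  show "(\<lambda>z. cmod (f z) * cmod (g z) * gauss 1 z) \<in> borel_measurable lborel" by measurable
  fix z
  have "cmod (f z) * cmod (g z) \<ge> 0" by simp
  then have "cmod (f z) * cmod (g z) \<le> (cmod (f z))\<^sup>2 + (cmod (g z))\<^sup>2"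
    using sum_squares_bound[of "cmod (f z)" "cmod (g z)"] by linarith
  from mult_right_mono[OF this gauss_nonneg, of 1 z]
  show "norm (cmod (f z) * cmod (g z) * gauss 1 z) \<le> (cmod (f z))\<^sup>2 * gauss 1 z + (cmod (g z))\<^sup>2 * gauss 1 z"
    by (simp add: abs_mult distrib_right)
qed

text \<open>Pairings have no sign, so monotone convergence is replaced by dominated convergence,
  with the product at weight 1 as majorant.\<close>

lemma weighted_inner_tendsto:
  assumes f: "f \<in> fock" and g: "g \<in> fock" and s: "s \<longlonglongrightarrow> 1" "\<And>k. s k > 1"
  shows "(\<lambda>k. weighted_inner (s k) f g) \<longlonglongrightarrow> weighted_inner 1 f g"
  unfolding weighted_inner_def
proof (rule integral_dominated_convergence[OF _ _ fock_product_integrable[OF f g]])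
  note [measurable] = fock_measurable[OF f] fock_measurable[OF g]
  show "(\<lambda>z. f z * cnj (g z) * of_real (gauss 1 z)) \<in> borel_measurable lborel" by measurable
  show "(\<lambda>z. f z * cnj (g z) * of_real (gauss (s k) z)) \<in> borel_measurable lborel" for k by measurable
  show "AE z in lborel. (\<lambda>k. f z * cnj (g z) * of_real (gauss (s k) z)) \<longlonglongrightarrow> f z * cnj (g z) * of_real (gauss 1 z)"
    unfolding gauss_def by (intro AE_I2 tendsto_intros s(1))
  show "AE z in lborel. norm (f z * cnj (g z) * of_real (gauss (s k) z)) \<le> cmod (f z) * cmod (g z) * gauss 1 z" for k
    by (intro AE_I2) (simp add: norm_mult mult_left_mono gauss_antimono less_imp_le[OF s(2)])
qed

lemma weighted_inner_cmult_left: "weighted_inner s (\<lambda>z. c * f z) g = c * weighted_inner s f g"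
  unfolding weighted_inner_def by (simp add: mult.assoc)

lemma weighted_inner_cmult_right: "weighted_inner s f (\<lambda>z. c * g z) = cnj c * weighted_inner s f g"
  unfolding weighted_inner_def by (simp add: mult.left_commute[of _ "cnj c"] mult.assoc)

lemma weighted_inner_sum_left:
  assumes "s > 1" "\<And>i. i \<in> I \<Longrightarrow> f i \<in> slow" "g \<in> slow"
  shows "weighted_inner s (\<lambda>z. \<Sum>i\<in>I. f i z) g = (\<Sum>i\<in>I. weighted_inner s (f i) g)"
  using arg_cong[OF weighted_inner_sum_right[OF assms(1,3,2)], where f=cnj] by (simp add: cnj_weighted_inner)

lemma weighted_inner_zero_left [simp]: "weighted_inner s (\<lambda>z. 0) g = 0"
  by (simp add: weighted_inner_def)

lemma exp_cdot_fock: "(\<lambda>z. exp (cdot z a)) \<in> fock"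
proof (rule fockI)
  show ent: "entire (\<lambda>z. exp (cdot z a))" using entire_exp_cdot[of 1 a] by simp
  note [measurable] = entire_measurable[OF ent]
  show "integrable lborel (\<lambda>z. (cmod (exp (cdot z a)))\<^sup>2 * gauss 1 z)"
  proof (rule integrable_bound_nonneg)
    show "integrable lborel (\<lambda>z :: complex ^ 'a. exp (2 * norm a * norm z - 1 * (norm z)\<^sup>2))"
      by (rule integrable_exp_linear_minus_square) simp
    fix z
    have "Re (cdot z a) \<le> norm a * norm z"
      using complex_Re_le_cmod[of "cdot z a"] norm_cdot_le[of z a] by (simp add: mult.commute)
    then have "(cmod (exp (cdot z a)))\<^sup>2 \<le> exp (2 * norm a * norm z)"
      by (simp add: norm_exp_eq_Re flip: exp_of_nat_mult)
    from mult_right_mono[OF this gauss_nonneg, of 1 z]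
    show "norm ((cmod (exp (cdot z a)))\<^sup>2 * gauss 1 z) \<le> exp (2 * norm a * norm z - 1 * (norm z)\<^sup>2)"
      by (simp add: gauss_def exp_diff exp_minus field_simps)
  qed measurable
qed

lemma weighted_inner_exp_cdot:
  fixes g :: "complex ^ 'n::finite \<Rightarrow> complex"
  assumes g: "g \<in> fock"
  shows "weighted_inner 1 (\<lambda>z. exp (cdot z a)) g = of_real (gauss_mass TYPE('n) 1) * cnj (g a)"
proof -
  have "integrable lborel (\<lambda>z. g z * of_real (gauss 1 z) * exp (cdot a z))"
    by (rule kernel_integrable[OF fock_exp_integrable[OF g], where B=1 and s=1])
      (auto intro!: continuous_intros simp: norm_exp_eq_Re complex_Re_le_cmod)
  then have "(LINT z|lborel. g z * exp (cdot a z) * of_real (gauss 1 z)) = of_real (gauss_mass TYPE('n) 1) * g a"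
    using reproducing_formula[OF fock_entire[OF g], of 1 a] by (simp add: gauss_def mult_ac)
  then have "weighted_inner 1 g (\<lambda>z. exp (cdot z a)) = of_real (gauss_mass TYPE('n) 1) * g a"
    by (simp add: weighted_inner_def exp_cnj cnj_cdot)
  from arg_cong[OF this, of cnj] show ?thesis by (simp add: cnj_weighted_inner)
qed

text \<open>Only entries below \<open>j\<close> count, so the sign is the same whether or not
  \<open>j\<close> belongs to \<open>J\<close>. It serves for adjoining \<open>j\<close> and for
  removing it.\<close>

definition wedge_sign :: "'n::{finite,linorder} \<Rightarrow> 'n set \<Rightarrow> complex" where
  "wedge_sign j J = (- 1) ^ card {k \<in> J. k < j}"

lemma cnj_wedge_coeff: "cnj (wedge_coeff j J K) = wedge_coeff j J K"
  by (simp add: wedge_coeff_def)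

lemma wedge_coeff_left: "wedge_coeff j J K = (if K = insert j J then if j \<notin> J then wedge_sign j J else 0 else 0)"
  by (simp add: wedge_coeff_def wedge_sign_def)

text \<open>The two forms of the coefficient are shaped for collapsing sums: the previous one
  determines \<open>K\<close> from \<open>J\<close> and \<open>j\<close>, this one \<open>J\<close>
  from \<open>K\<close> and \<open>j\<close>.\<close>

lemma wedge_coeff_right: "wedge_coeff j J K = (if J = K - {j} then if j \<in> K then wedge_sign j K else 0 else 0)"
proof (cases "j \<in> K \<and> J = K - {j}")
  case True
  then have a: "j \<notin> J \<and> K = insert j J" and b: "{k \<in> J. k < j} = {k \<in> K. k < j}" by auto
  show ?thesis
    unfolding wedge_coeff_def wedge_sign_def if_P[OF a] b if_P[OF conjunct1[OF True]] if_P[OF conjunct2[OF True]] ..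
next
  case False
  then have a: "\<not> (j \<notin> J \<and> K = insert j J)" by auto
  show ?thesis unfolding wedge_coeff_def if_not_P[OF a] using False by auto
qed

lemma wedge_sign_square: "wedge_sign j J * (wedge_sign j J * x) = x"
  by (simp add: wedge_sign_def flip: power_add mult.assoc)

lemma wedge_sign_insert:
  "j \<notin> J \<Longrightarrow> wedge_sign k (insert j J) = (if j < k then - wedge_sign k J else wedge_sign k J)"
proof -
  assume "j \<notin> J"
  moreover have "{i \<in> insert j J. i < k} = (if j < k then insert j {i \<in> J. i < k} else {i \<in> J. i < k})" by auto
  ultimately show ?thesis by (simp add: wedge_sign_def)
qed

text \<open>Removing \<open>k\<close> and adjoining \<open>j\<close> in the two orders: exactly one
  of the two signs sees the other index, depending on whether \<open>j < k\<close> or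
  \<open>k < j\<close>, and flips. This is the cancellation behind Cartan's formula.\<close>

lemma wedge_sign_swap:
  assumes "j \<notin> J" "k \<in> J"
  shows "wedge_sign k J * wedge_sign j (J - {k}) = - (wedge_sign j J * wedge_sign k (insert j J))"
proof -
  have "wedge_sign j (insert k (J - {k})) = (if k < j then - wedge_sign j (J - {k}) else wedge_sign j (J - {k}))"
    by (rule wedge_sign_insert) simp
  then have 1: "wedge_sign j J = (if k < j then - wedge_sign j (J - {k}) else wedge_sign j (J - {k}))"
    unfolding insert_Diff[OF assms(2)] .
  have 2: "wedge_sign k (insert j J) = (if j < k then - wedge_sign k J else wedge_sign k J)"
    by (rule wedge_sign_insert[OF assms(1)])
  have "j \<noteq> k" using assms by blast
  then consider "j < k" "\<not> k < j" | "k < j" "\<not> j < k"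
    by (cases j k rule: linorder_cases) auto
  then show ?thesis
    unfolding 1 2 by cases (simp_all only: if_True if_False mult_minus_left mult_minus_right minus_minus mult.commute)
qed

text \<open>Contraction with the vector field \<open>\<Sum>\<^sub>j z\<^sub>j \<partial>/\<partial>z\<^sub>j\<close>.\<close>

definition euler_contract :: "'n form \<Rightarrow> ('n::{finite,linorder}) form" where
  "euler_contract g = (\<lambda>J z. \<Sum>j\<in>- J. wedge_sign j J * (z $ j * g (insert j J) z))"

text \<open>The same coefficients as in \<open>del\<close>, summed over the other index: the
  contraction is the transpose, with \<open>\<partial>\<^sub>j\<close> replaced by
  \<open>z\<^sub>j\<close>.\<close>

lemma euler_contract_eq_sum:
  "euler_contract g J z = (\<Sum>K\<in>UNIV. \<Sum>j\<in>UNIV. wedge_coeff j J K * (z $ j * g K z))"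
proof -
  have "(\<Sum>K\<in>UNIV. \<Sum>j\<in>UNIV. wedge_coeff j J K * (z $ j * g K z))
      = (\<Sum>j\<in>UNIV. \<Sum>K\<in>UNIV. if K = insert j J then (if j \<notin> J then wedge_sign j J else 0) * (z $ j * g K z) else 0)"
    by (subst sum.swap) (auto simp: wedge_coeff_left intro!: sum.cong)
  also have "\<dots> = (\<Sum>j\<in>UNIV. if j \<in> - J then wedge_sign j J * (z $ j * g (insert j J) z) else 0)"
    by (intro sum.cong) auto
  also have "\<dots> = euler_contract g J z"
    by (subst sum.inter_filter[symmetric]) (simp_all add: euler_contract_def Compl_eq)
  finally show ?thesis ..
qed

lemma fock_formsD:
  assumes "f \<in> fock_forms p" shows "f J \<in> fock" "card J \<noteq> p \<Longrightarrow> f J = (\<lambda>_. 0)"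
  using assms fock_zero by (cases "card J = p"; auto simp: fock_forms_def)+

lemma fock_formsI:
  "(\<And>J. card J = p \<Longrightarrow> f J \<in> fock) \<Longrightarrow> (\<And>J. card J \<noteq> p \<Longrightarrow> f J = (\<lambda>_. 0)) \<Longrightarrow> f \<in> fock_forms p"
  by (simp add: fock_forms_def)

lemma del_eq_sum:
  assumes "f \<in> fock_forms p"
  shows "del p f K z = (\<Sum>J\<in>UNIV. \<Sum>j\<in>UNIV. wedge_coeff j J K * dz_deriv j (f J) z)"
proof -
  have "del p f K z = (\<Sum>J | card J = p. \<Sum>j\<in>UNIV. wedge_coeff j J K * dz_deriv j (f J) z)"
    by (simp add: del_def mult.commute)
  also have "\<dots> = (\<Sum>J\<in>UNIV. \<Sum>j\<in>UNIV. wedge_coeff j J K * dz_deriv j (f J) z)"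
    using fock_formsD(2)[OF assms] by (intro sum.mono_neutral_left) (auto simp: dz_deriv_const)
  finally show ?thesis .
qed

lemma del_eq:
  assumes "f \<in> fock_forms p"
  shows "del p f K z = (\<Sum>j\<in>K. wedge_sign j K * dz_deriv j (f (K - {j})) z)"
proof -
  have "del p f K z = (\<Sum>j\<in>UNIV. \<Sum>J\<in>UNIV. if J = K - {j} then (if j \<in> K then wedge_sign j K else 0) * dz_deriv j (f J) z else 0)"
    unfolding del_eq_sum[OF assms] by (subst sum.swap) (auto simp: wedge_coeff_right intro!: sum.cong)
  also have "\<dots> = (\<Sum>j\<in>UNIV. if j \<in> K then wedge_sign j K * dz_deriv j (f (K - {j})) z else 0)"
    by (intro sum.cong) auto
  also have "\<dots> = (\<Sum>j\<in>K. wedge_sign j K * dz_deriv j (f (K - {j})) z)"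
    by (subst sum.inter_filter[symmetric]) simp_all
  finally show ?thesis .
qed

lemma del_zero:
  assumes "f \<in> fock_forms p" "card K \<noteq> p + 1"
  shows "del p f K = (\<lambda>_. 0)"
proof
  fix z
  have "dz_deriv j (f (K - {j})) z = 0" if "j \<in> K" for j
  proof -
    have "card (K - {j}) \<noteq> p" using assms(2) that card_Suc_Diff1[of K j] by auto
    then show ?thesis using fock_formsD(2)[OF assms(1)] by (simp add: dz_deriv_const)
  qed
  then show "del p f K z = 0" unfolding del_eq[OF assms(1)] by simp
qed

lemma euler_contract_zero:
  assumes "g \<in> fock_forms (p + 1)" "card J \<noteq> p"
  shows "euler_contract g J = (\<lambda>_. 0)"
proof
  fix z
  have "g (insert j J) z = 0" if "j \<notin> J" for j
    using fock_formsD(2)[OF assms(1), of "insert j J"] assms(2) that by (simp add: card_insert_if)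
  then show "euler_contract g J z = 0" unfolding euler_contract_def by simp
qed

lemma form_inner_eq:
  assumes "f \<in> fock_forms p"
  shows "form_inner p f g = (\<Sum>J\<in>UNIV. weighted_inner 1 (f J) (g J))"
  unfolding form_inner_def fock_inner_eq
  using fock_formsD(2)[OF assms] by (intro sum.mono_neutral_left) auto

text \<open>Integration by parts in each coefficient and an exchange of the two sums. For
  \<open>s > 1\<close> all terms converge without any domain condition on \<open>f\<close> or
  \<open>g\<close>.\<close>

lemma weighted_pairing:
  fixes f g :: "('n::{finite,linorder}) form"
  assumes s: "s > 1" and f: "f \<in> fock_forms p" and g: "g \<in> fock_forms (p + 1)"
  shows "(\<Sum>K\<in>UNIV. weighted_inner s (del p f K) (g K)) = of_real s * (\<Sum>J\<in>UNIV. weighted_inner s (f J) (euler_contract g J))"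
proof -
  have fs: "f J \<in> slow" for J by (intro fock_slow fock_formsD(1)[OF f])
  have gs: "g J \<in> slow" for J by (intro fock_slow fock_formsD(1)[OF g])
  have ds: "dz_deriv j (f J) \<in> slow" for j J by (rule slow_dz_deriv[OF fs])
  have "weighted_inner s (del p f K) (g K)
      = (\<Sum>J\<in>UNIV. \<Sum>j\<in>UNIV. wedge_coeff j J K * (of_real s * weighted_inner s (f J) (\<lambda>z. z $ j * g K z)))" for K
  proof -
    have "weighted_inner s (del p f K) (g K)
        = weighted_inner s (\<lambda>z. \<Sum>J\<in>UNIV. \<Sum>j\<in>UNIV. wedge_coeff j J K * dz_deriv j (f J) z) (g K)"
      unfolding del_eq_sum[OF f, abs_def] ..
    also have "\<dots> = (\<Sum>J\<in>UNIV. \<Sum>j\<in>UNIV. wedge_coeff j J K * weighted_inner s (dz_deriv j (f J)) (g K))"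
      by (subst weighted_inner_sum_left[OF s _ gs], (intro slow_sum slow_cmult ds finite)[1])
        (simp add: weighted_inner_sum_left[OF s _ gs] slow_cmult ds weighted_inner_cmult_left)
    finally show ?thesis unfolding weighted_inner_dz_deriv[OF s fs gs] .
  qed
  moreover have "weighted_inner s (f J) (euler_contract g J)
      = (\<Sum>K\<in>UNIV. \<Sum>j\<in>UNIV. wedge_coeff j J K * weighted_inner s (f J) (\<lambda>z. z $ j * g K z))" for J
  proof -
    have "weighted_inner s (f J) (euler_contract g J)
        = weighted_inner s (f J) (\<lambda>z. \<Sum>K\<in>UNIV. \<Sum>j\<in>UNIV. wedge_coeff j J K * (z $ j * g K z))"
      unfolding euler_contract_eq_sum[abs_def] ..
    also have "\<dots> = (\<Sum>K\<in>UNIV. \<Sum>j\<in>UNIV. wedge_coeff j J K * weighted_inner s (f J) (\<lambda>z. z $ j * g K z))"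
      by (subst weighted_inner_sum_right[OF s fs], (intro slow_sum slow_cmult slow_coord_mult gs finite)[1])
        (simp add: weighted_inner_sum_right[OF s fs] slow_cmult slow_coord_mult gs weighted_inner_cmult_right cnj_wedge_coeff)
    finally show ?thesis .
  qed
  ultimately show ?thesis
    by (simp add: sum_distrib_left mult.left_commute[of "of_real s"]) (rule sum.swap)
qed

text \<open>The limit \<open>s \<longlonglongrightarrow> 1\<close> of the weighted pairing. The
  assumptions on \<open>del p f\<close> and \<open>euler_contract g\<close> make the pairings on
  both sides converge.\<close>

lemma form_inner_del:
  fixes f g :: "('n::{finite,linorder}) form"
  assumes f: "f \<in> dom_del p" and g: "g \<in> fock_forms (p + 1)" and c: "euler_contract g \<in> fock_forms p"
  shows "form_inner (p + 1) (del p f) g = form_inner p f (euler_contract g)"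
proof -
  have f': "f \<in> fock_forms p" "del p f \<in> fock_forms (p + 1)" using f by (auto simp: dom_del_def)
  define s where "s k = 1 + 1 / real (Suc k)" for k
  have s: "s \<longlonglongrightarrow> 1" "s k > 1" for k
    using LIMSEQ_Suc[OF lim_1_over_n, THEN tendsto_add[OF tendsto_const[of "1::real"]]] by (auto simp: s_def[abs_def])
  have "(\<lambda>k. \<Sum>K\<in>UNIV. weighted_inner (s k) (del p f K) (g K)) \<longlonglongrightarrow> (\<Sum>K\<in>UNIV. weighted_inner 1 (del p f K) (g K))"
    by (intro tendsto_sum weighted_inner_tendsto s fock_formsD(1)[OF f'(2)] fock_formsD(1)[OF g])
  moreover have "(\<lambda>k. of_real (s k) * (\<Sum>J\<in>UNIV. weighted_inner (s k) (f J) (euler_contract g J)))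
      \<longlonglongrightarrow> of_real 1 * (\<Sum>J\<in>UNIV. weighted_inner 1 (f J) (euler_contract g J))"
    by (intro tendsto_intros weighted_inner_tendsto s fock_formsD(1)[OF f'(1)] fock_formsD(1)[OF c])
  ultimately have "(\<Sum>K\<in>UNIV. weighted_inner 1 (del p f K) (g K)) = of_real 1 * (\<Sum>J\<in>UNIV. weighted_inner 1 (f J) (euler_contract g J))"
    unfolding weighted_pairing[OF s(2) f'(1) g] by (rule LIMSEQ_unique)
  then show ?thesis by (simp only: form_inner_eq[OF f'(1)] form_inner_eq[OF f'(2)] of_real_1 mult_1_left)
qed

text \<open>Testing against \<open>e\<^bsup>\<langle>z,a\<rangle>\<^esup> dz\<^sub>J\<close> evaluates the coefficients of \<open>g\<close> and \<open>h\<close> at the point \<open>a\<close>.\<close>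

lemma adjoint_eq_euler_contract:
  fixes g h :: "('n::{finite,linorder}) form"
  assumes g: "g \<in> fock_forms (p + 1)" and h: "h \<in> fock_forms p"
    and adj: "\<And>f. f \<in> dom_del p \<Longrightarrow> form_inner (p + 1) (del p f) g = form_inner p f h"
  shows "h = euler_contract g"
proof (intro ext)
  fix J :: "'n set" and a :: "(complex, 'n) vec"
  show "h J a = euler_contract g J a"
  proof (cases "card J = p")
    case False
    then show ?thesis using fock_formsD(2)[OF h False] euler_contract_zero[OF g False] by simp
  next
    case True
    define f :: "'n form" where "f = (\<lambda>I. if I = J then \<lambda>z. exp (cdot z a) else (\<lambda>_. 0))"
    have f: "f \<in> fock_forms p" using True by (intro fock_formsI) (auto simp: f_def exp_cdot_fock fock_zero)
    have del_f: "del p f K = (\<lambda>z. (\<Sum>j\<in>UNIV. wedge_coeff j J K * cnj (a $ j)) * exp (cdot z a))" for K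
    proof
      fix z
      have "(\<Sum>j\<in>UNIV. wedge_coeff j I K * dz_deriv j (f I) z)
          = (if I = J then (\<Sum>j\<in>UNIV. wedge_coeff j J K * cnj (a $ j)) * exp (cdot z a) else 0)" for I
        using dz_deriv_exp_cdot[of _ 1 a z] by (simp add: f_def dz_deriv_const sum_distrib_right mult.assoc)
      then show "del p f K z = (\<Sum>j\<in>UNIV. wedge_coeff j J K * cnj (a $ j)) * exp (cdot z a)"
        unfolding del_eq_sum[OF f] by simp
    qed
    have del_fock: "del p f \<in> fock_forms (p + 1)"
      using del_zero[OF f] by (intro fock_formsI) (simp_all add: del_f fock_cmult exp_cdot_fock)
    define c where "c = complex_of_real (gauss_mass TYPE('n) 1)"
    have "gauss_mass TYPE('n) 1 > 0" by (rule gauss_mass_pos) simp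
    then have c: "c \<noteq> 0" by (simp add: c_def)
    have inner: "weighted_inner 1 (\<lambda>z. exp (cdot z a)) g' = c * cnj (g' a)" if "g' \<in> fock" for g'
      using weighted_inner_exp_cdot[OF that] by (simp add: c_def)
    have "form_inner (p + 1) (del p f) g = (\<Sum>K\<in>UNIV. (\<Sum>j\<in>UNIV. wedge_coeff j J K * cnj (a $ j)) * (c * cnj (g K a)))"
      unfolding form_inner_eq[OF del_fock] del_f weighted_inner_cmult_left inner[OF fock_formsD(1)[OF g]] ..
    also have "\<dots> = c * cnj (euler_contract g J a)"
      by (simp add: euler_contract_eq_sum cnj_wedge_coeff sum_distrib_left sum_distrib_right mult_ac)
    finally have lhs: "form_inner (p + 1) (del p f) g = c * cnj (euler_contract g J a)" .
    have "form_inner p f h = (\<Sum>I\<in>UNIV. if I = J then weighted_inner 1 (\<lambda>z. exp (cdot z a)) (h I) else 0)"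
      unfolding form_inner_eq[OF f] by (intro sum.cong) (auto simp: f_def)
    also have "\<dots> = c * cnj (h J a)" by (simp add: inner fock_formsD(1)[OF h])
    finally show ?thesis using adj[of f] f del_fock lhs c by (simp add: dom_del_def)
  qed
qed

text \<open>The pairing identity shows that such \<open>g\<close> have an adjoint image; conversely
  the test forms identify any adjoint image with the contraction, which must then be square
  integrable.\<close>

lemma dom_del_adj_iff:
  "g \<in> dom_del_adj p \<longleftrightarrow> g \<in> fock_forms (p + 1) \<and> euler_contract g \<in> fock_forms p"
proof
  assume "g \<in> dom_del_adj p"
  then obtain h where "g \<in> fock_forms (p + 1)" "h \<in> fock_forms p"
    "\<And>f. f \<in> dom_del p \<Longrightarrow> form_inner (p + 1) (del p f) g = form_inner p f h"
    unfolding dom_del_adj_def by blast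
  then show "g \<in> fock_forms (p + 1) \<and> euler_contract g \<in> fock_forms p"
    using adjoint_eq_euler_contract by metis
next
  assume "g \<in> fock_forms (p + 1) \<and> euler_contract g \<in> fock_forms p"
  then show "g \<in> dom_del_adj p" unfolding dom_del_adj_def using form_inner_del by blast
qed

text \<open>Uniqueness, usually a consequence of the density of \<open>dom_del p\<close>, comes here
  from the test forms.\<close>

lemma del_adj_eq:
  assumes "g \<in> dom_del_adj p" shows "del_adj p g = euler_contract g"
  unfolding del_adj_def
proof (rule the_equality)
  have g: "g \<in> fock_forms (p + 1)" "euler_contract g \<in> fock_forms p" using assms by (auto simp: dom_del_adj_iff)
  show "euler_contract g \<in> fock_forms p \<and> (\<forall>f\<in>dom_del p. form_inner (p + 1) (del p f) g = form_inner p f (euler_contract g))"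
    using form_inner_del g by blast
  show "h = euler_contract g"
    if "h \<in> fock_forms p \<and> (\<forall>f\<in>dom_del p. form_inner (p + 1) (del p f) g = form_inner p f h)" for h
    using adjoint_eq_euler_contract[OF g(1)] that by blast
qed

text \<open>\<open>p \<ge> 1\<close> is needed for \<open>p - 1 + 1 = p\<close>. The description of
  \<open>del_adj (p - 1) f\<close> as a contraction is available only for \<open>f\<close> in its
  domain, hence the case distinction.\<close>

lemma dom_box_tilde_iff:
  assumes "p \<ge> 1"
  shows "f \<in> dom_box_tilde p \<longleftrightarrow> f \<in> fock_forms p \<and> del p f \<in> fock_forms (p + 1) \<and>
    euler_contract f \<in> fock_forms (p - 1) \<and> euler_contract (del p f) \<in> fock_forms p \<and>
    del (p - 1) (euler_contract f) \<in> fock_forms p"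
proof -
  have p: "p - 1 + 1 = p" using assms by simp
  have 1: "f \<in> dom_box_tilde p \<longleftrightarrow> (f \<in> dom_del p \<and> f \<in> dom_del_adj (p - 1)) \<and>
      del p f \<in> dom_del_adj p \<and> del_adj (p - 1) f \<in> dom_del (p - 1)"
    unfolding dom_box_tilde_def by blast
  have 2: "f \<in> dom_del p \<longleftrightarrow> f \<in> fock_forms p \<and> del p f \<in> fock_forms (p + 1)"
    unfolding dom_del_def by blast
  have 3: "f \<in> dom_del_adj (p - 1) \<longleftrightarrow> f \<in> fock_forms p \<and> euler_contract f \<in> fock_forms (p - 1)"
    unfolding dom_del_adj_iff p ..
  have 4: "euler_contract f \<in> dom_del (p - 1) \<longleftrightarrow> euler_contract f \<in> fock_forms (p - 1) \<and> del (p - 1) (euler_contract f) \<in> fock_forms p"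
    unfolding dom_del_def p by blast
  show ?thesis
  proof (cases "f \<in> dom_del_adj (p - 1)")
    case True
    show ?thesis using True unfolding 1 del_adj_eq[OF True] 2 3 4 dom_del_adj_iff[of "del p f"] by blast
  next
    case False
    then show ?thesis unfolding 1 3 by blast
  qed
qed

lemma box_tilde_eq:
  assumes "f \<in> dom_box_tilde p"
  shows "box_tilde p f J z = euler_contract (del p f) J z + del (p - 1) (euler_contract f) J z"
  using assms by (simp add: box_tilde_def form_add_def dom_box_tilde_def del_adj_eq)

section \<open>Cartan's formula and the box operator\<close>

text \<open>The first sum collects the terms where the adjoined index is the one differentiated, so
  that the sign is squared; in the others \<open>j\<close> has replaced some \<open>k\<close> in
  \<open>J\<close>.\<close>

lemma euler_contract_del:
  assumes f: "f \<in> fock_forms p"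
  shows "euler_contract (del p f) J z = (\<Sum>j\<in>- J. z $ j * dz_deriv j (f J) z)
    + (\<Sum>j\<in>- J. \<Sum>k\<in>J. wedge_sign j J * wedge_sign k (insert j J) * (z $ j * dz_deriv k (f (insert j (J - {k}))) z))"
proof -
  have "wedge_sign j J * (z $ j * del p f (insert j J) z) = z $ j * dz_deriv j (f J) z
      + (\<Sum>k\<in>J. wedge_sign j J * wedge_sign k (insert j J) * (z $ j * dz_deriv k (f (insert j (J - {k}))) z))"
    if j: "j \<in> - J" for j
  proof -
    have "del p f (insert j J) z = wedge_sign j J * dz_deriv j (f J) z
        + (\<Sum>k\<in>J. wedge_sign k (insert j J) * dz_deriv k (f (insert j (J - {k}))) z)"
    proof -
      have "insert j J - {k} = insert j (J - {k})" if "k \<in> J" for k using j that by auto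
      then have "(\<Sum>k\<in>J. wedge_sign k (insert j J) * dz_deriv k (f (insert j J - {k})) z)
          = (\<Sum>k\<in>J. wedge_sign k (insert j J) * dz_deriv k (f (insert j (J - {k}))) z)"
        by (intro sum.cong) auto
      moreover have "insert j J - {j} = J" "wedge_sign j (insert j J) = wedge_sign j J"
        using j by (auto simp: wedge_sign_insert)
      ultimately show ?thesis using j unfolding del_eq[OF f] by (subst sum.insert) auto
    qed
    then show ?thesis
      by (simp add: distrib_left sum_distrib_left wedge_sign_square mult.assoc mult.left_commute[of "z $ j"])
  qed
  then show ?thesis unfolding euler_contract_def by (simp add: sum.distrib)
qed

text \<open>In this order the derivative also falls on the coordinate: for each \<open>k\<close> in
  \<open>J\<close> the product rule leaves one copy of \<open>f J\<close>. This is the origin of the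
  zero order term, and so of the constant \<open>1 / p\<close>.\<close>

lemma del_euler_contract:
  assumes f: "f \<in> fock_forms p" and c: "euler_contract f \<in> fock_forms q"
  shows "del q (euler_contract f) J z = (\<Sum>j\<in>J. z $ j * dz_deriv j (f J) z) + of_nat (card J) * f J z
    + (\<Sum>k\<in>J. \<Sum>j\<in>- J. wedge_sign k J * wedge_sign j (J - {k}) * (z $ j * dz_deriv k (f (insert j (J - {k}))) z))"
proof -
  have ent: "entire (f I)" for I by (intro fock_entire fock_formsD(1)[OF f])
  have "wedge_sign k J * dz_deriv k (euler_contract f (J - {k})) z = z $ k * dz_deriv k (f J) z + f J z
      + (\<Sum>j\<in>- J. wedge_sign k J * wedge_sign j (J - {k}) * (z $ j * dz_deriv k (f (insert j (J - {k}))) z))"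
    if k: "k \<in> J" for k
  proof -
    let ?I = "J - {k}"
    have "dz_deriv k (euler_contract f ?I) z = (\<Sum>j\<in>- ?I. dz_deriv k (\<lambda>z. wedge_sign j ?I * (z $ j * f (insert j ?I) z)) z)"
      unfolding euler_contract_def by (intro dz_deriv_sum entire_cmult entire_coord_mult ent) simp
    also have "\<dots> = (\<Sum>j\<in>- ?I. wedge_sign j ?I * (z $ j * dz_deriv k (f (insert j ?I)) z + (if k = j then f (insert j ?I) z else 0)))"
      by (simp add: dz_deriv_cmult entire_coord_mult ent dz_deriv_coord_mult)
    also have "- ?I = insert k (- J)" by auto
    also have "(\<Sum>j\<in>insert k (- J). wedge_sign j ?I * (z $ j * dz_deriv k (f (insert j ?I)) z + (if k = j then f (insert j ?I) z else 0)))
        = wedge_sign k ?I * (z $ k * dz_deriv k (f (insert k ?I)) z + f (insert k ?I) z)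
          + (\<Sum>j\<in>- J. wedge_sign j ?I * (z $ j * dz_deriv k (f (insert j ?I)) z))"
    proof -
      have "(\<Sum>j\<in>- J. wedge_sign j ?I * (z $ j * dz_deriv k (f (insert j ?I)) z + (if k = j then f (insert j ?I) z else 0)))
          = (\<Sum>j\<in>- J. wedge_sign j ?I * (z $ j * dz_deriv k (f (insert j ?I)) z))"
        using k by (intro sum.cong) auto
      then show ?thesis using k by (subst sum.insert) auto
    qed
    also have "insert k ?I = J" using k by auto
    also have "wedge_sign k ?I = wedge_sign k J" using wedge_sign_insert[of k ?I k] k by (simp add: insert_absorb)
    finally show ?thesis
      by (simp add: distrib_left sum_distrib_left wedge_sign_square mult.assoc)
  qed
  then show ?thesis unfolding del_eq[OF c] by (simp add: sum.distrib)
qed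

text \<open>The mixed terms of the two compositions cancel by \<open>wedge_sign_swap\<close>, and
  the diagonal sums over \<open>J\<close> and its complement join to the full Euler
  operator.\<close>

lemma cartan_formula:
  assumes f: "f \<in> fock_forms p" and c: "euler_contract f \<in> fock_forms q"
  shows "euler_contract (del p f) J z + del q (euler_contract f) J z
    = (\<Sum>j\<in>UNIV. z $ j * dz_deriv j (f J) z) + of_nat (card J) * f J z"
proof -
  have "(\<Sum>k\<in>J. \<Sum>j\<in>- J. wedge_sign k J * wedge_sign j (J - {k}) * (z $ j * dz_deriv k (f (insert j (J - {k}))) z))
      = - (\<Sum>j\<in>- J. \<Sum>k\<in>J. wedge_sign j J * wedge_sign k (insert j J) * (z $ j * dz_deriv k (f (insert j (J - {k}))) z))"
    by (subst sum.swap) (simp add: wedge_sign_swap sum_negf[symmetric])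
  moreover have "(\<Sum>j\<in>UNIV. z $ j * dz_deriv j (f J) z) = (\<Sum>j\<in>J. z $ j * dz_deriv j (f J) z) + (\<Sum>j\<in>- J. z $ j * dz_deriv j (f J) z)"
    by (subst sum.union_disjoint[symmetric]) (auto simp: Compl_partition)
  ultimately show ?thesis
    unfolding euler_contract_del[OF f] del_euler_contract[OF f c] by simp
qed

text \<open>\<open>c\<^sup>p h(cz)\<close> has derivative zero in \<open>c\<close> if \<open>\<Sum>\<^sub>j z\<^sub>j \<partial>\<^sub>jh + p h = 0\<close>.\<close>

lemma euler_operator_inj:
  assumes h: "entire h" "entire h'" and p: "p \<ge> 1"
    and eq: "\<And>z. (\<Sum>j\<in>UNIV. z $ j * dz_deriv j h z) + of_nat p * h z = (\<Sum>j\<in>UNIV. z $ j * dz_deriv j h' z) + of_nat p * h' z"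
  shows "h = h'"
proof
  fix z
  define d where "d z = h z + (- 1) * h' z" for z
  have ent: "entire d" unfolding d_def by (intro entire_add entire_cmult h)
  have dd: "dz_deriv j d w = dz_deriv j h w - dz_deriv j h' w" for j w
    unfolding d_def dz_deriv_add[OF h(1) entire_cmult[OF h(2)]] dz_deriv_cmult[OF h(2)] by simp
  have d0: "(\<Sum>j\<in>UNIV. w $ j * dz_deriv j d w) + of_nat p * d w = 0" for w
    unfolding dd unfolding d_def using eq[of w] by (simp add: right_diff_distrib sum_subtractf algebra_simps)
  have "((\<lambda>c. c ^ p * d (c *s z)) has_field_derivative 0) (at c)" for c
  proof -
    obtain q where q: "p = Suc q" using p by (cases p) auto
    have "((\<lambda>c. c ^ p * d (c *s z)) has_field_derivative
        (of_nat p * c ^ q * d (c *s z) + c ^ p * (\<Sum>j\<in>UNIV. z $ j * dz_deriv j d (c *s z)))) (at c)"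
      using DERIV_mult[OF DERIV_power_Suc[OF DERIV_ident, of q] has_field_derivative_entire_line[OF ent, of z c]]
      by (simp add: q mult_ac)
    also have "of_nat p * c ^ q * d (c *s z) + c ^ p * (\<Sum>j\<in>UNIV. z $ j * dz_deriv j d (c *s z))
        = c ^ q * ((\<Sum>j\<in>UNIV. (c *s z) $ j * dz_deriv j d (c *s z)) + of_nat p * d (c *s z))"
      by (simp add: q algebra_simps sum_distrib_left)
    finally show ?thesis by (simp only: d0 mult_zero_right)
  qed
  then obtain k where k: "\<And>c. c ^ p * d (c *s z) = k"
    using has_field_derivative_zero_constant[of UNIV "\<lambda>c. c ^ p * d (c *s z)"] by auto
  have "d z = 0" using k[of 1] k[of 0] p by (simp add: power_0_left)
  then show "h z = h' z" by (simp add: d_def)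
qed

section \<open>The box operator on coefficients and its inverse\<close>

lemma box_tilde_coeff:
  assumes p: "p \<ge> 1" and f: "f \<in> dom_box_tilde p"
  shows "box_tilde p f J z = (if card J = p then (\<Sum>j\<in>UNIV. z $ j * dz_deriv j (f J) z) + of_nat p * f J z else 0)"
proof -
  have f': "f \<in> fock_forms p" "euler_contract f \<in> fock_forms (p - 1)" "euler_contract (del p f) \<in> fock_forms p"
    "del (p - 1) (euler_contract f) \<in> fock_forms p"
    using f dom_box_tilde_iff[OF p] by blast+
  show ?thesis
  proof (cases "card J = p")
    case True
    then show ?thesis using cartan_formula[OF f'(1,2), of J z] by (simp add: box_tilde_eq[OF f])
  next
    case False
    then show ?thesis
      using fock_formsD(2)[OF f'(3), of J] fock_formsD(2)[OF f'(4), of J] by (simp add: box_tilde_eq[OF f])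
  qed
qed

lemma box_tilde_in_fock_forms:
  assumes p: "p \<ge> 1" and f: "f \<in> dom_box_tilde p"
  shows "box_tilde p f \<in> fock_forms p"
proof -
  have f': "euler_contract (del p f) \<in> fock_forms p" "del (p - 1) (euler_contract f) \<in> fock_forms p"
    using f dom_box_tilde_iff[OF p] by blast+
  have "box_tilde p f J = (\<lambda>z. euler_contract (del p f) J z + del (p - 1) (euler_contract f) J z)" for J
    using box_tilde_eq[OF f] by auto
  then show ?thesis
    using fock_formsD[OF f'(1)] fock_formsD[OF f'(2)] by (intro fock_formsI) (auto intro: fock_add)
qed

lemma fock_forms_eqI:
  assumes "f \<in> fock_forms p" "g \<in> fock_forms p" "\<And>J. card J = p \<Longrightarrow> f J = g J"
  shows "f = g"
proof
  show "f J = g J" for J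
    using assms(3) fock_formsD(2)[OF assms(1), of J] fock_formsD(2)[OF assms(2), of J] by (cases "card J = p") auto
qed

lemma inj_on_box_tilde:
  assumes p: "p \<ge> 1"
  shows "inj_on (box_tilde p) (dom_box_tilde p :: ('n::{finite,linorder}) form set)"
proof (rule inj_onI)
  fix f g :: "'n form" assume fg: "f \<in> dom_box_tilde p" "g \<in> dom_box_tilde p" "box_tilde p f = box_tilde p g"
  have f: "f \<in> fock_forms p" and g: "g \<in> fock_forms p" using fg dom_box_tilde_iff[OF p] by blast+
  show "f = g"
  proof (rule fock_forms_eqI[OF f g])
    fix J :: "'n set" assume J: "card J = p"
    show "f J = g J"
    proof (rule euler_operator_inj[OF _ _ p])
      show "entire (f J)" "entire (g J)" using fock_formsD(1)[OF f] fock_formsD(1)[OF g] by (auto intro: fock_entire)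
      show "(\<Sum>j\<in>UNIV. z $ j * dz_deriv j (f J) z) + of_nat p * f J z = (\<Sum>j\<in>UNIV. z $ j * dz_deriv j (g J) z) + of_nat p * g J z" for z
        using box_tilde_coeff[OF p fg(1), of J z] box_tilde_coeff[OF p fg(2), of J z] fg(3) J by simp
    qed
  qed
qed

definition form_euler_inverse :: "nat \<Rightarrow> 'n form \<Rightarrow> ('n::{finite,linorder}) form" where
  "form_euler_inverse p u = (\<lambda>J. if card J = p then euler_inverse p (u J) else (\<lambda>_. 0))"

lemma
  fixes u :: "('n::{finite,linorder}) form"
  assumes p: "p \<ge> 1" and u: "u \<in> fock_forms p"
  shows form_euler_inverse_dom: "form_euler_inverse p u \<in> dom_box_tilde p"
    and box_tilde_form_euler_inverse: "box_tilde p (form_euler_inverse p u) = u"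
proof -
  define f where "f = form_euler_inverse p u"
  have uJ: "u J \<in> fock" for J by (rule fock_formsD(1)[OF u])
  have f: "f \<in> fock_forms p"
    by (intro fock_formsI) (simp_all add: f_def form_euler_inverse_def euler_inverse_fock[OF p uJ])
  have df: "dz_deriv k (f J) \<in> fock" for k J
    using euler_inverse_dz_deriv_fock[OF p uJ[of J], of k]
    by (simp add: fock_zero f_def form_euler_inverse_def dz_deriv_const[abs_def])
  have zf: "(\<lambda>z. z $ j * f J z) \<in> fock" for j J
    using euler_inverse_coord_fock[OF p uJ[of J], of j]
    by (simp add: fock_zero f_def form_euler_inverse_def)
  have zdf: "(\<lambda>z. z $ j * dz_deriv k (f J) z) \<in> fock" for j k J
    using euler_inverse_coord_dz_deriv_fock[OF p uJ[of J], of j k]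
    by (simp add: fock_zero f_def form_euler_inverse_def dz_deriv_const)
  have del_f: "del p f K = (\<lambda>z. \<Sum>j\<in>K. wedge_sign j K * dz_deriv j (f (K - {j})) z)" for K
    using del_eq[OF f] by auto
  have del_fock: "del p f \<in> fock_forms (p + 1)"
  proof (rule fock_formsI)
    show "del p f K \<in> fock" for K unfolding del_f by (intro fock_sum fock_cmult df) simp
  qed (rule del_zero[OF f])
  have contract_fock: "euler_contract f \<in> fock_forms (p - 1)"
  proof (rule fock_formsI)
    show "euler_contract f J \<in> fock" for J unfolding euler_contract_def by (intro fock_sum fock_cmult zf) simp
    show "euler_contract f J = (\<lambda>_. 0)" if "card J \<noteq> p - 1" for J
      using that f p by (intro euler_contract_zero) auto
  qed
  have cd: "euler_contract (del p f) \<in> fock_forms p"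
  proof (rule fock_formsI)
    have "(\<lambda>z. z $ j * del p f K z) \<in> fock" for j K
    proof -
      have "(\<lambda>z. z $ j * del p f K z) = (\<lambda>z. \<Sum>k\<in>K. wedge_sign k K * (z $ j * dz_deriv k (f (K - {k})) z))"
        unfolding del_f by (auto simp: sum_distrib_left mult.left_commute)
      also have "\<dots> \<in> fock" by (intro fock_sum fock_cmult zdf) simp
      finally show ?thesis .
    qed
    then show "euler_contract (del p f) J \<in> fock" for J
      unfolding euler_contract_def by (intro fock_sum fock_cmult) simp
    show "euler_contract (del p f) J = (\<lambda>_. 0)" if "card J \<noteq> p" for J
      using that by (intro euler_contract_zero[OF del_fock])
  qed
  have eq: "euler_contract (del p f) J z + del (p - 1) (euler_contract f) J z = u J z" if "card J = p" for J z
    using cartan_formula[OF f contract_fock, of J z] euler_inverse_eq[OF p uJ, of z J] that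
    by (simp add: f_def form_euler_inverse_def)
  \<comment> \<open>Estimating this directly would involve derivatives of products; by Cartan's
    formula it is \<open>u\<close> minus a form already known to have Fock coefficients.\<close>
  have dc: "del (p - 1) (euler_contract f) \<in> fock_forms p"
  proof (rule fock_formsI)
    fix J :: "'n set" assume "card J = p"
    then have eq': "del (p - 1) (euler_contract f) J = (\<lambda>z. u J z + (- 1) * euler_contract (del p f) J z)"
      using eq[of J] by (auto simp: algebra_simps)
    show "del (p - 1) (euler_contract f) J \<in> fock"
      unfolding eq' by (intro fock_add fock_cmult uJ fock_formsD(1)[OF cd])
  next
    fix J :: "'n set" assume "card J \<noteq> p"
    then show "del (p - 1) (euler_contract f) J = (\<lambda>_. 0)"
      using p by (intro del_zero[OF contract_fock]) simp
  qed
  show dom: "form_euler_inverse p u \<in> dom_box_tilde p"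
    using f del_fock contract_fock cd dc unfolding dom_box_tilde_iff[OF p] f_def by blast
  show "box_tilde p (form_euler_inverse p u) = u"
  proof (rule fock_forms_eqI[OF box_tilde_in_fock_forms[OF p dom] u])
    show "box_tilde p (form_euler_inverse p u) J = u J" if "card J = p" for J
      using eq[OF that] box_tilde_eq[OF dom] by (auto simp: f_def)
  qed
qed

section \<open>Norm bound and linearity of the inverse\<close>

lemma N_tilde_eq:
  assumes p: "p \<ge> 1" and u: "u \<in> fock_forms p"
  shows "N_tilde p u = form_euler_inverse p u"
  using inv_into_f_f[OF inj_on_box_tilde[OF p] form_euler_inverse_dom[OF p u]]
  by (simp add: N_tilde_def box_tilde_form_euler_inverse[OF p u])

lemma form_norm_N_tilde_le:
  assumes p: "p \<ge> 1" and u: "u \<in> fock_forms p"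
  shows "form_norm p (N_tilde p u) \<le> 1 / real p * form_norm p u"
proof -
  have norm: "form_norm p f = sqrt (\<Sum>J | card J = p. weighted_norm2 1 (f J))" for f :: "'a form"
    by (simp add: form_norm_def fock_norm_eq weighted_norm2_nonneg)
  have "(\<Sum>J | card J = p. weighted_norm2 1 (N_tilde p u J)) \<le> (\<Sum>J | card J = p. weighted_norm2 1 (u J) / (real p)\<^sup>2)"
    unfolding N_tilde_eq[OF p u]
    by (intro sum_mono) (simp add: form_euler_inverse_def euler_inverse_norm[OF p fock_formsD(1)[OF u]])
  also have "\<dots> = (\<Sum>J | card J = p. weighted_norm2 1 (u J)) / (real p)\<^sup>2"
    by (rule sum_divide_distrib[symmetric])
  finally have "form_norm p (N_tilde p u) \<le> sqrt ((\<Sum>J | card J = p. weighted_norm2 1 (u J)) / (real p)\<^sup>2)"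
    unfolding norm by (rule real_sqrt_le_mono)
  then show ?thesis by (simp add: norm real_sqrt_divide)
qed

text \<open>Both sides solve the same equation, so injectivity of \<open>E + p\<close> replaces a
  manipulation of the integrals.\<close>

lemma euler_inverse_add:
  assumes p: "p \<ge> 1" and u: "u \<in> fock" and v: "v \<in> fock"
  shows "euler_inverse p (\<lambda>z. u z + v z) = (\<lambda>z. euler_inverse p u z + euler_inverse p v z)"
proof (rule euler_operator_inj[OF _ _ p])
  note ent = euler_inverse_entire[OF p u] euler_inverse_entire[OF p v]
  show "entire (euler_inverse p (\<lambda>z. u z + v z))" by (rule euler_inverse_entire[OF p fock_add[OF u v]])
  show "entire (\<lambda>z. euler_inverse p u z + euler_inverse p v z)" by (rule entire_add[OF ent])
  fix z
  have "u z + v z = ((\<Sum>j\<in>UNIV. z $ j * dz_deriv j (euler_inverse p u) z) + of_nat p * euler_inverse p u z)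
      + ((\<Sum>j\<in>UNIV. z $ j * dz_deriv j (euler_inverse p v) z) + of_nat p * euler_inverse p v z)"
    by (simp only: euler_inverse_eq[OF p u] euler_inverse_eq[OF p v])
  then show "(\<Sum>j\<in>UNIV. z $ j * dz_deriv j (euler_inverse p (\<lambda>z. u z + v z)) z) + of_nat p * euler_inverse p (\<lambda>z. u z + v z) z
      = (\<Sum>j\<in>UNIV. z $ j * dz_deriv j (\<lambda>z. euler_inverse p u z + euler_inverse p v z) z)
        + of_nat p * (euler_inverse p u z + euler_inverse p v z)"
    unfolding euler_inverse_eq[OF p fock_add[OF u v]] dz_deriv_add[OF ent]
    by (simp add: distrib_left sum.distrib)
qed

lemma euler_inverse_cmult:
  assumes p: "p \<ge> 1" and u: "u \<in> fock"
  shows "euler_inverse p (\<lambda>z. c * u z) = (\<lambda>z. c * euler_inverse p u z)"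
proof (rule euler_operator_inj[OF _ _ p])
  note ent = euler_inverse_entire[OF p u]
  show "entire (euler_inverse p (\<lambda>z. c * u z))" by (rule euler_inverse_entire[OF p fock_cmult[OF u]])
  show "entire (\<lambda>z. c * euler_inverse p u z)" by (rule entire_cmult[OF ent])
  show "(\<Sum>j\<in>UNIV. z $ j * dz_deriv j (euler_inverse p (\<lambda>z. c * u z)) z) + of_nat p * euler_inverse p (\<lambda>z. c * u z) z
      = (\<Sum>j\<in>UNIV. z $ j * dz_deriv j (\<lambda>z. c * euler_inverse p u z) z) + of_nat p * (c * euler_inverse p u z)" for z
    unfolding euler_inverse_eq[OF p fock_cmult[OF u]] dz_deriv_cmult[OF ent]
    unfolding euler_inverse_eq[OF p u, of z, symmetric] by (simp add: distrib_left sum_distrib_left mult.left_commute)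
qed

lemma fock_forms_add: "u \<in> fock_forms p \<Longrightarrow> v \<in> fock_forms p \<Longrightarrow> form_add u v \<in> fock_forms p"
  using fock_formsD[of u p] fock_formsD[of v p] by (intro fock_formsI) (simp_all add: form_add_def fock_add)

lemma fock_forms_scale: "u \<in> fock_forms p \<Longrightarrow> form_scale c u \<in> fock_forms p"
  using fock_formsD[of u p] by (intro fock_formsI) (simp_all add: form_scale_def fock_cmult)

lemma bounded_operator_N_tilde:
  assumes p: "p \<ge> 1"
  shows "bounded_operator p (N_tilde p :: ('n::{finite,linorder}) form \<Rightarrow> 'n form)"
  unfolding bounded_operator_def
proof (intro conjI ballI allI)
  show "N_tilde p ` fock_forms p \<subseteq> (fock_forms p :: 'n form set)"
    using form_euler_inverse_dom[OF p] dom_box_tilde_iff[OF p] by (auto simp: N_tilde_eq[OF p])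
  show "\<exists>C. \<forall>u\<in>fock_forms p. form_norm p (N_tilde p (u :: 'n form)) \<le> C * form_norm p u"
    using form_norm_N_tilde_le[OF p] by blast
next
  fix u v :: "'n form" assume u: "u \<in> fock_forms p" and v: "v \<in> fock_forms p"
  show "N_tilde p (form_add u v) = form_add (N_tilde p u) (N_tilde p v)"
    unfolding N_tilde_eq[OF p u] N_tilde_eq[OF p v] N_tilde_eq[OF p fock_forms_add[OF u v]]
    using euler_inverse_add[OF p fock_formsD(1)[OF u] fock_formsD(1)[OF v]]
    by (auto simp: form_euler_inverse_def form_add_def fun_eq_iff)
next
  fix c and u :: "'n form" assume u: "u \<in> fock_forms p"
  show "N_tilde p (form_scale c u) = form_scale c (N_tilde p u)"
    unfolding N_tilde_eq[OF p u] N_tilde_eq[OF p fock_forms_scale[OF u]]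
    using euler_inverse_cmult[OF p fock_formsD(1)[OF u]]
    by (auto simp: form_euler_inverse_def form_scale_def fun_eq_iff)
qed

theorem theorem4p3:
  fixes p :: nat
  assumes "1 \<le> p" and "p \<le> CARD('n::{finite,linorder}) - 1"
  shows "bij_betw (box_tilde p) (dom_box_tilde p :: 'n form set) (fock_forms p) \<and>
    bounded_operator p (N_tilde p :: 'n form \<Rightarrow> 'n form) \<and>
    (\<forall>u \<in> (fock_forms p :: 'n form set). form_norm p (N_tilde p u) \<le> 1 / real p * form_norm p u)"
proof (intro conjI ballI)
  have "box_tilde p ` dom_box_tilde p = (fock_forms p :: 'n form set)"
  proof (intro equalityI subsetI)
    show "u \<in> box_tilde p ` dom_box_tilde p" if "u \<in> fock_forms p" for u :: "'n form"
      using form_euler_inverse_dom[OF assms(1) that] box_tilde_form_euler_inverse[OF assms(1) that] by (metis imageI)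
  qed (use box_tilde_in_fock_forms[OF assms(1)] in auto)
  then show "bij_betw (box_tilde p) (dom_box_tilde p :: 'n form set) (fock_forms p)"
    using inj_on_box_tilde[OF assms(1)] by (simp add: bij_betw_def)
  show "bounded_operator p (N_tilde p :: 'n form \<Rightarrow> 'n form)"
    by (rule bounded_operator_N_tilde[OF assms(1)])
  show "form_norm p (N_tilde p u) \<le> 1 / real p * form_norm p u" if "u \<in> fock_forms p" for u :: "'n form"
    by (rule form_norm_N_tilde_le[OF assms(1) that])
qed

end
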